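(* Fix rational numbers $\beta,\gamma$ such that $\beta\neq\gamma$ and $|\beta+\gamma|>2$. For any positive integer $\Delta$, there is a fully polynomial-time (deterministic) approximation scheme (FPTAS) for $Z_G$, where the input graph $G$ has maximum degree at most $\Delta$. Without the bounded degree requirement, there is a quasi-polynomial time approximation scheme for $Z_G$.
   Context: Graphs are finite undirected multigraphs, possibly with self-loops and parallel edges. For fixed $\beta,\gamma$, let $A=\begin{bmatrix}\beta&1\\1&\gamma\end{bmatrix}$ and for a graph $G=(V,E)$ define $Z_G=\sum_{\sigma\in\{0,1\}^V}\prod_{\{u,v\}\in E}A_{\sigma(u),\sigma(v)}$. *)

theory Defs
  imports
    Complex_Main
    "HOL-Library.Multiset"
    "HOL-Library.FuncSet"
    "HOL-Library.Uprod"
begin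

record 'a multigraph =
  verts :: "'a set"
  edges :: "'a uprod multiset"

definition wf_multigraph :: "'a multigraph \<Rightarrow> bool" where
  "wf_multigraph G \<longleftrightarrow>
     finite (verts G) \<and> (\<forall>e \<in># edges G. set_uprod e \<subseteq> verts G)"

text \<open>A self-loop contributes 2 to the degree of its vertex.\<close>

definition vertex_degree :: "'a multigraph \<Rightarrow> 'a \<Rightarrow> nat" where
  "vertex_degree G v =
     size {#e \<in># edges G. v \<in> set_uprod e#} + size {#e \<in># edges G. e = Upair v v#}"

definition max_degree_le :: "'a multigraph \<Rightarrow> nat \<Rightarrow> bool" where
  "max_degree_le G \<Delta> \<longleftrightarrow> (\<forall>v \<in> verts G. vertex_degree G v \<le> \<Delta>)"

definition interaction :: "rat \<Rightarrow> rat \<Rightarrow> nat \<Rightarrow> nat \<Rightarrow> rat" where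
  "interaction \<beta> \<gamma> i j =
     (if i = 0 \<and> j = 0 then \<beta> else if i = 1 \<and> j = 1 then \<gamma> else 1)"

lift_definition edge_weight :: "rat \<Rightarrow> rat \<Rightarrow> ('a \<Rightarrow> nat) \<Rightarrow> 'a uprod \<Rightarrow> rat" is
  "\<lambda>\<beta> \<gamma> \<sigma> (u, v). interaction \<beta> \<gamma> (\<sigma> u) (\<sigma> v)"
  by (auto simp: interaction_def)

lemma edge_weight_Upair [simp]:
  "edge_weight \<beta> \<gamma> \<sigma> (Upair u v) = interaction \<beta> \<gamma> (\<sigma> u) (\<sigma> v)"
  by transfer simp

definition partition_function :: "rat \<Rightarrow> rat \<Rightarrow> 'a multigraph \<Rightarrow> rat" where
  "partition_function \<beta> \<gamma> G =
     (\<Sum>\<sigma> \<in> verts G \<rightarrow>\<^sub>E {0, 1}. \<Prod>e \<in># edges G. edge_weight \<beta> \<gamma> \<sigma> e)"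

text \<open>
  Algorithms are programs of a first-order, call-by-value functional language whose only data are
  binary trees over a single atom (as in Jones's languages F and WHILE).  A program is a list of
  function bodies, called by position; function 0 is the entry point, and variables are de Bruijn
  indices into the current environment.  Every evaluation rule costs one step.  No rule copies or
  compares trees, so with trees represented by shared pointers one step is a constant number of
  machine operations, and running times agree with those of Turing machines up to a polynomial.
\<close>

datatype data = Atom | Cell data data

fun cells :: "data \<Rightarrow> nat" where
  "cells Atom = 0"
| "cells (Cell x y) = Suc (cells x + cells y)"

fun left :: "data \<Rightarrow> data" where
  "left Atom = Atom"
| "left (Cell x y) = x"

fun right :: "data \<Rightarrow> data" where
  "right Atom = Atom"
| "right (Cell x y) = y"

datatype expr =
    Var nat
  | Nil_E
  | Cons_E expr expr
  | Hd_E expr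
  | Tl_E expr
  | If_E expr expr expr
  | Let_E expr expr
  | Call_E nat "expr list"

type_synonym program = "expr list"

inductive
  eval :: "program \<Rightarrow> data list \<Rightarrow> expr \<Rightarrow> nat \<Rightarrow> data \<Rightarrow> bool" and
  evals :: "program \<Rightarrow> data list \<Rightarrow> expr list \<Rightarrow> nat \<Rightarrow> data list \<Rightarrow> bool"
  for p :: program
where
  eval_Var: "i < length env \<Longrightarrow> eval p env (Var i) 1 (env ! i)"
| eval_Nil: "eval p env Nil_E 1 Atom"
| eval_Cons: "eval p env a s x \<Longrightarrow> eval p env b t y \<Longrightarrow>
    eval p env (Cons_E a b) (s + t + 1) (Cell x y)"
| eval_Hd: "eval p env a t x \<Longrightarrow> eval p env (Hd_E a) (t + 1) (left x)"
| eval_Tl: "eval p env a t x \<Longrightarrow> eval p env (Tl_E a) (t + 1) (right x)"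
| eval_If_true: "eval p env c s x \<Longrightarrow> x \<noteq> Atom \<Longrightarrow> eval p env a t y \<Longrightarrow>
    eval p env (If_E c a b) (s + t + 1) y"
| eval_If_false: "eval p env c s Atom \<Longrightarrow> eval p env b t y \<Longrightarrow>
    eval p env (If_E c a b) (s + t + 1) y"
| eval_Let: "eval p env a s x \<Longrightarrow> eval p (x # env) b t y \<Longrightarrow>
    eval p env (Let_E a b) (s + t + 1) y"
| eval_Call: "evals p env as s xs \<Longrightarrow> f < length p \<Longrightarrow> eval p xs (p ! f) t y \<Longrightarrow>
    eval p env (Call_E f as) (s + t + 1) y"
| evals_Nil: "evals p env [] 0 []"
| evals_Cons: "eval p env a s x \<Longrightarrow> evals p env as t xs \<Longrightarrow>
    evals p env (a # as) (s + t) (x # xs)"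

definition runs :: "program \<Rightarrow> data \<Rightarrow> nat \<Rightarrow> data \<Rightarrow> bool" where
  "runs p x t y \<longleftrightarrow> p \<noteq> [] \<and> eval p [x] (p ! 0) t y"

inductive_cases eval_VarE: "eval p env (Var i) t y"
inductive_cases eval_NilE: "eval p env Nil_E t y"
inductive_cases eval_ConsE: "eval p env (Cons_E a b) t y"
inductive_cases eval_HdE: "eval p env (Hd_E a) t y"
inductive_cases eval_TlE: "eval p env (Tl_E a) t y"
inductive_cases eval_IfE: "eval p env (If_E c a b) t y"
inductive_cases eval_LetE: "eval p env (Let_E a b) t y"
inductive_cases eval_CallE: "eval p env (Call_E f as) t y"
inductive_cases evals_NilE: "evals p env [] t ys"
inductive_cases evals_ConsE: "evals p env (a # as) t ys"

lemma eval_deterministic: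
  "eval p env e t y \<Longrightarrow> eval p env e t' y' \<Longrightarrow> t = t' \<and> y = y'"
  "evals p env es t ys \<Longrightarrow> evals p env es t' ys' \<Longrightarrow> t = t' \<and> ys = ys'"
proof (induction arbitrary: t' y' and t' ys' rule: eval_evals.inducts)
  case (eval_Var i env)
  from eval_Var.prems show ?case by (rule eval_VarE) simp
next
  case (eval_Nil env)
  from eval_Nil.prems show ?case by (rule eval_NilE) simp
next
  case (eval_Cons env a s x b t y)
  from eval_Cons.prems show ?case
  proof (rule eval_ConsE)
    fix s2 x2 t2 y2
    assume *: "t' = Suc (s2 + t2)" "y' = Cell x2 y2" "eval p env a s2 x2" "eval p env b t2 y2"
    from eval_Cons.IH(2)[OF *(3)] eval_Cons.IH(4)[OF *(4)] *(1,2) show ?thesis by simp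
  qed
next
  case (eval_Hd env a t x)
  from eval_Hd.prems show ?case
  proof (rule eval_HdE)
    fix t2 x2
    assume *: "t' = Suc t2" "y' = left x2" "eval p env a t2 x2"
    from eval_Hd.IH(2)[OF *(3)] *(1,2) show ?thesis by simp
  qed
next
  case (eval_Tl env a t x)
  from eval_Tl.prems show ?case
  proof (rule eval_TlE)
    fix t2 x2
    assume *: "t' = Suc t2" "y' = right x2" "eval p env a t2 x2"
    from eval_Tl.IH(2)[OF *(3)] *(1,2) show ?thesis by simp
  qed
next
  case (eval_If_true env c s x a t y b)
  from eval_If_true.prems show ?case
  proof (rule eval_IfE)
    fix s2 x2 t2
    assume *: "t' = Suc (s2 + t2)" "eval p env c s2 x2" "eval p env a t2 y'"
    from eval_If_true.IH(2)[OF *(2)] eval_If_true.IH(4)[OF *(3)] *(1) show ?thesis by simp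
  next
    fix s2 t2
    assume "eval p env c s2 Atom"
    from eval_If_true.IH(2)[OF this] eval_If_true.hyps show ?thesis by simp
  qed
next
  case (eval_If_false env c s b t y a)
  from eval_If_false.prems show ?case
  proof (rule eval_IfE)
    fix s2 x2 t2
    assume "eval p env c s2 x2" "x2 \<noteq> Atom"
    from eval_If_false.IH(2)[OF this(1)] this(2) show ?thesis by simp
  next
    fix s2 t2
    assume *: "t' = Suc (s2 + t2)" "eval p env c s2 Atom" "eval p env b t2 y'"
    from eval_If_false.IH(2)[OF *(2)] eval_If_false.IH(4)[OF *(3)] *(1) show ?thesis by simp
  qed
next
  case (eval_Let env a s x b t y)
  from eval_Let.prems show ?case
  proof (rule eval_LetE)
    fix s2 x2 t2
    assume *: "t' = Suc (s2 + t2)" "eval p env a s2 x2" "eval p (x2 # env) b t2 y'"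
    from eval_Let.IH(2)[OF *(2)] have "s = s2" "x = x2" by simp_all
    with eval_Let.IH(4) * show ?thesis by simp
  qed
next
  case (eval_Call env as s xs f t y)
  from eval_Call.prems show ?case
  proof (rule eval_CallE)
    fix s2 xs2 t2
    assume *: "t' = Suc (s2 + t2)" "evals p env as s2 xs2" "eval p xs2 (p ! f) t2 y'"
    from eval_Call.IH(2)[OF *(2)] have "s = s2" "xs = xs2" by simp_all
    with eval_Call.IH(5) * show ?thesis by simp
  qed
next
  case (evals_Nil env)
  from evals_Nil.prems show ?case by (rule evals_NilE) simp
next
  case (evals_Cons env a s x as t xs)
  from evals_Cons.prems show ?case
  proof (rule evals_ConsE)
    fix s2 x2 t2 xs2
    assume *: "t' = s2 + t2" "ys' = x2 # xs2" "eval p env a s2 x2" "evals p env as t2 xs2"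
    from evals_Cons.IH(2)[OF *(3)] evals_Cons.IH(4)[OF *(4)] *(1,2) show ?thesis by simp
  qed
qed

lemma runs_deterministic: "runs p x t y \<Longrightarrow> runs p x t' y' \<Longrightarrow> t = t' \<and> y = y'"
  unfolding runs_def using eval_deterministic(1) by blast

definition bool_code :: "bool \<Rightarrow> data" where
  "bool_code b = (if b then Cell Atom Atom else Atom)"

definition list_code :: "('a \<Rightarrow> data) \<Rightarrow> 'a list \<Rightarrow> data" where
  "list_code c xs = foldr (\<lambda>x. Cell (c x)) xs Atom"

fun bits :: "nat \<Rightarrow> bool list" where
  "bits n = (if n = 0 then [] else odd n # bits (n div 2))"

declare bits.simps [simp del]

definition nat_code :: "nat \<Rightarrow> data" where
  "nat_code n = list_code bool_code (bits n)"

definition int_code :: "int \<Rightarrow> data" where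
  "int_code i = Cell (bool_code (i < 0)) (nat_code (nat \<bar>i\<bar>))"

text \<open>
  A rational number may be presented by any fraction with positive denominator, and a graph by any
  enumeration of its vertices and edges; hence these encodings are relations.
\<close>

definition encodes_rat :: "rat \<Rightarrow> data \<Rightarrow> bool" where
  "encodes_rat q x \<longleftrightarrow>
     (\<exists>a b. b > 0 \<and> q = of_int a / of_nat b \<and> x = Cell (int_code a) (nat_code b))"

definition encodes_graph :: "nat multigraph \<Rightarrow> data \<Rightarrow> bool" where
  "encodes_graph G x \<longleftrightarrow>
     (\<exists>vs es. distinct vs \<and> set vs = verts G \<and>
        mset (map (\<lambda>(u, v). Upair u v) es) = edges G \<and>
        x = Cell (list_code nat_code vs)
                 (list_code (\<lambda>(u, v). Cell (nat_code u) (nat_code v)) es))"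

definition approximates_within ::
    "program \<Rightarrow> (nat multigraph \<Rightarrow> rat) \<Rightarrow> nat multigraph set \<Rightarrow> (nat \<Rightarrow> real \<Rightarrow> real) \<Rightarrow> bool"
where
  "approximates_within p F \<G> T \<longleftrightarrow>
     (\<forall>G \<in> \<G>. \<forall>\<epsilon> > 0. \<forall>g r. encodes_graph G g \<longrightarrow> encodes_rat \<epsilon> r \<longrightarrow>
        (\<exists>t y z. runs p (Cell g r) t y \<and>
           real t \<le> T (cells (Cell g r)) (1 / of_rat \<epsilon>) \<and>
           encodes_rat z y \<and> \<bar>z - F G\<bar> \<le> \<epsilon> * \<bar>F G\<bar>))"

text \<open>
  The size \<open>n\<close> of the whole input (graph and accuracy) and the inverse accuracy \<open>s\<close> satisfy
  \<open>n + s > 1\<close>, so \<open>c * (n + s) ^ k\<close> majorizes every polynomial in \<open>n\<close> and \<open>s\<close>.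
\<close>

definition has_FPTAS :: "(nat multigraph \<Rightarrow> rat) \<Rightarrow> nat multigraph set \<Rightarrow> bool" where
  "has_FPTAS F \<G> \<longleftrightarrow>
     (\<exists>p c k. approximates_within p F \<G> (\<lambda>n s. c * (real n + s) ^ k))"

definition has_QPTAS :: "(nat multigraph \<Rightarrow> rat) \<Rightarrow> nat multigraph set \<Rightarrow> bool" where
  "has_QPTAS F \<G> \<longleftrightarrow>
     (\<exists>p c k. approximates_within p F \<G> (\<lambda>n s. 2 powr (c * log 2 (real n + s) ^ k)))"

end

theory Submission
  imports Defs "HOL-Complex_Analysis.Complex_Analysis"
begin

text \<open>
  Flipping all spins exchanges \<open>\<beta>\<close> and \<open>\<gamma>\<close>, so assume \<open>\<bar>\<beta>\<bar> > \<bar>\<gamma>\<bar>\<close>.  Attach a variable \<open>x\<close> to every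
  half-edge whose endpoint has spin 1, so that the edge weights become \<open>\<beta>, x, x, \<gamma> x\<^sup>2\<close>.  Since
  \<open>\<bar>\<beta> + \<gamma>\<bar> > 2\<close>, the polynomial \<open>\<beta> + a + b + \<gamma> a b\<close> has no zero with \<open>\<bar>a\<bar>, \<bar>b\<bar> \<le> \<rho>\<close> for some
  \<open>\<rho> > 1\<close>, and Asano contractions carry this over to all graphs: every ratio
  \<open>R\<^sub>v = Z[\<sigma>(v) = 1] / Z[\<sigma>(v) = 0]\<close>, with any set of vertices pinned to 0, is holomorphic and bounded
  by 1 in the disc \<open>\<bar>x\<bar> < \<rho>\<close>.  Pinning the vertices to 0 one after the other gives
  \<open>Z = \<beta>\<^bsup>|E|\<^esup> \<Prod> (1 + R\<^sub>v)\<close>, where by Cauchy's estimate each \<open>R\<^sub>v(1)\<close> may be replaced by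
  a partial sum of its Taylor series of length \<open>O(log (n / \<epsilon>))\<close>.

  The Taylor coefficients come from a recursion in the style of Weitz, run on power series instead of
  numbers: splitting \<open>v\<close> into one copy per incident edge shows that \<open>R\<^sub>v\<close> is a product of factors
  \<open>x (1 + \<gamma> x R\<^sub>u) / (\<beta> + x R\<^sub>u)\<close>, where \<open>R\<^sub>u\<close> refers to the graph without \<open>v\<close> and with some neighbours
  of \<open>v\<close> pinned (to 0 or to 1, which is harmless for formal series).  As each factor gains a power of
  \<open>x\<close>, the first \<open>k\<close> coefficients need recursion depth \<open>k\<close> only, hence \<open>\<Delta>\<^sup>k\<close> calls: polynomially many
  for bounded degree and quasi-polynomially many in general.  With \<open>1 / \<beta> = a / D\<close>, \<open>\<gamma> = g / D\<close> and
  \<open>x = D y\<close> all coefficients are integers.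
\<close>

section \<open>Evaluation as a partial function\<close>

text \<open>The margin \<rho> > 1 is used twice. It makes x = 1 an interior point of the disc, so
  that Taylor tails decay geometrically; and at x = 1 it gives |R_v| \<le> 1/\<rho> unless v is
  isolated (then R_v = 1), so that 1 + R_v stays away from 0 and absolute errors become relative
  ones. Counting half-edges gives a vertex of degree d the field x^d against the admissible radius
  \<rho>^d, and thus a disc that does not shrink with the degree.

  Analysis and recursion share only the normalised sums over spin-1 sets. The analysis always sees
  the whole graph and pins by leaving vertices out of the summation; the program deletes vertices
  and records pins instead. Agreement of the two weights on all remaining configurations is the link
  between them.

  As time is counted in machine steps, coefficient sizes matter too. A weighted norm whose unit ball
  is preserved by the recursion keeps bit lengths linear in the truncation order, and this order is
  itself read off from the bit lengths of the input, so that no logarithm has to be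
  computed.\<close>

definition ev :: "program \<Rightarrow> data list \<Rightarrow> expr \<Rightarrow> (nat \<times> data) option" where
  "ev p env e =
     (if \<exists>r. eval p env e (fst r) (snd r) then Some (THE r. eval p env e (fst r) (snd r)) else None)"

definition evs :: "program \<Rightarrow> data list \<Rightarrow> expr list \<Rightarrow> (nat \<times> data list) option" where
  "evs p env es =
     (if \<exists>r. evals p env es (fst r) (snd r) then Some (THE r. evals p env es (fst r) (snd r)) else None)"

lemma ev_eq_Some_iff: "ev p env e = Some (t, y) \<longleftrightarrow> eval p env e t y"
proof -
  have u: "(THE r. eval p env e (fst r) (snd r)) = (t, y)" if "eval p env e t y" for t y
    using that by (intro the_equality) (auto dest: eval_deterministic(1))
  show ?thesis
    unfolding ev_def using u by (force split: if_splits)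
qed

lemma evs_eq_Some_iff: "evs p env es = Some (t, ys) \<longleftrightarrow> evals p env es t ys"
proof -
  have u: "(THE r. evals p env es (fst r) (snd r)) = (t, ys)" if "evals p env es t ys" for t ys
    using that by (intro the_equality) (auto dest: eval_deterministic(2))
  show ?thesis
    unfolding evs_def using u by (force split: if_splits)
qed

definition call :: "program \<Rightarrow> nat \<Rightarrow> data list \<Rightarrow> (nat \<times> data) option" where
  "call p f xs = (if f < length p then ev p xs (p ! f) else None)"

lemma option_pair_eqI:
  assumes "\<And>t y. u = Some (t, y) \<longleftrightarrow> v = Some (t, y)"
  shows "u = v"
  using assms by (metis not_Some_eq surj_pair)

lemma eval_iff:
  "eval p env (Var i) r z \<longleftrightarrow> i < length env \<and> r = 1 \<and> z = env ! i"
  "eval p env Nil_E r z \<longleftrightarrow> r = 1 \<and> z = Atom"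
  "eval p env (Cons_E a b) r z \<longleftrightarrow>
     (\<exists>s t x y. eval p env a s x \<and> eval p env b t y \<and> r = s + t + 1 \<and> z = Cell x y)"
  "eval p env (Hd_E a) r z \<longleftrightarrow> (\<exists>t x. eval p env a t x \<and> r = t + 1 \<and> z = left x)"
  "eval p env (Tl_E a) r z \<longleftrightarrow> (\<exists>t x. eval p env a t x \<and> r = t + 1 \<and> z = right x)"
  "eval p env (If_E c a b) r z \<longleftrightarrow>
     (\<exists>s t x. eval p env c s x \<and> eval p env (if x = Atom then b else a) t z \<and> r = s + t + 1)"
  "eval p env (Let_E a b) r z \<longleftrightarrow>
     (\<exists>s t x. eval p env a s x \<and> eval p (x # env) b t z \<and> r = s + t + 1)"
  "eval p env (Call_E f as) r z \<longleftrightarrow>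
     (\<exists>s t xs. evals p env as s xs \<and> f < length p \<and> eval p xs (p ! f) t z \<and> r = s + t + 1)"
  "evals p env [] r zs \<longleftrightarrow> r = 0 \<and> zs = []"
  "evals p env (a # as) r zs \<longleftrightarrow>
     (\<exists>s t x xs. eval p env a s x \<and> evals p env as t xs \<and> r = s + t \<and> zs = x # xs)"
proof -
  show "eval p env (If_E c a b) r z \<longleftrightarrow>
     (\<exists>s t x. eval p env c s x \<and> eval p env (if x = Atom then b else a) t z \<and> r = s + t + 1)" (is "?L \<longleftrightarrow> ?R")
  proof
    assume ?L then show ?R
    proof (rule eval_IfE)
      fix s x t assume "r = Suc (s + t)" "eval p env c s x" "x \<noteq> Atom" "eval p env a t z"
      then show ?R by (intro exI[of _ s] exI[of _ t] exI[of _ x]) simp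
    next
      fix s t assume "r = Suc (s + t)" "eval p env c s Atom" "eval p env b t z"
      then show ?R by (intro exI[of _ s] exI[of _ t] exI[of _ Atom]) simp
    qed
  next
    assume ?R
    then obtain s t x where h: "eval p env c s x" "eval p env (if x = Atom then b else a) t z" "r = s + t + 1"
      by blast
    then show ?L
      by (cases "x = Atom") (auto intro: eval_If_true[simplified] eval_If_false[simplified])
  qed
qed (auto elim!: eval_VarE eval_NilE eval_ConsE eval_HdE eval_TlE eval_LetE eval_CallE evals_NilE evals_ConsE intro: eval_evals.intros eval_evals.intros[simplified])

lemmas ev_iff = eval_iff[folded ev_eq_Some_iff evs_eq_Some_iff]

text \<open>Determinism makes evaluation a partial function, so its rules become equations. The
  simplifier runs a body symbolically until it meets a \<open>call\<close>, which the cost lemma of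
  the callee rewrites.\<close>

lemma ev_simps:
  "ev p env (Var i) = (if i < length env then Some (1, env ! i) else None)"
  "ev p env Nil_E = Some (1, Atom)"
  "ev p env (Cons_E a b) =
     (case ev p env a of None \<Rightarrow> None | Some (s, x) \<Rightarrow>
       (case ev p env b of None \<Rightarrow> None | Some (t, y) \<Rightarrow> Some (s + t + 1, Cell x y)))"
  "ev p env (Hd_E a) = (case ev p env a of None \<Rightarrow> None | Some (t, x) \<Rightarrow> Some (t + 1, left x))"
  "ev p env (Tl_E a) = (case ev p env a of None \<Rightarrow> None | Some (t, x) \<Rightarrow> Some (t + 1, right x))"
  "ev p env (If_E c a b) =
     (case ev p env c of None \<Rightarrow> None | Some (s, x) \<Rightarrow>
       (case ev p env (if x = Atom then b else a) of None \<Rightarrow> None | Some (t, y) \<Rightarrow> Some (s + t + 1, y)))"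
  "ev p env (Let_E a b) =
     (case ev p env a of None \<Rightarrow> None | Some (s, x) \<Rightarrow>
       (case ev p (x # env) b of None \<Rightarrow> None | Some (t, y) \<Rightarrow> Some (s + t + 1, y)))"
  "ev p env (Call_E f as) =
     (case evs p env as of None \<Rightarrow> None | Some (s, xs) \<Rightarrow>
       (case call p f xs of None \<Rightarrow> None | Some (t, y) \<Rightarrow> Some (s + t + 1, y)))"
  by - (rule option_pair_eqI; force simp: ev_iff call_def split: option.splits)+

lemma evs_simps:
  "evs p env [] = Some (0, [])"
  "evs p env (a # as) =
     (case ev p env a of None \<Rightarrow> None | Some (s, x) \<Rightarrow>
       (case evs p env as of None \<Rightarrow> None | Some (t, xs) \<Rightarrow> Some (s + t, x # xs)))"
  by - (rule option_pair_eqI; force simp: ev_iff split: option.splits)+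

section \<open>The program\<close>

fun quote :: "data \<Rightarrow> expr" where
  "quote Atom = Nil_E"
| "quote (Cell x y) = Cons_E (quote x) (quote y)"

lemma ev_quote [simp]: "ev p env (quote d) = Some (2 * cells d + 1, d)"
  by (induction d) (simp_all add: ev_simps)

text \<open>Recursion depth and series length are passed in unary: decrementing is
  \<open>Tl_E\<close> and the test for 0 is a plain \<open>If_E\<close>. They are logarithmic, so
  this is cheap.\<close>

fun unary_code :: "nat \<Rightarrow> data" where
  "unary_code 0 = Atom"
| "unary_code (Suc k) = Cell Atom (unary_code k)"

lemma unary_code_eq_Atom [simp]: "unary_code k = Atom \<longleftrightarrow> k = 0"
  by (cases k) auto

lemma right_unary_code [simp]: "right (unary_code k) = unary_code (k - 1)"
  by (cases k) auto

abbreviation "True_E \<equiv> Cons_E Nil_E Nil_E"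
abbreviation "not_E e \<equiv> If_E e Nil_E True_E"
abbreviation "and_E e f \<equiv> If_E e f Nil_E"
abbreviation "or_E e f \<equiv> If_E e True_E f"
abbreviation "xor_E e f \<equiv> If_E e (not_E f) f"

abbreviation "int_E i \<equiv> quote (int_code i)"

abbreviation (input) "fBIT \<equiv> 1::nat"
abbreviation (input) "fADD \<equiv> 2::nat"
abbreviation (input) "fSUB \<equiv> 3::nat"
abbreviation (input) "fLESS \<equiv> 4::nat"
abbreviation (input) "fMUL \<equiv> 5::nat"
abbreviation (input) "fEQ \<equiv> 6::nat"
abbreviation (input) "fDIFF \<equiv> 7::nat"
abbreviation (input) "fZADD \<equiv> 8::nat"
abbreviation (input) "fZMUL \<equiv> 9::nat"
abbreviation (input) "fSCALE \<equiv> 10::nat"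
abbreviation (input) "fPADD \<equiv> 11::nat"
abbreviation (input) "fPMUL \<equiv> 12::nat"
abbreviation (input) "fPDIV \<equiv> 13::nat"
abbreviation (input) "fSHIFT \<equiv> 14::nat"
abbreviation (input) "fPINPROD \<equiv> 15::nat"
abbreviation (input) "fNBRS \<equiv> 16::nat"
abbreviation (input) "fREST \<equiv> 17::nat"
abbreviation (input) "fPINS \<equiv> 18::nat"
abbreviation (input) "fZEROS \<equiv> 19::nat"
abbreviation (input) "fSTEP \<equiv> 20::nat"
abbreviation (input) "fRATIO \<equiv> 21::nat"
abbreviation (input) "fLOOP \<equiv> 22::nat"
abbreviation (input) "fHORNER \<equiv> 23::nat"
abbreviation (input) "fOUTER \<equiv> 24::nat"
abbreviation (input) "fNOLOOP \<equiv> 25::nat"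
abbreviation (input) "fLOOPPINS \<equiv> 26::nat"
abbreviation (input) "fPOW \<equiv> 27::nat"
abbreviation (input) "fCOUNT \<equiv> 28::nat"
abbreviation (input) "fDROP \<equiv> 29::nat"
abbreviation (input) "fFUEL \<equiv> 30::nat"

text \<open>Each body lists its arguments in a comment: argument \<open>i\<close> is \<open>Var i\<close>.\<close>

definition bit_body :: expr where \<comment> \<open>b, x\<close>
  "bit_body = If_E (Var 0) (Cons_E True_E (Var 1)) (If_E (Var 1) (Cons_E Nil_E (Var 1)) Nil_E)"

definition add_body :: expr where \<comment> \<open>c, x, y\<close>
  "add_body =
     (let step = Call_E fBIT [xor_E (xor_E (Var 0) (Hd_E (Var 1))) (Hd_E (Var 2)),
             Call_E fADD [If_E (Var 0) (or_E (Hd_E (Var 1)) (Hd_E (Var 2))) (and_E (Hd_E (Var 1)) (Hd_E (Var 2))),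
               Tl_E (Var 1), Tl_E (Var 2)]]
      in If_E (Var 1) step (If_E (Var 2) step (If_E (Var 0) (Cons_E True_E Nil_E) Nil_E)))"

text \<open>The borrow out of one bit of x - y - c. Comparison uses it as well, since x < y + c says
  that the last borrow is set.\<close>

abbreviation "borrow_E \<equiv>
  If_E (Hd_E (Var 1)) (and_E (Hd_E (Var 2)) (Var 0)) (or_E (Hd_E (Var 2)) (Var 0))"

definition sub_body :: expr where \<comment> \<open>c, x, y\<close>
  "sub_body =
     If_E (Var 1)
       (Call_E fBIT [xor_E (xor_E (Var 0) (Hd_E (Var 1))) (Hd_E (Var 2)),
          Call_E fSUB [borrow_E, Tl_E (Var 1), Tl_E (Var 2)]])
       Nil_E"

definition less_body :: expr where \<comment> \<open>c, x, y\<close>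
  "less_body =
     If_E (Var 1) (Call_E fLESS [borrow_E, Tl_E (Var 1), Tl_E (Var 2)]) (If_E (Var 2) True_E (Var 0))"

definition mul_body :: expr where \<comment> \<open>x, y\<close>
  "mul_body =
     If_E (Var 0)
       (Let_E (Call_E fBIT [Nil_E, Call_E fMUL [Tl_E (Var 0), Var 1]])
         (If_E (Hd_E (Var 1)) (Call_E fADD [Nil_E, Var 0, Var 2]) (Var 0)))
       Nil_E"

definition eq_body :: expr where \<comment> \<open>x, y\<close>
  "eq_body =
     If_E (Call_E fLESS [Nil_E, Var 0, Var 1]) Nil_E
       (If_E (Call_E fLESS [Nil_E, Var 1, Var 0]) Nil_E True_E)"

definition diff_body :: expr where \<comment> \<open>x, y\<close>
  "diff_body =
     If_E (Call_E fLESS [Nil_E, Var 0, Var 1])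
       (Cons_E True_E (Call_E fSUB [Nil_E, Var 1, Var 0]))
       (Cons_E Nil_E (Call_E fSUB [Nil_E, Var 0, Var 1]))"

definition zadd_body :: expr where \<comment> \<open>x, y\<close>
  "zadd_body =
     If_E (Hd_E (Var 0))
       (If_E (Hd_E (Var 1))
         (Cons_E True_E (Call_E fADD [Nil_E, Tl_E (Var 0), Tl_E (Var 1)]))
         (Call_E fDIFF [Tl_E (Var 1), Tl_E (Var 0)]))
       (If_E (Hd_E (Var 1))
         (Call_E fDIFF [Tl_E (Var 0), Tl_E (Var 1)])
         (Cons_E Nil_E (Call_E fADD [Nil_E, Tl_E (Var 0), Tl_E (Var 1)])))"

definition zmul_body :: expr where \<comment> \<open>x, y\<close>
  "zmul_body =
     Let_E (Call_E fMUL [Tl_E (Var 0), Tl_E (Var 1)])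
       (If_E (Var 0) (Cons_E (xor_E (Hd_E (Var 1)) (Hd_E (Var 2))) (Var 0)) (Cons_E Nil_E Nil_E))"

definition scale_body :: expr where \<comment> \<open>c, xs\<close>
  "scale_body =
     If_E (Var 1)
       (Cons_E (Call_E fZMUL [Var 0, Hd_E (Var 1)]) (Call_E fSCALE [Var 0, Tl_E (Var 1)]))
       Nil_E"

definition padd_body :: expr where \<comment> \<open>xs, ys\<close>
  "padd_body =
     If_E (Var 0)
       (If_E (Var 1)
         (Cons_E (Call_E fZADD [Hd_E (Var 0), Hd_E (Var 1)]) (Call_E fPADD [Tl_E (Var 0), Tl_E (Var 1)]))
         Nil_E)
       Nil_E"

definition pmul_body :: expr where \<comment> \<open>xs, ys\<close>
  "pmul_body =
     If_E (Var 0)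
       (Call_E fPADD [Call_E fSCALE [Hd_E (Var 0), Var 1],
          Cons_E (int_E 0) (Call_E fPMUL [Tl_E (Var 0), Var 1])])
       Nil_E"

definition pdiv_body :: expr where \<comment> \<open>xs, ys\<close>
  "pdiv_body =
     If_E (Var 0)
       (Cons_E (Hd_E (Var 0))
         (Call_E fPDIV [Call_E fPADD [Tl_E (Var 0),
            Call_E fSCALE [Call_E fZMUL [int_E (- 1), Hd_E (Var 0)], Var 1]], Var 1]))
       Nil_E"

definition shift_body :: expr where \<comment> \<open>x, xs\<close>
  "shift_body = If_E (Var 1) (Cons_E (Var 0) (Call_E fSHIFT [Hd_E (Var 1), Tl_E (Var 1)])) Nil_E"

definition pinprod_body :: "int \<Rightarrow> int \<Rightarrow> expr" where \<comment> \<open>v, P, acc\<close>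
  "pinprod_body a g =
     If_E (Var 1)
       (If_E (Call_E fEQ [Hd_E (Hd_E (Var 1)), Var 0])
         (Call_E fPINPROD [Var 0, Tl_E (Var 1),
            Call_E fSCALE [If_E (Tl_E (Hd_E (Var 1))) (int_E g) (int_E a), Call_E fSHIFT [int_E 0, Var 2]]])
         (Call_E fPINPROD [Var 0, Tl_E (Var 1), Var 2]))
       (Var 2)"

definition nbrs_body :: expr where \<comment> \<open>v, E\<close>
  "nbrs_body =
     If_E (Var 1)
       (If_E (Call_E fEQ [Hd_E (Hd_E (Var 1)), Var 0])
         (Cons_E (Tl_E (Hd_E (Var 1))) (Call_E fNBRS [Var 0, Tl_E (Var 1)]))
         (If_E (Call_E fEQ [Tl_E (Hd_E (Var 1)), Var 0])
           (Cons_E (Hd_E (Hd_E (Var 1))) (Call_E fNBRS [Var 0, Tl_E (Var 1)]))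
           (Call_E fNBRS [Var 0, Tl_E (Var 1)])))
       Nil_E"

definition rest_body :: expr where \<comment> \<open>v, E\<close>
  "rest_body =
     If_E (Var 1)
       (If_E (Call_E fEQ [Hd_E (Hd_E (Var 1)), Var 0])
         (Call_E fREST [Var 0, Tl_E (Var 1)])
         (If_E (Call_E fEQ [Tl_E (Hd_E (Var 1)), Var 0])
           (Call_E fREST [Var 0, Tl_E (Var 1)])
           (Cons_E (Hd_E (Var 1)) (Call_E fREST [Var 0, Tl_E (Var 1)]))))
       Nil_E"

definition pins_body :: expr where \<comment> \<open>us, P\<close>
  "pins_body =
     If_E (Var 0)
       (Cons_E (Cons_E (Hd_E (Var 0)) Nil_E) (Call_E fPINS [Tl_E (Var 0), Var 1]))
       (Var 1)"

definition zeros_body :: expr where \<comment> \<open>k\<close>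
  "zeros_body = If_E (Var 0) (Cons_E (int_E 0) (Call_E fZEROS [Tl_E (Var 0)])) Nil_E"

definition step_body :: "int \<Rightarrow> int \<Rightarrow> expr" where \<comment> \<open>r, acc\<close>
  "step_body a g =
     Call_E fPDIV [
       Call_E fPMUL [Call_E fSCALE [int_E a, Call_E fSHIFT [int_E 0, Var 1]],
         Cons_E (int_E 1) (Call_E fSCALE [int_E g, Var 0])],
       Call_E fSCALE [int_E a, Var 0]]"

definition ratio_body :: expr where \<comment> \<open>k, v, E, P\<close>
  "ratio_body =
     If_E (Var 0)
       (Call_E fLOOP [Tl_E (Var 0), Call_E fREST [Var 1, Var 2], Var 3, Call_E fNBRS [Var 1, Var 2],
          Call_E fPINPROD [Var 1, Var 3, Cons_E (int_E 1) (Call_E fZEROS [Tl_E (Var 0)])]])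
       Nil_E"

definition loop_body :: expr where \<comment> \<open>k, E, P, us, acc\<close>
  "loop_body =
     If_E (Var 3)
       (Call_E fLOOP [Var 0, Var 1, Cons_E (Cons_E (Hd_E (Var 3)) True_E) (Var 2), Tl_E (Var 3),
          Call_E fSTEP [Call_E fRATIO [Var 0, Hd_E (Var 3), Var 1, Call_E fPINS [Tl_E (Var 3), Var 2]], Var 4]])
       (Var 4)"

definition horner_body :: "int \<Rightarrow> expr" where \<comment> \<open>xs\<close>
  "horner_body D =
     If_E (Var 0)
       (Let_E (Call_E fHORNER [Tl_E (Var 0)])
         (Let_E (Call_E fZMUL [Tl_E (Var 0), int_E D])
           (Cons_E (Call_E fZADD [Call_E fZMUL [Hd_E (Var 2), Var 0], Hd_E (Var 1)]) (Var 0))))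
       (Cons_E (int_E 0) (int_E 1))"

definition outer_body :: expr where \<comment> \<open>k, E, P, vs, num, den\<close>
  "outer_body =
     If_E (Var 3)
       (Let_E (Call_E fHORNER [Call_E fRATIO [Var 0, Hd_E (Var 3), Var 1, Var 2]])
         (Call_E fOUTER [Var 1, Call_E fREST [Hd_E (Var 4), Var 2],
            Call_E fPINS [Call_E fNBRS [Hd_E (Var 4), Var 2], Var 3], Tl_E (Var 4),
            Call_E fZMUL [Var 5, Call_E fZADD [Tl_E (Var 0), Hd_E (Var 0)]],
            Call_E fZMUL [Var 6, Tl_E (Var 0)]]))
       (Cons_E (Var 4) (Var 5))"

definition noloop_body :: expr where \<comment> \<open>E\<close>
  "noloop_body =
     If_E (Var 0)
       (If_E (Call_E fEQ [Hd_E (Hd_E (Var 0)), Tl_E (Hd_E (Var 0))])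
         (Call_E fNOLOOP [Tl_E (Var 0)])
         (Cons_E (Hd_E (Var 0)) (Call_E fNOLOOP [Tl_E (Var 0)])))
       Nil_E"

definition looppins_body :: expr where \<comment> \<open>E\<close>
  "looppins_body =
     If_E (Var 0)
       (If_E (Call_E fEQ [Hd_E (Hd_E (Var 0)), Tl_E (Hd_E (Var 0))])
         (Cons_E (Cons_E (Hd_E (Hd_E (Var 0))) Nil_E)
           (Cons_E (Cons_E (Hd_E (Hd_E (Var 0))) True_E) (Call_E fLOOPPINS [Tl_E (Var 0)])))
         (Call_E fLOOPPINS [Tl_E (Var 0)]))
       Nil_E"

definition pow_body :: expr where \<comment> \<open>c, xs\<close>
  "pow_body = If_E (Var 1) (Call_E fZMUL [Var 0, Call_E fPOW [Var 0, Tl_E (Var 1)]]) (int_E 1)"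

definition count_body :: expr where \<comment> \<open>xs\<close>
  "count_body = If_E (Var 0) (Call_E fADD [True_E, Call_E fCOUNT [Tl_E (Var 0)], Nil_E]) Nil_E"

definition drop_body :: expr where \<comment> \<open>xs, ys\<close>
  "drop_body = If_E (Var 1) (Call_E fDROP [Tl_E (Var 0), Tl_E (Var 1)]) (Var 0)"

definition fuel_body :: "nat \<Rightarrow> expr" where \<comment> \<open>xs, acc\<close>
  "fuel_body K =
     If_E (Var 0) ((Cons_E Nil_E ^^ K) (Call_E fFUEL [Tl_E (Var 0), Var 1])) (Var 1)"

text \<open>The fuel has \<open>K\<close> units for each bit of the number of vertices,
  \<open>K\<close> for each bit by which the denominator of the accuracy is longer than its
  numerator, and \<open>3 * K\<close> more. In the result the denominator loses its sign, as a
  rational is coded by an integer over a natural number.\<close>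

definition main_body :: "int \<Rightarrow> int \<Rightarrow> nat \<Rightarrow> expr" where
  "main_body bn bd K =
     (let vs = Hd_E (Hd_E (Var 0)); es = Tl_E (Hd_E (Var 0));
          num = Tl_E (Hd_E (Tl_E (Var 0))); den = Tl_E (Tl_E (Var 0)) in
      Let_E
        (Call_E fOUTER [
           Call_E fFUEL [Call_E fCOUNT [vs], Call_E fFUEL [Call_E fDROP [den, num], quote (unary_code (3 * K))]],
           Call_E fNOLOOP [es], Call_E fLOOPPINS [es], vs,
           Call_E fPOW [int_E bn, es], Call_E fPOW [int_E bd, es]])
        (Cons_E (Hd_E (Var 0)) (Tl_E (Tl_E (Var 0)))))"

text \<open>
  The parameters will satisfy \<open>cA / cD = 1 / \<beta>\<close>, \<open>cG / cD = \<gamma>\<close> and \<open>bn / bd = \<beta>\<close>; \<open>K\<close> scales the number of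
  Taylor coefficients.
\<close>

locale spin_program =
  fixes cA cG cD bn bd :: int and K :: nat
begin

definition prog :: program where
  "prog = [main_body bn bd K, bit_body, add_body, sub_body, less_body, mul_body, eq_body, diff_body,
     zadd_body, zmul_body, scale_body, padd_body, pmul_body, pdiv_body, shift_body, pinprod_body cA cG,
     nbrs_body, rest_body, pins_body, zeros_body, step_body cA cG, ratio_body, loop_body, horner_body cD,
     outer_body, noloop_body, looppins_body, pow_body, count_body, drop_body, fuel_body K]"

lemma call_prog:
  "call prog 0 xs = ev prog xs (main_body bn bd K)"
  "call prog (Suc 0) xs = ev prog xs bit_body"
  "call prog fADD xs = ev prog xs add_body"
  "call prog fSUB xs = ev prog xs sub_body"
  "call prog fLESS xs = ev prog xs less_body"
  "call prog fMUL xs = ev prog xs mul_body"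
  "call prog fEQ xs = ev prog xs eq_body"
  "call prog fDIFF xs = ev prog xs diff_body"
  "call prog fZADD xs = ev prog xs zadd_body"
  "call prog fZMUL xs = ev prog xs zmul_body"
  "call prog fSCALE xs = ev prog xs scale_body"
  "call prog fPADD xs = ev prog xs padd_body"
  "call prog fPMUL xs = ev prog xs pmul_body"
  "call prog fPDIV xs = ev prog xs pdiv_body"
  "call prog fSHIFT xs = ev prog xs shift_body"
  "call prog fPINPROD xs = ev prog xs (pinprod_body cA cG)"
  "call prog fNBRS xs = ev prog xs nbrs_body"
  "call prog fREST xs = ev prog xs rest_body"
  "call prog fPINS xs = ev prog xs pins_body"
  "call prog fZEROS xs = ev prog xs zeros_body"
  "call prog fSTEP xs = ev prog xs (step_body cA cG)"
  "call prog fRATIO xs = ev prog xs ratio_body"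
  "call prog fLOOP xs = ev prog xs loop_body"
  "call prog fHORNER xs = ev prog xs (horner_body cD)"
  "call prog fOUTER xs = ev prog xs outer_body"
  "call prog fNOLOOP xs = ev prog xs noloop_body"
  "call prog fLOOPPINS xs = ev prog xs looppins_body"
  "call prog fPOW xs = ev prog xs pow_body"
  "call prog fCOUNT xs = ev prog xs count_body"
  "call prog fDROP xs = ev prog xs drop_body"
  "call prog fFUEL xs = ev prog xs (fuel_body K)"
  by (simp_all add: call_def prog_def)

definition does :: "nat \<Rightarrow> data list \<Rightarrow> nat \<Rightarrow> data \<Rightarrow> bool" where
  "does f xs T y \<longleftrightarrow> (\<exists>t. call prog f xs = Some (t, y) \<and> t \<le> T)"

text \<open>A name for the exact cost: a finished call becomes an equation for the simplifier, while
  its bound stays an inequality for linear arithmetic.\<close>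

definition steps :: "nat \<Rightarrow> data list \<Rightarrow> nat" where
  "steps f xs = fst (the (call prog f xs))"

lemma doesD:
  assumes "does f xs T y"
  shows "call prog f xs = Some (steps f xs, y)" "steps f xs \<le> T"
  using assms by (auto simp: does_def steps_def)

lemma does_mono: "does f xs T y \<Longrightarrow> T \<le> T' \<Longrightarrow> does f xs T' y"
  by (auto simp: does_def)

end

section \<open>Binary numerals and bit lengths\<close>

lemma bool_code_eq_Atom [simp]: "bool_code b = Atom \<longleftrightarrow> \<not> b"
  by (simp add: bool_code_def)

lemma bool_code_True: "bool_code True = Cell Atom Atom"
  and bool_code_False: "bool_code False = Atom"
  by (simp_all add: bool_code_def)

lemma nat_code_0 [simp]: "nat_code 0 = Atom"
  by (simp add: nat_code_def list_code_def bits.simps)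

lemma nat_code_unfold: "n > 0 \<Longrightarrow> nat_code n = Cell (bool_code (odd n)) (nat_code (n div 2))"
  by (subst nat_code_def, subst bits.simps) (simp add: nat_code_def list_code_def)

lemma nat_code_eq_Atom [simp]: "nat_code n = Atom \<longleftrightarrow> n = 0"
  using nat_code_unfold[of n] by (cases "n = 0") auto

lemma left_nat_code [simp]: "left (nat_code n) = bool_code (odd n)"
  using nat_code_unfold[of n] by (cases "n = 0") (auto simp: bool_code_def)

lemma right_nat_code [simp]: "right (nat_code n) = nat_code (n div 2)"
  using nat_code_unfold[of n] by (cases "n = 0") auto

definition bit_length :: "nat \<Rightarrow> nat" where
  "bit_length n = length (bits n)"

lemma bit_length_0 [simp]: "bit_length 0 = 0"
  by (simp add: bit_length_def bits.simps)

lemma bit_length_unfold: "n > 0 \<Longrightarrow> bit_length n = Suc (bit_length (n div 2))"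
  by (subst bit_length_def, subst bits.simps) (simp add: bit_length_def)

lemma less_two_power_bit_length: "n < 2 ^ bit_length n"
proof (induction n rule: less_induct)
  case (less n)
  show ?case
  proof (cases "n = 0")
    case False
    then have "n div 2 < 2 ^ bit_length (n div 2)" by (intro less) auto
    then show ?thesis using False by (simp add: bit_length_unfold)
  qed simp
qed

lemma two_power_bit_length_le: "n > 0 \<Longrightarrow> 2 ^ bit_length n \<le> 2 * n"
proof (induction n rule: less_induct)
  case (less n)
  show ?case
  proof (cases "n div 2 = 0")
    case False
    then have "2 ^ bit_length (n div 2) \<le> 2 * (n div 2)" using less.prems by (intro less) auto
    then show ?thesis using less.prems by (simp add: bit_length_unfold)
  next
    case True
    then have "n = 1" using less.prems by auto
    then show ?thesis by (simp add: bit_length_unfold)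
  qed
qed

lemma bit_length_le:
  assumes "n < 2 ^ b"
  shows "bit_length n \<le> b"
proof (cases "n = 0")
  case False
  then have "2 ^ bit_length n \<le> 2 * n" by (intro two_power_bit_length_le) auto
  also have "\<dots> < 2 ^ Suc b" using assms by simp
  finally show ?thesis by (simp only: power_strict_increasing_iff[of "2::nat"]) 
qed simp

lemmas run_simps = ev_simps evs_simps bool_code_True bool_code_False Let_def

lemma nat_add_carry:
  "2 * (a div 2 + b div 2 + of_bool (if c then odd a \<or> odd b else odd a \<and> odd b))
     + of_bool ((c \<noteq> odd a) \<noteq> odd b) = a + b + of_bool (c::bool)" for a b :: nat
  by (cases c; cases "odd a"; cases "odd b") (auto elim!: oddE evenE)

lemma nat_sub_borrow:
  fixes a b :: nat
  assumes "b + of_bool c \<le> a"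
  defines "c' \<equiv> if odd a then odd b \<and> c else odd b \<or> c"
  shows "b div 2 + of_bool c' \<le> a div 2"
    "2 * (a div 2 - (b div 2 + of_bool c')) + of_bool ((c \<noteq> odd a) \<noteq> odd b) = a - (b + of_bool c)"
  using assms by (cases c; cases "odd a"; cases "odd b"; auto elim!: oddE evenE)+

lemma nat_less_borrow:
  fixes a b :: nat
  shows "a div 2 < b div 2 + of_bool (if odd a then odd b \<and> c else odd b \<or> c) \<longleftrightarrow> a < b + of_bool c"
  by (cases c; cases "odd a"; cases "odd b"; auto elim!: oddE evenE)

lemma int_code_simps [simp]:
  "left (int_code i) = bool_code (i < 0)" "right (int_code i) = nat_code (nat \<bar>i\<bar>)"
  "int_code i \<noteq> Atom"
  by (simp_all add: int_code_def)

section \<open>Correctness and cost of integer arithmetic\<close>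

context spin_program
begin

text \<open>A zero put in front of the empty numeral must vanish. Codes thus stay canonical, and
  \<open>Atom\<close> remains the only code of 0.\<close>

lemma does_bit: "does fBIT [bool_code b, nat_code n] 10 (nat_code (2 * n + of_bool b))"
  by (cases b; cases "n = 0")
     (simp_all add: does_def call_prog bit_body_def run_simps
       nat_code_unfold[of "Suc (2 * n)"] nat_code_unfold[of "2 * n"] nat_code_unfold[of "Suc 0"])

lemma does_add:
  "does fADD [bool_code c, nat_code a, nat_code b] (60 * (bit_length a + bit_length b) + 60)
     (nat_code (a + b + of_bool c))"
proof (induction "a + b" arbitrary: a b c rule: less_induct)
  case less
  show ?case
  proof (cases "a = 0 \<and> b = 0")
    case True
    then show ?thesis
      by (cases c) (simp_all add: does_def call_prog add_body_def run_simps nat_code_unfold[of "Suc 0"])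
  next
    case False
    define c' where "c' = (if c then odd a \<or> odd b else odd a \<and> odd b)"
    have len: "bit_length (a div 2) + bit_length (b div 2) + 1 \<le> bit_length a + bit_length b"
      using False bit_length_unfold[of a] bit_length_unfold[of b] by (cases "a = 0"; cases "b = 0") auto
    have "a div 2 + b div 2 < a + b" using False by linarith
    note IH = doesD[OF less[OF this, of c']]
    note B = doesD[OF does_bit[of "(c \<noteq> odd a) \<noteq> odd b" "a div 2 + b div 2 + of_bool c'"]]
    have sum: "2 * (a div 2 + b div 2 + of_bool c') + of_bool ((c \<noteq> odd a) \<noteq> odd b) = a + b + of_bool c"
      unfolding c'_def by (rule nat_add_carry)
    show ?thesis
      unfolding does_def call_prog using IH B[unfolded sum] False len 
      by (cases c; cases "odd a"; cases "odd b"; cases "a = 0")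
         (simp_all add: add_body_def run_simps c'_def)
  qed
qed

lemma does_sub:
  "b + of_bool c \<le> a \<Longrightarrow>
   does fSUB [bool_code c, nat_code a, nat_code b] (60 * bit_length a + 60)
     (nat_code (a - (b + of_bool c)))"
proof (induction a arbitrary: b c rule: less_induct)
  case (less a)
  show ?case
  proof (cases "a = 0")
    case True
    then show ?thesis
      using less.prems by (simp add: does_def call_prog sub_body_def run_simps)
  next
    case False
    define c' where "c' = (if odd a then odd b \<and> c else odd b \<or> c)"
    note brw = nat_sub_borrow[OF less.prems, folded c'_def]
    note IH = doesD[OF less.IH[OF _ brw(1)]]
    note B = doesD[OF does_bit[of "(c \<noteq> odd a) \<noteq> odd b" "a div 2 - (b div 2 + of_bool c')"]]
    show ?thesis
      unfolding does_def call_prog using IH B[unfolded brw(2)] False bit_length_unfold[of a]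
      by (cases c; cases "odd a"; cases "odd b") (simp_all add: sub_body_def run_simps c'_def)
  qed
qed

lemma does_less:
  "does fLESS [bool_code c, nat_code a, nat_code b] (30 * bit_length a + 30) (bool_code (a < b + of_bool c))"
proof (induction a arbitrary: b c rule: less_induct)
  case (less a)
  show ?case
  proof (cases "a = 0")
    case True
    then show ?thesis
      by (cases "b = 0") (simp_all add: does_def call_prog less_body_def run_simps)
  next
    case False
    define c' where "c' = (if odd a then odd b \<and> c else odd b \<or> c)"
    note IH = doesD[OF less[of "a div 2" c' "b div 2", unfolded c'_def nat_less_borrow, folded c'_def]]
    show ?thesis
      unfolding does_def call_prog using IH False bit_length_unfold[of a]
      by (cases c; cases "odd a"; cases "odd b") (simp_all add: less_body_def run_simps c'_def)
  qed
qed

text \<open>Exponents pass through the induction more easily than exact bit lengths: all that is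
  known of the partial product is that it lies below \<open>2 ^ (m + n)\<close>.\<close>

lemma does_mul:
  assumes "a < 2 ^ m" "b < 2 ^ n"
  shows "does fMUL [nat_code a, nat_code b] (m * (60 * (m + 2 * n) + 100) + 10) (nat_code (a * b))"
  using assms(1)
proof (induction m arbitrary: a)
  case 0
  then show ?case by (simp add: does_def call_prog mul_body_def run_simps)
next
  case (Suc m)
  show ?case
  proof (cases "a = 0")
    case True
    then show ?thesis by (simp add: does_def call_prog mul_body_def run_simps)
  next
    case False
    have hm: "a div 2 < 2 ^ m" using Suc.prems by auto
    note IH = doesD[OF Suc.IH[OF hm]]
    note B = doesD[OF does_bit[of False "a div 2 * b"]]
    note A = doesD[OF does_add[of False "2 * (a div 2 * b)" b]]
    have "a div 2 * b < 2 ^ m * 2 ^ n"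
      using hm assms(2) by (intro mult_strict_mono) auto
    then have "2 * (a div 2 * b) < 2 ^ Suc (m + n)"
      by (simp add: power_add)
    then have len: "bit_length (2 * (a div 2 * b)) \<le> Suc (m + n)" "bit_length b \<le> n"
      using assms(2) by (auto intro!: bit_length_le simp del: power_Suc)
    have val: "odd a \<Longrightarrow> 2 * (a div 2 * b) + b = a * b" "\<not> odd a \<Longrightarrow> 2 * (a div 2 * b) = a * b"
      by (auto elim!: oddE evenE simp: algebra_simps)
    show ?thesis
    proof (cases "odd a")
      case True
      show ?thesis
        unfolding does_def call_prog using IH B A[unfolded of_bool_eq add_0_right val(1)[OF True]] len False True
        by (simp add: mul_body_def run_simps algebra_simps)
    next
      case ev: False
      show ?thesis
        unfolding does_def call_prog using IH B[unfolded of_bool_eq add_0_right val(2)[OF ev]] False ev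
        by (simp add: mul_body_def run_simps algebra_simps)
    qed
  qed
qed

lemma does_eq:
  "does fEQ [nat_code a, nat_code b] (30 * (bit_length a + bit_length b) + 80) (bool_code (a = b))"
proof -
  note L = doesD[OF does_less[of False a b]] doesD[OF does_less[of False b a]]
  consider "a < b" | "b < a" | "a = b" by linarith
  then show ?thesis
    unfolding does_def call_prog using L
    by cases (simp_all add: eq_body_def run_simps)
qed

lemma does_diff:
  "does fDIFF [nat_code a, nat_code b] (90 * (bit_length a + bit_length b) + 120)
     (int_code (int a - int b))"
proof -
  note L = doesD[OF does_less[of False a b]]
  note S = doesD[OF does_sub[of a False b]] doesD[OF does_sub[of b False a]]
  show ?thesis
    unfolding does_def call_prog using L S
    by (cases "a < b") (simp_all add: diff_body_def run_simps int_code_def nat_diff_distrib)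
qed

lemma does_zadd:
  assumes "\<bar>i\<bar> < 2 ^ b" "\<bar>j\<bar> < 2 ^ b"
  shows "does fZADD [int_code i, int_code j] (180 * b + 200) (int_code (i + j))"
proof -
  have "nat \<bar>i\<bar> < 2 ^ b" "nat \<bar>j\<bar> < 2 ^ b"
    using assms by (simp_all add: nat_less_iff)
  then have len: "bit_length (nat \<bar>i\<bar>) \<le> b" "bit_length (nat \<bar>j\<bar>) \<le> b"
    by (auto intro: bit_length_le)
  note A = doesD[OF does_add[of False "nat \<bar>i\<bar>" "nat \<bar>j\<bar>"]]
  note F = doesD[OF does_diff[of "nat \<bar>i\<bar>" "nat \<bar>j\<bar>"]] doesD[OF does_diff[of "nat \<bar>j\<bar>" "nat \<bar>i\<bar>"]]
  show ?thesis
    unfolding does_def call_prog using A F len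
    by (cases "i < 0"; cases "j < 0")
       (simp_all add: zadd_body_def run_simps int_code_def nat_add_distrib[symmetric] algebra_simps)
qed

definition zmul_time :: "nat \<Rightarrow> nat" where
  "zmul_time b = b * (180 * b + 100) + 50"

lemma does_zmul:
  assumes "\<bar>i\<bar> < 2 ^ b" "\<bar>j\<bar> < 2 ^ b"
  shows "does fZMUL [int_code i, int_code j] (zmul_time b) (int_code (i * j))"
proof -
  have "nat \<bar>i\<bar> < 2 ^ b" "nat \<bar>j\<bar> < 2 ^ b"
    using assms by (simp_all add: nat_less_iff)
  note M = doesD[OF does_mul[OF this]]
  have *: "nat \<bar>i\<bar> * nat \<bar>j\<bar> = nat \<bar>i * j\<bar>"
    by (simp add: abs_mult nat_mult_distrib)
  show ?thesis
    unfolding does_def call_prog using M[unfolded *]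
    by (cases "i < 0"; cases "j < 0"; cases "i = 0"; cases "j = 0")
       (simp_all add: zmul_body_def run_simps int_code_def zmul_time_def mult_less_0_iff)
qed

end

section \<open>Truncated power series\<close>

lemma list_code_simps [simp]:
  "list_code c [] = Atom" "list_code c (x # xs) = Cell (c x) (list_code c xs)"
  by (simp_all add: list_code_def)

lemma list_code_eq_Atom [simp]: "list_code c xs = Atom \<longleftrightarrow> xs = []"
  by (cases xs) auto

lemma cells_int_code [simp]:
  "cells (int_code 0) = 1" "cells (int_code 1) = 3" "cells (int_code (- 1)) = 4"
  by (simp_all add: int_code_def bool_code_def nat_code_unfold)

text \<open>Multiplication modulo a power of the variable: \<open>map2\<close> cuts at the shorter
  list, so truncation needs no separate bookkeeping.\<close>

fun pmul :: "int list \<Rightarrow> int list \<Rightarrow> int list" where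
  "pmul [] ys = []"
| "pmul (x # xs) ys = map2 (+) (map ((*) x) ys) (0 # pmul xs ys)"

text \<open>The quotient of the series \<open>xs\<close> by \<open>1 + y * ys\<close>.\<close>

function pdiv :: "int list \<Rightarrow> int list \<Rightarrow> int list" where
  "pdiv [] ys = []"
| "pdiv (x # xs) ys = x # pdiv (map2 (+) xs (map ((*) (- x)) ys)) ys"
  by pat_completeness auto
termination by (relation "Wellfounded.measure (length \<circ> fst)") auto

text \<open>Multiplication by the variable at constant length: the top coefficient drops out and
  \<open>p\<close> becomes the constant term.\<close>

fun shift :: "'a \<Rightarrow> 'a list \<Rightarrow> 'a list" where
  "shift p [] = []"
| "shift p (x # xs) = p # shift x xs"

lemma length_shift [simp]: "length (shift p xs) = length xs"
  by (induction xs arbitrary: p) auto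

lemma length_pmul [simp]: "length (pmul xs ys) = min (length xs) (length ys)"
  by (induction xs) auto

lemma length_pdiv: "length xs \<le> Suc (length ys) \<Longrightarrow> length (pdiv xs ys) = length xs"
  by (induction xs ys rule: pdiv.induct) auto

lemma set_map2_plusE:
  assumes "z \<in> set (map2 (+) xs ys)"
  obtains x y where "x \<in> set xs" "y \<in> set ys" "z = x + (y::int)"
  using assms by (auto dest: set_zip_leftD set_zip_rightD)

text \<open>A weighted \<open>\<ell>\<^sup>1\<close> norm: being submultiplicative, it controls the size of all coefficients.\<close>

fun wnorm :: "nat \<Rightarrow> int list \<Rightarrow> real" where
  "wnorm c [] = 0"
| "wnorm c (x # xs) = \<bar>real_of_int x\<bar> + wnorm c xs / 2 ^ c"

lemma wnorm_nonneg [simp]: "wnorm c xs \<ge> 0"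
  by (induction xs) auto

lemma wnorm_scale: "wnorm c (map ((*) k) xs) = \<bar>real_of_int k\<bar> * wnorm c xs"
  by (induction xs) (auto simp: abs_mult algebra_simps)

lemma wnorm_map2_plus: "wnorm c (map2 (+) xs ys) \<le> wnorm c xs + wnorm c ys"
proof (induction xs ys rule: list_induct2')
  case (4 x xs y ys)
  have "wnorm c (map2 (+) xs ys) / 2 ^ c \<le> (wnorm c xs + wnorm c ys) / 2 ^ c"
    by (rule divide_right_mono[OF 4]) simp
  then show ?case by (simp add: add_divide_distrib)
qed auto

lemma wnorm_pmul: "wnorm c (pmul xs ys) \<le> wnorm c xs * wnorm c ys"
proof (induction xs)
  case (Cons x xs)
  have "wnorm c (pmul (x # xs) ys) \<le> \<bar>real_of_int x\<bar> * wnorm c ys + wnorm c (pmul xs ys) / 2 ^ c"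
    using wnorm_map2_plus[of c "map ((*) x) ys" "0 # pmul xs ys"] by (simp add: wnorm_scale)
  moreover have "wnorm c (pmul xs ys) / 2 ^ c \<le> wnorm c xs * wnorm c ys / 2 ^ c"
    by (rule divide_right_mono[OF Cons]) simp
  moreover have "wnorm c (x # xs) * wnorm c ys
      = \<bar>real_of_int x\<bar> * wnorm c ys + wnorm c xs * wnorm c ys / 2 ^ c"
    by (simp add: distrib_right)
  ultimately show ?case by linarith
qed simp

lemma wnorm_shift: "wnorm c (shift p xs) \<le> \<bar>real_of_int p\<bar> + wnorm c xs / 2 ^ c"
proof (induction xs arbitrary: p)
  case (Cons x xs)
  have "wnorm c (shift x xs) / 2 ^ c \<le> (\<bar>real_of_int x\<bar> + wnorm c xs / 2 ^ c) / 2 ^ c"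
    by (rule divide_right_mono[OF Cons]) simp
  then show ?case by simp
qed simp

text \<open>One step of long division. The quotient digit \<open>x\<close> leaves the remainder and
  returns, multiplied by the divisor's tail and one place further, with at most half of its
  weight.\<close>

lemma wnorm_div_step:
  assumes "wnorm c ys \<le> 2 ^ c / 2"
  shows "wnorm c (map2 (+) xs (map ((*) (- x)) ys)) / 2 ^ c \<le> wnorm c xs / 2 ^ c + \<bar>real_of_int x\<bar> / 2"
proof -
  have "wnorm c (map2 (+) xs (map ((*) (- x)) ys)) \<le> wnorm c xs + \<bar>real_of_int x\<bar> * wnorm c ys"
    using wnorm_map2_plus[of c xs "map ((*) (- x)) ys"] by (simp only: wnorm_scale) simp
  also have "\<dots> \<le> wnorm c xs + \<bar>real_of_int x\<bar> * (2 ^ c / 2)"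
    using assms by (intro add_left_mono mult_left_mono) auto
  finally have "wnorm c (map2 (+) xs (map ((*) (- x)) ys)) / 2 ^ c
      \<le> (wnorm c xs + \<bar>real_of_int x\<bar> * (2 ^ c / 2)) / 2 ^ c"
    by (rule divide_right_mono) simp
  then show ?thesis by (simp add: add_divide_distrib)
qed

text \<open>Geometric series: the divisor is 1 plus a series of norm at most 1/2, so its inverse has
  norm at most 2.\<close>

lemma wnorm_pdiv:
  assumes "wnorm c ys \<le> 2 ^ c / 2"
  shows "wnorm c (pdiv xs ys) \<le> 2 * wnorm c xs"
  using assms
proof (induction xs ys rule: pdiv.induct)
  case (2 x xs ys)
  let ?h = "map2 (+) xs (map ((*) (- x)) ys)"
  have "wnorm c (pdiv ?h ys) / 2 ^ c \<le> 2 * wnorm c ?h / 2 ^ c"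
    by (rule divide_right_mono[OF 2(1)[OF 2(2)]]) simp
  moreover have "X + p \<le> 2 * (X + w)" if "p \<le> 2 * h" "h \<le> w + X / 2" for X p h w :: real
    using that by argo
  ultimately show ?case
    using wnorm_div_step[OF 2(2), of xs x]
    unfolding pdiv.simps wnorm.simps times_divide_eq_right[symmetric] by blast
qed simp

lemma abs_le_wnorm:
  assumes "x \<in> set xs" "length xs \<le> l"
  shows "\<bar>real_of_int x\<bar> \<le> 2 ^ (c * l) * wnorm c xs"
  using assms
proof (induction xs arbitrary: l)
  case (Cons z xs)
  then obtain m where l: "l = Suc m" "length xs \<le> m" by (cases l) auto
  show ?case
  proof (cases "x \<in> set xs")
    case True
    have "\<bar>real_of_int x\<bar> \<le> 2 ^ (c * m) * wnorm c xs" by (rule Cons.IH[OF True l(2)])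
    also have "\<dots> = 2 ^ (c * l) * (wnorm c xs / 2 ^ c)" by (simp add: l(1) power_add)
    also have "\<dots> \<le> 2 ^ (c * l) * wnorm c (z # xs)" by (intro mult_left_mono) auto
    finally show ?thesis .
  next
    case False
    then have "x = z" using Cons.prems by simp
    moreover have "1 * wnorm c (z # xs) \<le> 2 ^ (c * l) * wnorm c (z # xs)"
      by (intro mult_right_mono) (auto simp: wnorm_nonneg)
    moreover have "\<bar>real_of_int z\<bar> \<le> wnorm c (z # xs)" by simp
    ultimately show ?thesis by linarith
  qed
qed simp

text \<open>The coefficient of index i carries the weight 2^(-c i); norm at most 2^j therefore
  leaves about c l + j bits, linear in the number of coefficients.\<close>

lemma abs_less_of_wnorm:
  assumes "wnorm c xs \<le> 2 ^ j" "length xs \<le> l" "c * l + j < b" "x \<in> set xs"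
  shows "\<bar>x\<bar> < 2 ^ b"
proof -
  have "\<bar>real_of_int x\<bar> \<le> 2 ^ (c * l) * 2 ^ j"
    using abs_le_wnorm[OF assms(4,2), of c] assms(1) by (meson order_trans mult_left_mono zero_le_numeral zero_le_power)
  also have "\<dots> < 2 ^ b"
    using assms(3) by (simp flip: power_add)
  finally show ?thesis by (metis of_int_abs of_int_less_iff of_int_numeral of_int_power)
qed

abbreviation "ints_code \<equiv> list_code int_code"

section \<open>Cost of the series operations\<close>

context spin_program
begin

lemma does_scale:
  assumes "\<bar>k\<bar> < 2 ^ b" "\<forall>x\<in>set xs. \<bar>x\<bar> < 2 ^ b"
  shows "does fSCALE [int_code k, ints_code xs] ((length xs + 1) * (zmul_time b + 20)) (ints_code (map ((*) k) xs))"
  using assms(2)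
proof (induction xs)
  case Nil
  then show ?case by (simp add: does_def call_prog scale_body_def run_simps)
next
  case (Cons x xs)
  have *: "\<bar>x\<bar> < 2 ^ b" "\<forall>x\<in>set xs. \<bar>x\<bar> < 2 ^ b" using Cons.prems by auto
  note IH = doesD[OF Cons.IH[OF *(2)]]
  note M = doesD[OF does_zmul[OF assms(1) *(1)]]
  show ?case
    unfolding does_def call_prog using IH M by (simp add: scale_body_def run_simps)
qed

lemma does_padd:
  assumes "\<forall>x\<in>set xs. \<bar>x\<bar> < 2 ^ b" "\<forall>y\<in>set ys. \<bar>y\<bar> < 2 ^ b"
  shows "does fPADD [ints_code xs, ints_code ys] ((length xs + 1) * (180 * b + 230)) (ints_code (map2 (+) xs ys))"
  using assms
proof (induction xs ys rule: list_induct2')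
  case (4 x xs y ys)
  have *: "\<bar>x\<bar> < 2 ^ b" "\<bar>y\<bar> < 2 ^ b" "\<forall>x\<in>set xs. \<bar>x\<bar> < 2 ^ b" "\<forall>y\<in>set ys. \<bar>y\<bar> < 2 ^ b"
    using "4.prems" by auto
  note A = doesD[OF does_zadd[OF *(1,2)]]
  note IH = doesD[OF "4.IH"[OF *(3,4)]]
  show ?case
    unfolding does_def call_prog using IH A by (simp add: padd_body_def run_simps)
qed (simp_all add: does_def call_prog padd_body_def run_simps)

definition pmul_time :: "nat \<Rightarrow> nat \<Rightarrow> nat" where
  "pmul_time l b = (l + 1) * (zmul_time b + 20) + (l + 1) * (180 * (2 * b + l) + 230) + 40"

text \<open>A crude entrywise bound is enough here: it only enters the cost of the additions inside
  a product, not the growth along the recursion.\<close>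

lemma pmul_bound:
  assumes "\<And>x. x \<in> set xs \<Longrightarrow> \<bar>x\<bar> \<le> B" "\<And>y. y \<in> set ys \<Longrightarrow> \<bar>y\<bar> \<le> B"
  shows "z \<in> set (pmul xs ys) \<Longrightarrow> \<bar>z\<bar> \<le> int (length xs) * (B * B)"
  using assms(1)
proof (induction xs arbitrary: z)
  case (Cons x xs)
  from Cons.prems(1) obtain u w where uw: "u \<in> set (map ((*) x) ys)" "w \<in> set (0 # pmul xs ys)" "z = u + w"
    unfolding pmul.simps by (rule set_map2_plusE)
  then obtain y where y: "y \<in> set ys" "u = x * y" by auto
  have nn: "B \<ge> 0" using assms(2)[OF y(1)] by linarith
  have "\<bar>u\<bar> \<le> B * B"
    unfolding y(2) abs_mult using assms(2)[OF y(1)] Cons.prems(2)[of x] nn by (intro mult_mono) auto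
  moreover have "\<bar>w\<bar> \<le> int (length xs) * (B * B)"
    using uw(2) Cons.IH[of w] Cons.prems(2) nn by auto
  ultimately show ?case using uw(3) by (simp add: algebra_simps)
qed simp

lemma does_pmul:
  assumes "\<forall>x\<in>set xs. \<bar>x\<bar> < 2 ^ b" "\<forall>y\<in>set ys. \<bar>y\<bar> < 2 ^ b"
    and "length xs \<le> l" "length ys \<le> l"
  shows "does fPMUL [ints_code xs, ints_code ys] ((length xs + 1) * pmul_time l b) (ints_code (pmul xs ys))"
  using assms(1,3)
proof (induction xs)
  case Nil
  then show ?case by (simp add: does_def call_prog pmul_body_def run_simps pmul_time_def)
next
  case (Cons x xs)
  have x: "\<bar>x\<bar> < 2 ^ b" and xs: "\<forall>z\<in>set xs. \<bar>z\<bar> < 2 ^ b" "length xs \<le> l"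
    using Cons.prems by auto
  note IH = doesD[OF Cons.IH[OF xs]]
  note S = doesD[OF does_scale[OF x assms(2)]]
  have S': "\<forall>z\<in>set (map ((*) x) ys). \<bar>z\<bar> < 2 ^ (2 * b + l)"
  proof
    fix z assume "z \<in> set (map ((*) x) ys)"
    then obtain y where "y \<in> set ys" "z = x * y" by auto
    then have "\<bar>z\<bar> < 2 ^ b * 2 ^ b"
      unfolding \<open>z = x * y\<close> abs_mult using x assms(2)
      by (intro mult_strict_mono) auto
    also have "\<dots> = 2 ^ (2 * b)" unfolding mult_2 power_add ..
    also have "\<dots> \<le> 2 ^ (2 * b + l)" by (rule power_increasing) auto
    finally show "\<bar>z\<bar> < 2 ^ (2 * b + l)" .
  qed
  have P': "\<forall>z\<in>set (0 # pmul xs ys). \<bar>z\<bar> < 2 ^ (2 * b + l)"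
  proof
    fix z assume z: "z \<in> set (0 # pmul xs ys)"
    show "\<bar>z\<bar> < 2 ^ (2 * b + l)"
    proof (cases "z \<in> set (pmul xs ys)")
      case True
      have "\<bar>z\<bar> \<le> int (length xs) * (2 ^ b * 2 ^ b)"
        using xs assms(2) by (intro pmul_bound[OF _ _ True]) (auto intro: less_imp_le)
      also have "\<dots> < 2 ^ l * (2 ^ b * 2 ^ b)"
      proof (rule mult_strict_right_mono)
        have "length xs < 2 ^ l" using xs(2) by (meson less_exp order_le_less_trans)
        then show "int (length xs) < 2 ^ l" by (metis of_nat_less_iff of_nat_numeral of_nat_power)
      qed simp
      also have "\<dots> = 2 ^ (2 * b + l)" unfolding mult_2 power_add by (simp only: ac_simps)
      finally show ?thesis .
    qed (use z in auto)
  qed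
  note A = doesD[OF does_padd[OF S' P'], unfolded length_map list_code_simps(2)]
  have len: "(length ys + 1) * (zmul_time b + 20) \<le> (l + 1) * (zmul_time b + 20)"
     "(length ys + 1) * (180 * (2 * b + l) + 230) \<le> (l + 1) * (180 * (2 * b + l) + 230)"
    using assms(4) by (intro mult_right_mono; simp)+
  have tot: "(length (x # xs) + 1) * pmul_time l b = (length xs + 1) * pmul_time l b + pmul_time l b"
    by simp
  define X where "X = (l + 1) * (zmul_time b + 20)"
  define Y where "Y = (l + 1) * (180 * (2 * b + l) + 230)"
  have time: "pmul_time l b = X + Y + 40"
    by (simp add: pmul_time_def X_def Y_def)
  note len = len[folded X_def Y_def]
  define Z where "Z = (length xs + 1) * pmul_time l b"
  note IH = IH[folded Z_def]
  show ?case
    unfolding does_def call_prog tot Z_def[symmetric]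
    by (simp add: pmul_body_def run_simps IH(1) S(1) A(1))
       (use IH(2) S(2) A(2) len time in linarith)
qed

definition pdiv_time :: "nat \<Rightarrow> nat \<Rightarrow> nat" where
  "pdiv_time l b = zmul_time b + (l + 1) * (zmul_time b + 20) + (l + 1) * (180 * (2 * b) + 230) + 60"

text \<open>The remainder may grow by a factor 2^c per step, but it becomes one coefficient shorter.
  As \<open>j + length xs\<close> never increases, one bit bound \<open>b\<close> serves the whole
  division.\<close>

lemma does_pdiv:
  assumes "wnorm c xs \<le> 2 ^ (c * j)" "wnorm c ys \<le> 2 ^ c / 2" "c * (j + length xs) < b"
    and "\<forall>y\<in>set ys. \<bar>y\<bar> < 2 ^ b" "length ys \<le> l" "length xs \<le> Suc l"
  shows "does fPDIV [ints_code xs, ints_code ys] ((length xs + 1) * pdiv_time l b) (ints_code (pdiv xs ys))"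
  using assms
proof (induction xs ys arbitrary: j rule: pdiv.induct)
  case (1 ys)
  then show ?case by (simp add: does_def call_prog pdiv_body_def run_simps pdiv_time_def)
next
  case (2 x xs ys)
  let ?h = "map2 (+) xs (map ((*) (- x)) ys)"
  have ent: "\<bar>z\<bar> < 2 ^ b" if "z \<in> set (x # xs)" for z
    using "2.prems"(3) that
    by (intro abs_less_of_wnorm[OF "2.prems"(1) order_refl]) (auto simp: algebra_simps)
  have b0: "0 < b" using "2.prems"(3) by auto
  have x: "\<bar>x\<bar> < 2 ^ b" "\<bar>- 1\<bar> < (2::int) ^ b" "\<bar>- x\<bar> < 2 ^ b" using ent[of x] b0 by auto
  note N = doesD[OF does_zmul[OF x(2) x(1)], unfolded mult_minus1]
  note S = doesD[OF does_scale[OF x(3) "2.prems"(4)]]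
  have pw: "(2::int) ^ b \<le> 2 ^ (2 * b)" by (rule power_increasing) auto
  have xs2: "\<forall>z\<in>set xs. \<bar>z\<bar> < 2 ^ (2 * b)"
    using ent pw by (meson list.set_intros(2) order_less_le_trans)
  have ys2: "\<forall>z\<in>set (map ((*) (- x)) ys). \<bar>z\<bar> < 2 ^ (2 * b)"
  proof
    fix z assume "z \<in> set (map ((*) (- x)) ys)"
    then obtain y where "y \<in> set ys" "z = - x * y" by auto
    then have "\<bar>z\<bar> < 2 ^ b * 2 ^ b"
      unfolding \<open>z = - x * y\<close> abs_mult using x(3) "2.prems"(4)
      by (intro mult_strict_mono) auto
    then show "\<bar>z\<bar> < 2 ^ (2 * b)" by (simp add: mult_2 power_add)
  qed
  note A = doesD[OF does_padd[OF xs2 ys2]]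
  have "wnorm c ?h / 2 ^ c \<le> wnorm c (x # xs)"
    using wnorm_div_step[OF "2.prems"(2), of xs x] by simp
  also have "\<dots> \<le> 2 ^ (c * j)" by fact
  finally have w: "wnorm c ?h \<le> 2 ^ (c * Suc j)" by (simp add: field_simps power_add)
  have "c * (Suc j + length ?h) \<le> c * (j + length (x # xs))" by (intro mult_left_mono) auto
  then have "c * (Suc j + length ?h) < b" using "2.prems"(3) by linarith
  moreover have "length ?h \<le> Suc l" using "2.prems"(6) by simp
  ultimately have IH': "does fPDIV [ints_code ?h, ints_code ys] ((length ?h + 1) * pdiv_time l b) (ints_code (pdiv ?h ys))"
    using "2.prems" w by (intro "2.IH"[where j = "Suc j"]) auto
  note IH = doesD[OF IH']
  define X where "X = (l + 1) * (zmul_time b + 20)"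
  define Y where "Y = (l + 1) * (180 * (2 * b) + 230)"
  define Z where "Z = (length xs + 1) * pdiv_time l b"
  have len: "(length ys + 1) * (zmul_time b + 20) \<le> X" "(length xs + 1) * (180 * (2 * b) + 230) \<le> Y"
     "(length ?h + 1) * pdiv_time l b \<le> Z"
    unfolding X_def Y_def Z_def using "2.prems"(5,6) by (intro mult_right_mono; simp)+
  have time: "pdiv_time l b = zmul_time b + X + Y + 60"
    by (simp add: pdiv_time_def X_def Y_def)
  have tot: "(length (x # xs) + 1) * pdiv_time l b = Z + pdiv_time l b"
    by (simp add: Z_def)
  show ?case
    unfolding does_def call_prog tot
    by (simp add: pdiv_body_def run_simps IH(1) S(1) A(1) N(1))
       (use IH(2) S(2) A(2) N(2) len time in linarith)
qed

lemma does_shift: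
  "does fSHIFT [int_code x, ints_code xs] (20 * length xs + 20) (ints_code (shift x xs))"
proof (induction xs arbitrary: x)
  case Nil
  then show ?case by (simp add: does_def call_prog shift_body_def run_simps)
next
  case (Cons y xs)
  note IH = doesD[OF Cons.IH[of y]]
  show ?case
    unfolding does_def call_prog using IH by (simp add: shift_body_def run_simps)
qed

end

section \<open>Spin ratios\<close>

abbreviation "edges_code \<equiv> list_code (\<lambda>(u, v). Cell (nat_code u) (nat_code v))"
abbreviation "pins_code \<equiv> list_code (\<lambda>(u, f). Cell (nat_code u) (bool_code f))"

text \<open>Parallel edges give repeated entries. Loops do not reach this function in the program,
  having been turned into pins before.\<close>

fun nbrs :: "nat \<Rightarrow> (nat \<times> nat) list \<Rightarrow> nat list" where
  "nbrs v [] = []"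
| "nbrs v ((x, y) # E) = (if x = v then y # nbrs v E else if y = v then x # nbrs v E else nbrs v E)"

fun rest :: "nat \<Rightarrow> (nat \<times> nat) list \<Rightarrow> (nat \<times> nat) list" where
  "rest v [] = []"
| "rest v ((x, y) # E) = (if x = v then rest v E else if y = v then rest v E else (x, y) # rest v E)"

text \<open>
  A pin \<open>(u, f)\<close> represents an edge from \<open>u\<close> to a deleted vertex of spin 1 if \<open>f\<close> holds, and of spin 0
  otherwise.
\<close>

definition pins :: "nat list \<Rightarrow> (nat \<times> bool) list \<Rightarrow> (nat \<times> bool) list" where
  "pins us P = map (\<lambda>u. (u, False)) us @ P"

lemma pins_simps [simp]: "pins [] P = P" "pins (u # us) P = (u, False) # pins us P"
  by (simp_all add: pins_def)

lemma set_rest: "set (rest v E) = {(x, y) \<in> set E. x \<noteq> v \<and> y \<noteq> v}"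
  by (induction v E rule: rest.induct) auto

lemma set_nbrs: "set (nbrs v E) = {y. (v, y) \<in> set E} \<union> {x. (x, v) \<in> set E}"
  by (induction v E rule: nbrs.induct) auto

lemma length_rest_nbrs: "length (rest v E) + length (nbrs v E) = length E"
  by (induction v E rule: rest.induct) auto

lemma length_nbrs_rest: "length (nbrs u (rest v E)) \<le> length (nbrs u E)"
proof (induction E)
  case (Cons e E)
  then show ?case by (cases e) (auto intro: le_SucI)
qed simp

lemma length_pins [simp]: "length (pins us P) = length us + length P"
  by (simp add: pins_def)

definition vertices_below :: "nat \<Rightarrow> (nat \<times> nat) list \<Rightarrow> (nat \<times> bool) list \<Rightarrow> bool" where
  "vertices_below n E P \<longleftrightarrow> (\<forall>(x, y) \<in> set E. x < n \<and> y < n) \<and> (\<forall>(x, f) \<in> set P. x < n)"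

lemma vertices_below_rest: "vertices_below n E P \<Longrightarrow> vertices_below n (rest v E) P"
  by (auto simp: vertices_below_def set_rest)

lemma vertices_below_nbrs: "vertices_below n E P \<Longrightarrow> \<forall>u\<in>set (nbrs v E). u < n"
  by (auto simp: vertices_below_def set_nbrs)

lemma vertices_below_pins:
  "vertices_below n E P \<Longrightarrow> \<forall>u\<in>set us. u < n \<Longrightarrow> vertices_below n E (pins us P)"
  by (auto simp: vertices_below_def pins_def)

section \<open>The ratio recursion and its graph operations\<close>

context spin_program
begin

fun pinprod :: "nat \<Rightarrow> (nat \<times> bool) list \<Rightarrow> int list \<Rightarrow> int list" where
  "pinprod v [] acc = acc"
| "pinprod v ((u, f) # P) acc =
     pinprod v P (if u = v then map ((*) (if f then cG else cA)) (shift 0 acc) else acc)"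

text \<open>The factor for one incident edge, written in y = x / \<open>cD\<close> as cA y (1 + cG y
  R) / (1 + cA y R). Since R enters only through y R, k of its coefficients determine k + 1 of the
  product.\<close>

definition step :: "int list \<Rightarrow> int list \<Rightarrow> int list" where
  "step r acc = pdiv (pmul (map ((*) cA) (shift 0 acc)) (1 # map ((*) cG) r)) (map ((*) cA) r)"

text \<open>The deleted vertex is split into one copy per edge, and \<open>loop\<close> flips the
  copies from spin 0 to spin 1 one at a time: copies already flipped are pins with
  \<open>True\<close> in \<open>P\<close>, those still to come are the pins with
  \<open>False\<close> in \<open>pins us P\<close>. The quotients of consecutive sums
  telescope.\<close>

function ratio :: "nat \<Rightarrow> nat \<Rightarrow> (nat \<times> nat) list \<Rightarrow> (nat \<times> bool) list \<Rightarrow> int list"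
  and loop :: "nat \<Rightarrow> (nat \<times> nat) list \<Rightarrow> (nat \<times> bool) list \<Rightarrow> nat list \<Rightarrow> int list \<Rightarrow> int list" where
  "ratio 0 v E P = []"
| "ratio (Suc k) v E P = loop k (rest v E) P (nbrs v E) (pinprod v P (1 # replicate k 0))"
| "loop k E P [] acc = acc"
| "loop k E P (u # us) acc = loop k E ((u, True) # P) us (step (ratio k u E (pins us P)) acc)"
  by pat_completeness auto
termination
  \<comment> \<open>\<open>loop\<close> calls \<open>ratio\<close> with the same \<open>k\<close>,
    so the number of remaining neighbours breaks the tie; only the call from \<open>ratio\<close> to
    \<open>loop\<close> lowers \<open>k\<close>.\<close>
  by (relation "measures [case_sum (\<lambda>(k, v, E, P). k) (\<lambda>(k, E, P, us, acc). k),
        case_sum (\<lambda>(k, v, E, P). 0) (\<lambda>(k, E, P, us, acc). length us)]") auto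

lemma does_nbrs:
  assumes "v < 2 ^ w" "vertices_below (2 ^ w) E []"
  shows "does fNBRS [nat_code v, edges_code E] ((length E + 1) * (120 * w + 250)) (list_code nat_code (nbrs v E))"
  using assms(2)
proof (induction E)
  case Nil
  then show ?case by (simp add: does_def call_prog nbrs_body_def run_simps)
next
  case (Cons e E)
  obtain x y where e: "e = (x, y)" by (cases e)
  have *: "x < 2 ^ w" "y < 2 ^ w" "vertices_below (2 ^ w) E []"
    using Cons.prems by (auto simp: vertices_below_def e)
  note len = bit_length_le[OF *(1)] bit_length_le[OF *(2)] bit_length_le[OF assms(1)]
  note IH = doesD[OF Cons.IH[OF *(3)]]
  note Q = doesD[OF does_eq[of x v]] doesD[OF does_eq[of y v]]
  show ?case
    unfolding does_def call_prog using IH Q len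
    by (cases "x = v"; cases "y = v") (simp_all add: nbrs_body_def run_simps e)
qed

lemma does_rest:
  assumes "v < 2 ^ w" "vertices_below (2 ^ w) E []"
  shows "does fREST [nat_code v, edges_code E] ((length E + 1) * (120 * w + 250)) (edges_code (rest v E))"
  using assms(2)
proof (induction E)
  case Nil
  then show ?case by (simp add: does_def call_prog rest_body_def run_simps)
next
  case (Cons e E)
  obtain x y where e: "e = (x, y)" by (cases e)
  have *: "x < 2 ^ w" "y < 2 ^ w" "vertices_below (2 ^ w) E []"
    using Cons.prems by (auto simp: vertices_below_def e)
  note len = bit_length_le[OF *(1)] bit_length_le[OF *(2)] bit_length_le[OF assms(1)]
  note IH = doesD[OF Cons.IH[OF *(3)]]
  note Q = doesD[OF does_eq[of x v]] doesD[OF does_eq[of y v]]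
  show ?case
    unfolding does_def call_prog using IH Q len
    by (cases "x = v"; cases "y = v") (simp_all add: rest_body_def run_simps e)
qed

lemma does_pins:
  "does fPINS [list_code nat_code us, pins_code P] (20 * length us + 20) (pins_code (pins us P))"
proof (induction us)
  case Nil
  then show ?case by (simp add: does_def call_prog pins_body_def run_simps)
next
  case (Cons u us)
  note IH = doesD[OF Cons.IH]
  show ?case
    unfolding does_def call_prog using IH by (simp add: pins_body_def run_simps)
qed

lemma does_zeros: "does fZEROS [unary_code k] (20 * k + 20) (ints_code (replicate k 0))"
proof (induction k)
  case 0
  then show ?case by (simp add: does_def call_prog zeros_body_def run_simps)
next
  case (Suc k)
  note IH = doesD[OF Suc.IH]
  show ?case
    unfolding does_def call_prog using IH by (simp add: zeros_body_def run_simps)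
qed

end

text \<open>With weight 2^(-c) on the variable, cA y and cG y have norm at most 1/4. Then
  \<open>step\<close> preserves the unit ball: its product has norm at most 1/4 * 5/4, and the
  division at most doubles this. The other three bounds limit the bit lengths of the
  constants.\<close>

locale spin_algo = spin_program +
  fixes c :: nat
  assumes cA_le: "4 * \<bar>cA\<bar> \<le> 2 ^ c" and cG_le: "4 * \<bar>cG\<bar> \<le> 2 ^ c"
    and cD_le: "\<bar>cD\<bar> \<le> 2 ^ c" and bn_le: "\<bar>bn\<bar> \<le> 2 ^ c" and bd_le: "\<bar>bd\<bar> \<le> 2 ^ c"
begin

lemma cA_le_real: "\<bar>real_of_int cA\<bar> \<le> 2 ^ c / 4" and cG_le_real: "\<bar>real_of_int cG\<bar> \<le> 2 ^ c / 4"
proof -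
  have "real_of_int (4 * \<bar>cA\<bar>) \<le> real_of_int (2 ^ c)" "real_of_int (4 * \<bar>cG\<bar>) \<le> real_of_int (2 ^ c)"
    using cA_le cG_le by (simp_all only: of_int_le_iff)
  then show "\<bar>real_of_int cA\<bar> \<le> 2 ^ c / 4" "\<bar>real_of_int cG\<bar> \<le> 2 ^ c / 4" by simp_all
qed

lemma quarter_mult_le: "(k::real) \<le> C / 4 \<Longrightarrow> 0 \<le> s \<Longrightarrow> s \<le> t \<Longrightarrow> 0 \<le> C \<Longrightarrow> k * s \<le> C / 4 * t"
  by (rule mult_mono) auto

lemma wnorm_scale_shift:
  assumes "wnorm c xs \<le> 1" "\<bar>real_of_int k\<bar> \<le> 2 ^ c / 4"
  shows "wnorm c (map ((*) k) (shift 0 xs)) \<le> 1 / 4"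
proof -
  obtain C where C: "(2::real) ^ c = C" "C > 0" by (rule that[of "2 ^ c"]) auto
  have "wnorm c (shift 0 xs) \<le> wnorm c xs / C"
    using wnorm_shift[of c 0 xs] by (simp only: C(1) of_int_0 abs_zero add_0)
  also have "\<dots> \<le> 1 / C" using assms(1) C(2) by (intro divide_right_mono) auto
  finally have "\<bar>real_of_int k\<bar> * wnorm c (shift 0 xs) \<le> C / 4 * (1 / C)"
    using assms(2) C by (intro quarter_mult_le) auto
  also have "C / 4 * (1 / C) = 1 / 4" using C(2) by simp
  finally show ?thesis unfolding wnorm_scale .
qed

lemma wnorm_cons_scale:
  assumes "wnorm c r \<le> 1"
  shows "wnorm c (1 # map ((*) cG) r) \<le> 5 / 4"
proof -
  obtain C where C: "(2::real) ^ c = C" "C > 0" by (rule that[of "2 ^ c"]) auto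
  have "\<bar>real_of_int cG\<bar> * wnorm c r \<le> C / 4 * 1"
    using assms cG_le_real C by (intro quarter_mult_le) auto
  then have "\<bar>real_of_int cG\<bar> * wnorm c r / C \<le> C / 4 * 1 / C"
    using C(2) by (intro divide_right_mono) auto
  also have "C / 4 * 1 / C = 1 / 4" using C(2) by simp
  finally show ?thesis unfolding wnorm.simps wnorm_scale C(1) by simp
qed

lemma wnorm_scale_cA:
  assumes "wnorm c r \<le> 1"
  shows "wnorm c (map ((*) cA) r) \<le> 2 ^ c / 2"
proof -
  obtain C where C: "(2::real) ^ c = C" "C > 0" by (rule that[of "2 ^ c"]) auto
  have "\<bar>real_of_int cA\<bar> * wnorm c r \<le> C / 4 * 1"
    using assms cA_le_real C by (intro quarter_mult_le) auto
  then show ?thesis using C(2) unfolding wnorm_scale C(1) by simp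
qed

lemma wnorm_pmul_step:
  assumes "wnorm c r \<le> 1" "wnorm c acc \<le> 1"
  shows "wnorm c (pmul (map ((*) cA) (shift 0 acc)) (1 # map ((*) cG) r)) \<le> 1 / 2"
proof -
  have "wnorm c (map ((*) cA) (shift 0 acc)) * wnorm c (1 # map ((*) cG) r) \<le> 1 / 4 * (5 / 4)"
    by (rule mult_mono[OF wnorm_scale_shift[OF assms(2) cA_le_real] wnorm_cons_scale[OF assms(1)]]) (auto simp del: wnorm.simps)
  then show ?thesis
    using wnorm_pmul[of c "map ((*) cA) (shift 0 acc)" "1 # map ((*) cG) r"] by argo
qed

lemma wnorm_step:
  assumes "wnorm c r \<le> 1" "wnorm c acc \<le> 1"
  shows "wnorm c (step r acc) \<le> 1"
proof -
  let ?x = "pmul (map ((*) cA) (shift 0 acc)) (1 # map ((*) cG) r)"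
  have "wnorm c (step r acc) \<le> 2 * wnorm c ?x"
    unfolding step_def by (rule wnorm_pdiv[OF wnorm_scale_cA[OF assms(1)]])
  then show ?thesis using wnorm_pmul_step[OF assms] by argo
qed

lemma length_step: "length acc = Suc (length r) \<Longrightarrow> length (step r acc) = Suc (length r)"
  unfolding step_def by (subst length_pdiv) (simp_all del: pmul.simps)

lemma pinprod_props:
  assumes "wnorm c acc \<le> 1"
  shows "wnorm c (pinprod v P acc) \<le> 1" "length (pinprod v P acc) = length acc"
proof -
  have "wnorm c (pinprod v P acc) \<le> 1 \<and> length (pinprod v P acc) = length acc"
    using assms
  proof (induction v P acc rule: pinprod.induct)
    case (2 v u f P acc)
    have "wnorm c (map ((*) (if f then cG else cA)) (shift 0 acc)) \<le> 1"
      using wnorm_scale_shift[OF "2.prems" cA_le_real] wnorm_scale_shift[OF "2.prems" cG_le_real]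
      by (cases f) auto
    then show ?case using 2 by (cases "u = v") auto
  qed auto
  then show "wnorm c (pinprod v P acc) \<le> 1" "length (pinprod v P acc) = length acc" by auto
qed

lemma wnorm_replicate_0 [simp]: "wnorm m (replicate k 0) = 0"
  by (induction k) auto

text \<open>The bound 1 does not depend on the depth: however many calls contribute, the coefficient
  of index i stays at most 2^(c i).\<close>

lemma ratio_props: "wnorm c (ratio k v E P) \<le> 1 \<and> length (ratio k v E P) = k"
  and loop_props: "wnorm c acc \<le> 1 \<Longrightarrow> length acc = Suc k \<Longrightarrow>
    wnorm c (loop k E P us acc) \<le> 1 \<and> length (loop k E P us acc) = Suc k"
proof (induction k v E P and k E P us acc rule: ratio_loop.induct)
  case (2 k v E P)
  then show ?case
    using pinprod_props[of "1 # replicate k 0" v P] by auto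
next
  case (4 k E P u us acc)
  then show ?case
    by (auto intro!: wnorm_step simp: length_step)
qed auto

text \<open>Room for \<open>l\<close> coefficients of norm up to \<open>2 ^ (c + 1)\<close>, which
  includes the divisor in \<open>step\<close>, whose norm may reach
  \<open>2 ^ c / 2\<close>.\<close>

definition bits_at :: "nat \<Rightarrow> nat" where
  "bits_at l = c * (l + 2) + 3"

lemma const_bounds: "\<bar>cA\<bar> < 2 ^ bits_at l" "\<bar>cG\<bar> < 2 ^ bits_at l" "\<bar>cD\<bar> < 2 ^ bits_at l"
proof -
  have "(2::int) ^ c < 2 ^ bits_at l" by (rule power_strict_increasing) (auto simp: bits_at_def)
  then show "\<bar>cA\<bar> < 2 ^ bits_at l" "\<bar>cG\<bar> < 2 ^ bits_at l" "\<bar>cD\<bar> < 2 ^ bits_at l"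
    using cA_le cG_le cD_le by linarith+
qed

lemma entries_less:
  assumes "wnorm c xs \<le> 2 ^ j" "length xs \<le> l" "j \<le> c + 1"
  shows "\<forall>x\<in>set xs. \<bar>x\<bar> < 2 ^ bits_at l"
proof
  fix x assume "x \<in> set xs"
  then show "\<bar>x\<bar> < 2 ^ bits_at l"
    using assms(3) by (intro abs_less_of_wnorm[OF assms(1,2)]) (auto simp: bits_at_def algebra_simps)
qed

definition scale_time :: "nat \<Rightarrow> nat" where
  "scale_time l = (l + 1) * (zmul_time (bits_at l) + 20)"

lemma does_scale_at:
  assumes "wnorm c xs \<le> 1" "length xs \<le> l" "\<bar>k\<bar> < 2 ^ bits_at l"
  shows "does fSCALE [int_code k, ints_code xs] (scale_time l) (ints_code (map ((*) k) xs))"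
proof -
  have "\<forall>x\<in>set xs. \<bar>x\<bar> < 2 ^ bits_at l"
    using assms by (intro entries_less[of _ 0]) auto
  from does_scale[OF assms(3) this] show ?thesis
    by (rule does_mono) (use assms(2) in \<open>auto simp: scale_time_def\<close>)
qed

definition step_time :: "nat \<Rightarrow> nat" where
  "step_time l = 20 * l + 3 * scale_time l + (l + 1) * pmul_time l (bits_at l) + (l + 2) * pdiv_time l (bits_at l)
     + 10 * cells (int_code cA) + 10 * cells (int_code cG) + 100"

lemma does_step:
  assumes "wnorm c r \<le> 1" "wnorm c acc \<le> 1" "Suc (length r) \<le> l" "length acc \<le> l"
  shows "does fSTEP [ints_code r, ints_code acc] (step_time l) (ints_code (step r acc))"
proof -
  let ?s = "shift 0 acc" and ?b = "bits_at l"
  let ?x = "map ((*) cA) ?s" and ?y = "1 # map ((*) cG) r" and ?z = "map ((*) cA) r"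
  have ws: "wnorm c ?s \<le> 1"
  proof -
    have "wnorm c ?s \<le> wnorm c acc / 2 ^ c" using wnorm_shift[of c 0 acc] by (simp only: of_int_0 abs_zero add_0)
    also have "\<dots> \<le> wnorm c acc / 1" by (intro divide_left_mono) auto
    finally show ?thesis using assms(2) by simp
  qed
  note H = doesD[OF does_shift[of 0 acc]]
  have ls: "length ?s \<le> l" "length r \<le> l" using assms by auto
  note S1 = doesD[OF does_scale_at[OF ws ls(1) const_bounds(1)]]
  note S2 = doesD[OF does_scale_at[OF assms(1) ls(2) const_bounds(2)]]
  note S3 = doesD[OF does_scale_at[OF assms(1) ls(2) const_bounds(1)]]
  have bx: "\<forall>x\<in>set ?x. \<bar>x\<bar> < 2 ^ ?b"
    using wnorm_scale_shift[OF assms(2) cA_le_real] ls by (intro entries_less[of _ 0]) auto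
  have b_y: "\<forall>x\<in>set ?y. \<bar>x\<bar> < 2 ^ ?b"
    using order_trans[OF wnorm_cons_scale[OF assms(1)], of "2 ^ 1"] assms(3)
    by (intro entries_less[of _ 1]) (auto simp del: wnorm.simps)
  have bz: "\<forall>x\<in>set ?z. \<bar>x\<bar> < 2 ^ ?b"
  proof (rule entries_less[of _ c])
    have "(2::real) ^ c / 2 \<le> 2 ^ c" by simp
    then show "wnorm c ?z \<le> 2 ^ c" using wnorm_scale_cA[OF assms(1)] by argo
  qed (use assms in auto)
  have lens: "length ?x \<le> l" "length ?y \<le> l" "length ?z \<le> l" using assms by auto
  note M = doesD[OF does_pmul[OF bx b_y lens(1,2)], unfolded list_code_simps]
  have wp: "wnorm c (pmul ?x ?y) \<le> 2 ^ (c * 0)" using wnorm_pmul_step[OF assms(1,2)] by simp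
  have lp: "length (pmul ?x ?y) \<le> l" using assms by simp
  have "c * (0 + length (pmul ?x ?y)) < ?b"
  proof -
    have "c * (0 + length (pmul ?x ?y)) \<le> c * (l + 2)" using lp by (intro mult_left_mono) auto
    then show ?thesis unfolding bits_at_def by linarith
  qed
  note V = doesD[OF does_pdiv[OF wp wnorm_scale_cA[OF assms(1)] this bz lens(3) le_SucI[OF lp]]]
  have t1: "(length ?x + 1) * pmul_time l ?b \<le> (l + 1) * pmul_time l ?b"
    using lens by (intro mult_right_mono) auto
  have t2: "(length (pmul ?x ?y) + 1) * pdiv_time l ?b \<le> (l + 2) * pdiv_time l ?b"
    using lp by (intro mult_right_mono) auto
  have eq: "ints_code (step r acc) = ints_code (pdiv (pmul ?x ?y) ?z)" by (simp add: step_def)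
  have ta: "20 * length acc + 20 \<le> 20 * l + 20" using assms(4) by simp
  show ?thesis
    unfolding does_def call_prog eq
    by (simp add: step_body_def run_simps H(1) S1(1) S2(1) S3(1) M(1) V(1) del: pmul.simps)
       (use H(2) S1(2) S2(2) S3(2) M(2) V(2) t1 t2 ta in \<open>unfold step_time_def; linarith\<close>)
qed

definition pin_time :: "nat \<Rightarrow> nat \<Rightarrow> nat" where
  "pin_time l w = 60 * w + 20 * l + scale_time l + 2 * cells (int_code cA) + 2 * cells (int_code cG) + 200"

lemma does_pinprod:
  assumes "v < 2 ^ w" "vertices_below (2 ^ w) [] P" "wnorm c acc \<le> 1" "length acc \<le> l"
  shows "does fPINPROD [nat_code v, pins_code P, ints_code acc] ((length P + 1) * pin_time l w)
     (ints_code (pinprod v P acc))"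
  using assms(2-4)
proof (induction P arbitrary: acc)
  case Nil
  then show ?case by (simp add: does_def call_prog pinprod_body_def run_simps pin_time_def)
next
  case (Cons q P)
  obtain u f where q: "q = (u, f)" by (cases q)
  have *: "u < 2 ^ w" "vertices_below (2 ^ w) [] P"
    using Cons.prems by (auto simp: vertices_below_def q)
  note len = bit_length_le[OF *(1)] bit_length_le[OF assms(1)]
  note Q = doesD[OF does_eq[of u v]]
  define k where "k = (if f then cG else cA)"
  let ?a = "map ((*) k) (shift 0 acc)"
  have ws: "wnorm c (shift 0 acc) \<le> 1"
  proof -
    have "wnorm c (shift 0 acc) \<le> wnorm c acc / 2 ^ c" using wnorm_shift[of c 0 acc] by (simp only: of_int_0 abs_zero add_0)
    also have "\<dots> \<le> wnorm c acc / 1" by (intro divide_left_mono) auto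
    finally show ?thesis using Cons.prems by simp
  qed
  note H = doesD[OF does_shift[of 0 acc]]
  have ls: "length (shift 0 acc) \<le> l" "length ?a \<le> l" using Cons.prems by auto
  have "\<bar>k\<bar> < 2 ^ bits_at l" using const_bounds by (auto simp: k_def)
  note S = doesD[OF does_scale_at[OF ws ls(1) this]]
  have wa: "wnorm c ?a \<le> 1"
    using wnorm_scale_shift[OF Cons.prems(2) cA_le_real] wnorm_scale_shift[OF Cons.prems(2) cG_le_real]
    by (cases f) (auto simp: k_def)
  note IH = doesD[OF Cons.IH[OF *(2) wa ls(2)]] doesD[OF Cons.IH[OF *(2) Cons.prems(2,3)]]
  define Z where "Z = (length P + 1) * pin_time l w"
  have tot: "(length (q # P) + 1) * pin_time l w = Z + pin_time l w" by (simp add: Z_def)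
  note IH = IH[folded Z_def]
  have la: "20 * length acc \<le> 20 * l" using Cons.prems by simp
  show ?case
  proof (cases "u = v")
    case True
    have *: "ev prog env (if bool_code f = Atom then int_E cA else int_E cG) = Some (2 * cells (int_code k) + 1, int_code k)" for env
      by (simp add: k_def)
    have kc: "2 * cells (int_code k) \<le> 2 * cells (int_code cA) + 2 * cells (int_code cG)" by (simp add: k_def)
    have eq: "pinprod v (q # P) acc = pinprod v P ?a" by (simp add: q k_def True)
    show ?thesis
      unfolding does_def call_prog tot eq using True
      by (simp add: pinprod_body_def ev_simps evs_simps q H(1) IH(1) S(1) Q(1)[unfolded True] bool_code_True * del: bool_code_eq_Atom)
        (use len Q(2)[unfolded True] H(2) S(2) IH(2) la kc in \<open>simp add: pin_time_def; linarith\<close>)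
  next
    case False
    show ?thesis
      unfolding does_def call_prog tot using False
      by (simp add: pinprod_body_def run_simps q IH(3) Q(1))
        (use len Q(2) IH(4) in \<open>simp add: pin_time_def; linarith\<close>)
  qed
qed

end

section \<open>Running time\<close>

lemma vertices_belowD: "vertices_below n E P \<Longrightarrow> vertices_below n E []" "vertices_below n E P \<Longrightarrow> vertices_below n [] P"
  by (auto simp: vertices_below_def)

definition noloop :: "(nat \<times> nat) list \<Rightarrow> (nat \<times> nat) list" where
  "noloop E = filter (\<lambda>(x, y). x \<noteq> y) E"

text \<open>A loop has normalised weight \<open>\<gamma> x\<^sup>2 / \<beta> = (x / \<beta>) (\<gamma> x)\<close>, the product of the two kinds of pins.\<close>

fun looppins :: "(nat \<times> nat) list \<Rightarrow> (nat \<times> bool) list" where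
  "looppins [] = []"
| "looppins ((x, y) # E) = (if x = y then (x, False) # (x, True) # looppins E else looppins E)"

lemma length_noloop_looppins: "length (noloop E) + length (looppins E) \<le> 2 * length E"
  by (induction E rule: looppins.induct) (auto simp: noloop_def)

lemma vertices_below_noloop: "vertices_below n E [] \<Longrightarrow> vertices_below n (noloop E) (looppins E)"
  by (induction E rule: looppins.induct) (auto simp: noloop_def vertices_below_def)

lemma bit_length_div_power: "bit_length (b div 2 ^ n) = bit_length b - n"
proof (induction n arbitrary: b)
  case (Suc n)
  have "b div 2 ^ Suc n = b div 2 div 2 ^ n" by (simp add: div_mult2_eq)
  then show ?case using Suc[of "b div 2"] by (cases "b = 0") (auto simp: bit_length_unfold[of b])
qed simp

lemma ev_Cons_power:
  "ev p env e = Some (t, x) \<Longrightarrow>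
   ev p env ((Cons_E Nil_E ^^ n) e) = Some (t + 2 * n, (Cell Atom ^^ n) x)"
  by (induction n) (auto simp: ev_simps)

lemma Cell_power_unary_code: "(Cell Atom ^^ n) (unary_code m) = unary_code (n + m)"
  by (induction n) auto

lemma cells_unary_code [simp]: "cells (unary_code m) = m"
  by (induction m) auto

context spin_program
begin

text \<open>The value at y = 1 / \<open>cD\<close>, that is at x = 1, as an unreduced fraction with
  denominator \<open>cD ^ length xs\<close>.\<close>

fun horner :: "int list \<Rightarrow> int \<times> int" where
  "horner [] = (0, 1)"
| "horner (x # xs) = (case horner xs of (n, d) \<Rightarrow> (x * (d * cD) + n, d * cD))"

fun outer :: "nat \<Rightarrow> (nat \<times> nat) list \<Rightarrow> (nat \<times> bool) list \<Rightarrow> nat list \<Rightarrow> int \<Rightarrow> int \<Rightarrow> int \<times> int" where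
  "outer k E P [] num den = (num, den)"
| "outer k E P (v # vs) num den =
     (case horner (ratio k v E P) of (n, d) \<Rightarrow>
        outer k (rest v E) (pins (nbrs v E) P) vs (num * (d + n)) (den * d))"

lemma does_noloop:
  assumes "vertices_below (2 ^ w) E []"
  shows "does fNOLOOP [edges_code E] ((length E + 1) * (60 * w + 200)) (edges_code (noloop E))"
  using assms
proof (induction E)
  case Nil
  then show ?case by (simp add: does_def call_prog noloop_body_def run_simps noloop_def)
next
  case (Cons e E)
  obtain x y where e: "e = (x, y)" by (cases e)
  have *: "x < 2 ^ w" "y < 2 ^ w" "vertices_below (2 ^ w) E []"
    using Cons.prems by (auto simp: vertices_below_def e)
  note len = bit_length_le[OF *(1)] bit_length_le[OF *(2)]
  note IH = doesD[OF Cons.IH[OF *(3)]]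
  note Q = doesD[OF does_eq[of x y]]
  show ?case
    unfolding does_def call_prog using IH Q len
    by (cases "x = y") (simp_all add: noloop_body_def run_simps e noloop_def)
qed

lemma does_looppins:
  assumes "vertices_below (2 ^ w) E []"
  shows "does fLOOPPINS [edges_code E] ((length E + 1) * (60 * w + 200)) (pins_code (looppins E))"
  using assms
proof (induction E)
  case Nil
  then show ?case by (simp add: does_def call_prog looppins_body_def run_simps)
next
  case (Cons e E)
  obtain x y where e: "e = (x, y)" by (cases e)
  have *: "x < 2 ^ w" "y < 2 ^ w" "vertices_below (2 ^ w) E []"
    using Cons.prems by (auto simp: vertices_below_def e)
  note len = bit_length_le[OF *(1)] bit_length_le[OF *(2)]
  note IH = doesD[OF Cons.IH[OF *(3)]]
  note Q = doesD[OF does_eq[of x y]]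
  show ?case
    unfolding does_def call_prog using IH Q len
    by (cases "x = y") (simp_all add: looppins_body_def run_simps e)
qed

lemma does_count: "does fCOUNT [list_code f xs] ((length xs + 1) * (60 * length xs + 100)) (nat_code (length xs))"
proof (induction xs)
  case Nil
  then show ?case by (simp add: does_def call_prog count_body_def run_simps)
next
  case (Cons x xs)
  note IH = doesD[OF Cons.IH]
  note A = doesD[OF does_add[of True "length xs" 0]]
  have "bit_length (length xs) \<le> length xs" by (intro bit_length_le less_exp)
  then have t: "steps fADD [bool_code True, nat_code (length xs), nat_code 0] \<le> 60 * length xs + 60"
    using A(2) by simp
  show ?case
    unfolding does_def call_prog using IH A(1) t by (simp add: count_body_def run_simps algebra_simps)
qed

lemma does_drop:
  "does fDROP [nat_code b, nat_code a] (20 * bit_length a + 20) (nat_code (b div 2 ^ bit_length a))"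
proof (induction a arbitrary: b rule: less_induct)
  case (less a)
  show ?case
  proof (cases "a = 0")
    case True
    then show ?thesis by (simp add: does_def call_prog drop_body_def run_simps)
  next
    case False
    then have "a div 2 < a" by simp
    note IH = doesD[OF less[OF this, of "b div 2"]]
    have *: "b div 2 div 2 ^ bit_length (a div 2) = b div 2 ^ bit_length a"
      using False by (simp add: bit_length_unfold[of a] div_mult2_eq)
    show ?thesis
      unfolding does_def call_prog using IH[unfolded *] False
      by (simp add: drop_body_def run_simps bit_length_unfold[of a])
  qed
qed

lemma does_fuel:
  "does fFUEL [nat_code n, unary_code m] (bit_length n * (2 * K + 20) + 20) (unary_code (K * bit_length n + m))"
proof (induction n rule: less_induct)
  case (less n)
  show ?case
  proof (cases "n = 0")
    case True
    then show ?thesis by (simp add: does_def call_prog fuel_body_def run_simps)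
  next
    case False
    then have "n div 2 < n" by simp
    note IH = doesD[OF less[OF this]]
    have "ev prog [nat_code n, unary_code m] (Call_E fFUEL [Tl_E (Var 0), Var 1])
       = Some (4 + steps fFUEL [nat_code (n div 2), unary_code m], unary_code (K * bit_length (n div 2) + m))"
      by (simp add: run_simps IH(1))
    note * = ev_Cons_power[OF this, of K, unfolded Cell_power_unary_code]
    show ?thesis
      unfolding does_def call_prog using IH(2) * False
      by (simp add: fuel_body_def ev_simps(1,6) bit_length_unfold[of n] algebra_simps)
  qed
qed

lemma does_pow:
  assumes "\<bar>x\<bar> \<le> 2 ^ m" "m * (length xs + 1) < b"
  shows "does fPOW [int_code x, list_code f xs] ((length xs + 1) * (zmul_time b + 30)) (int_code (x ^ length xs))"
  using assms(2)
proof (induction xs)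
  case Nil
  then show ?case by (simp add: does_def call_prog pow_body_def run_simps)
next
  case (Cons y xs)
  have le: "m * (length xs + 1) < b" "m < b" using Cons.prems by auto
  have x: "\<bar>x\<bar> < 2 ^ b"
    using assms(1) power_strict_increasing[OF le(2), of "2::int"] by (rule order_le_less_trans) simp
  have "\<bar>x ^ length xs\<bar> \<le> (2 ^ m) ^ length xs"
    unfolding power_abs using assms(1) by (intro power_mono) auto
  also have "\<dots> < 2 ^ b"
    unfolding power_mult[symmetric] using le by (intro power_strict_increasing) auto
  finally have p: "\<bar>x ^ length xs\<bar> < 2 ^ b" .
  note IH = doesD[OF Cons.IH[OF le(1)]]
  note M = doesD[OF does_zmul[OF x p]]
  show ?case
    unfolding does_def call_prog using IH M by (simp add: pow_body_def run_simps)
qed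

end

section \<open>Cost of the recursion and of the whole program\<close>

context spin_algo
begin

definition overhead :: "nat \<Rightarrow> nat \<Rightarrow> nat \<Rightarrow> nat" where
  "overhead l M w = 2 * ((M + 1) * (120 * w + 250)) + (M + 1) * pin_time l w + 20 * l + 20 * M + step_time l + 200"

text \<open>Edges only turn into neighbours and neighbours into pins, so \<open>M\<close> bounds
  their total throughout. The subtracted \<open>overhead\<close> pays for the work around a
  recursive call: one round of \<open>loop\<close> then costs at most
  \<open>3 * overhead l M w * (d + 2) ^ k\<close>. Of the d + 2 such shares available at the next
  level, d go to the neighbours and two cover the work of the call itself.\<close>

lemma does_ratio:
  "k \<le> l \<Longrightarrow> v < 2 ^ w \<Longrightarrow> vertices_below (2 ^ w) E P \<Longrightarrow> length E + length P \<le> M \<Longrightarrow>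
   \<forall>u. length (nbrs u E) \<le> d \<Longrightarrow>
   does fRATIO [unary_code k, nat_code v, edges_code E, pins_code P]
     (3 * overhead l M w * (d + 2) ^ k - overhead l M w) (ints_code (ratio k v E P))"
  and does_loop:
  "Suc k \<le> l \<Longrightarrow> wnorm c acc \<le> 1 \<Longrightarrow> length acc = Suc k \<Longrightarrow> vertices_below (2 ^ w) E P \<Longrightarrow>
   \<forall>u\<in>set us. u < 2 ^ w \<Longrightarrow> length E + length us + length P \<le> M \<Longrightarrow> \<forall>u. length (nbrs u E) \<le> d \<Longrightarrow>
   does fLOOP [unary_code k, edges_code E, pins_code P, list_code nat_code us, ints_code acc]
     (overhead l M w + length us * (3 * overhead l M w * (d + 2) ^ k)) (ints_code (loop k E P us acc))"
proof (induction k v E P and k E P us acc rule: ratio_loop.induct)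
  case (1 v E P)
  then show ?case by (simp add: does_def call_prog ratio_body_def run_simps overhead_def)
next
  case (2 k v E P)
  let ?acc = "pinprod v P (1 # replicate k 0)"
  define W where "W = overhead l M w"
  define X where "X = 3 * W * (d + 2) ^ k"
  have acc: "wnorm c ?acc \<le> 1" "length ?acc = Suc k"
    using pinprod_props[of "1 # replicate k 0" v P] by auto
  have len: "length (rest v E) + length (nbrs v E) + length P \<le> M"
    using length_rest_nbrs[of v E] "2.prems"(4) by linarith
  have deg: "\<forall>u. length (nbrs u (rest v E)) \<le> d"
    using length_nbrs_rest "2.prems"(5) order_trans by blast
  note L = doesD[OF "2.IH"[OF "2.prems"(1) acc vertices_below_rest[OF "2.prems"(3)]
     vertices_below_nbrs[OF "2.prems"(3)] len deg], folded W_def, folded X_def]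
  note R = doesD[OF does_rest[OF "2.prems"(2) vertices_belowD(1)[OF "2.prems"(3)]]]
  note N = doesD[OF does_nbrs[OF "2.prems"(2) vertices_belowD(1)[OF "2.prems"(3)]]]
  have u: "wnorm c (1 # replicate k 0) \<le> 1" "length (1 # replicate k (0::int)) \<le> l"
    using "2.prems"(1) by auto
  note Q = doesD[OF does_pinprod[OF "2.prems"(2) vertices_belowD(2)[OF "2.prems"(3)] u], unfolded list_code_simps]
  note Z = doesD[OF does_zeros[of k]]
  have t1: "(length E + 1) * (120 * w + 250) \<le> (M + 1) * (120 * w + 250)"
    "(length P + 1) * pin_time l w \<le> (M + 1) * pin_time l w" "20 * k \<le> 20 * l"
    using "2.prems"(1,4) by (auto intro!: mult_right_mono)
  have W: "2 * ((M + 1) * (120 * w + 250)) + (M + 1) * pin_time l w + 20 * l + 200 \<le> W"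
    by (simp add: W_def overhead_def)
  have d: "length (nbrs v E) * X \<le> d * X" using "2.prems"(5) by (intro mult_right_mono) auto
  have "3 * W * 1 \<le> X" unfolding X_def by (intro mult_left_mono) auto
  then have XW: "3 * W \<le> X" by simp
  have tot: "3 * W * (d + 2) ^ Suc k = d * X + 2 * X" by (simp add: X_def algebra_simps)
  show ?case
    unfolding does_def call_prog W_def[symmetric] tot ratio.simps
    by (simp add: ratio_body_def run_simps L(1) R(1) N(1) Q(1) Z(1))
       (use L(2) R(2) N(2) Q(2) Z(2) t1 W d XW in linarith)
next
  case (3 k E P acc)
  then show ?case by (simp add: does_def call_prog loop_body_def run_simps overhead_def)
next
  case (4 k E P u us acc)
  define W where "W = overhead l M w"
  define X where "X = 3 * W * (d + 2) ^ k"
  let ?r = "ratio k u E (pins us P)"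
  have r: "wnorm c ?r \<le> 1" "length ?r = k" using ratio_props by auto
  have kl: "k \<le> l" "Suc (length ?r) \<le> l" "length acc \<le> l" using "4.prems" r by auto
  have u: "u < 2 ^ w" "\<forall>u\<in>set us. u < 2 ^ w" using "4.prems"(5) by auto
  have l1: "length E + length (pins us P) \<le> M" using "4.prems"(6) by simp
  note R = doesD[OF "4.IH"(1)[OF kl(1) u(1) vertices_below_pins[OF "4.prems"(4) u(2)] l1 "4.prems"(7)],
      folded W_def, folded X_def]
  note S = doesD[OF does_step[OF r(1) "4.prems"(2) kl(2,3)]]
  have s: "wnorm c (step ?r acc) \<le> 1" "length (step ?r acc) = Suc k"
    using wnorm_step[OF r(1) "4.prems"(2)] length_step[of acc ?r] r "4.prems"(3) by auto
  have vb: "vertices_below (2 ^ w) E ((u, True) # P)"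
    using "4.prems"(4) u(1) by (auto simp: vertices_below_def)
  have l2: "length E + length us + length ((u, True) # P) \<le> M" using "4.prems"(6) by simp
  note L = doesD[OF "4.IH"(2)[OF "4.prems"(1) s vb u(2) l2 "4.prems"(7)], folded W_def, folded X_def]
  note L = L[unfolded list_code_simps prod.case bool_code_True]
  note N = doesD[OF does_pins[of us P]]
  have W: "20 * length us + step_time l + 100 \<le> W" using "4.prems"(6) by (simp add: W_def overhead_def)
  have "3 * W * 1 \<le> X" unfolding X_def by (intro mult_left_mono) auto
  then have XW: "3 * W \<le> X" by simp
  have tot: "length (u # us) * X = length us * X + X" by simp
  show ?case
    unfolding does_def call_prog W_def[symmetric] X_def[symmetric] tot
    by (simp add: loop_body_def run_simps L(1) R(1) N(1) S(1))
       (use L(2) R(2) N(2) S(2) W XW in linarith)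
qed

lemma horner_snd: "snd (horner xs) = cD ^ length xs"
  by (induction xs) (auto simp: case_prod_beta)

lemma abs_cD_power: "\<bar>cD ^ n\<bar> \<le> 2 ^ (c * n)"
proof -
  have "\<bar>cD\<bar> ^ n \<le> (2 ^ c) ^ n" using cD_le by (intro power_mono) auto
  then show ?thesis by (simp add: power_abs power_mult)
qed

lemma horner_fst:
  assumes "\<forall>x\<in>set xs. \<bar>x\<bar> < 2 ^ b"
  shows "\<bar>fst (horner xs)\<bar> \<le> int (length xs) * 2 ^ (b + c * length xs)"
  using assms
proof (induction xs)
  case (Cons x xs)
  have "\<bar>x * (snd (horner xs) * cD)\<bar> = \<bar>x\<bar> * \<bar>cD ^ Suc (length xs)\<bar>"
    by (simp add: horner_snd abs_mult mult.commute)
  also have "\<dots> \<le> 2 ^ b * 2 ^ (c * Suc (length xs))"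
    using Cons.prems abs_cD_power[of "Suc (length xs)"] by (intro mult_mono) auto
  also have "\<dots> = 2 ^ (b + c * length (x # xs))" by (simp add: power_add)
  finally have 1: "\<bar>x * (snd (horner xs) * cD)\<bar> \<le> 2 ^ (b + c * length (x # xs))" .
  have "\<bar>fst (horner xs)\<bar> \<le> int (length xs) * 2 ^ (b + c * length xs)"
    using Cons by auto
  also have "\<dots> \<le> int (length xs) * 2 ^ (b + c * length (x # xs))"
    by (intro mult_left_mono power_increasing) auto
  finally have 2: "\<bar>fst (horner xs)\<bar> \<le> int (length xs) * 2 ^ (b + c * length (x # xs))" .
  have "fst (horner (x # xs)) = x * (snd (horner xs) * cD) + fst (horner xs)"
    by (simp add: case_prod_beta)
  moreover have "int (length (x # xs)) * 2 ^ (b + c * length (x # xs))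
      = 2 ^ (b + c * length (x # xs)) + int (length xs) * 2 ^ (b + c * length (x # xs))"
    by (simp add: algebra_simps)
  ultimately show ?case using 1 2 by linarith
qed simp

definition horner_bits :: "nat \<Rightarrow> nat" where
  "horner_bits l = bits_at l + c * l + l + 1"

lemma horner_bounds:
  assumes "\<forall>x\<in>set xs. \<bar>x\<bar> < 2 ^ bits_at l" "length xs \<le> l"
  shows "\<bar>fst (horner xs)\<bar> < 2 ^ horner_bits l" "\<bar>snd (horner xs)\<bar> < 2 ^ horner_bits l"
proof -
  have cl: "c * length xs \<le> c * l" using assms(2) by (rule mult_left_mono) simp
  have "length xs < 2 ^ l" using assms(2) less_exp[of l] by (meson order_le_less_trans)
  then have n: "int (length xs) < 2 ^ l" by (metis of_nat_less_iff of_nat_numeral of_nat_power)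
  have "\<bar>fst (horner xs)\<bar> \<le> int (length xs) * 2 ^ (bits_at l + c * length xs)"
    by (rule horner_fst[OF assms(1)])
  also have "\<dots> < 2 ^ l * 2 ^ (bits_at l + c * length xs)"
    by (intro mult_strict_right_mono[OF n]) simp
  also have "\<dots> = 2 ^ (l + (bits_at l + c * length xs))" by (simp add: power_add)
  also have "\<dots> \<le> 2 ^ horner_bits l"
  proof (rule power_increasing)
    show "l + (bits_at l + c * length xs) \<le> horner_bits l"
      unfolding horner_bits_def using cl by linarith
  qed simp
  finally show "\<bar>fst (horner xs)\<bar> < 2 ^ horner_bits l" .
  have "\<bar>snd (horner xs)\<bar> \<le> 2 ^ (c * length xs)"
    unfolding horner_snd by (rule abs_cD_power)
  also have "\<dots> < 2 ^ horner_bits l"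
  proof (rule power_strict_increasing)
    show "c * length xs < horner_bits l"
      unfolding horner_bits_def using cl by linarith
  qed simp
  finally show "\<bar>snd (horner xs)\<bar> < 2 ^ horner_bits l" .
qed

definition horner_time :: "nat \<Rightarrow> nat" where
  "horner_time l = 2 * zmul_time (horner_bits l) + 180 * horner_bits l + 2 * cells (int_code cD) + 300"

lemma does_horner:
  assumes "\<forall>x\<in>set xs. \<bar>x\<bar> < 2 ^ bits_at l" "length xs \<le> l"
  shows "does fHORNER [ints_code xs] ((length xs + 1) * horner_time l)
     (Cell (int_code (fst (horner xs))) (int_code (snd (horner xs))))"
  using assms
proof (induction xs)
  case Nil
  then show ?case by (simp add: does_def call_prog horner_body_def run_simps horner_time_def)
next
  case (Cons x xs)
  let ?h = "horner_bits l"
  have xs: "\<forall>x\<in>set xs. \<bar>x\<bar> < 2 ^ bits_at l" "length xs \<le> l" using Cons.prems by auto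
  have bh: "bits_at l \<le> ?h" by (simp add: horner_bits_def)
  have pw: "(2::int) ^ bits_at l \<le> 2 ^ ?h" by (intro power_increasing bh) auto
  have x: "\<bar>x\<bar> < 2 ^ bits_at l" "\<bar>x\<bar> < 2 ^ ?h" "\<bar>cD\<bar> < 2 ^ ?h"
    using Cons.prems(1) pw const_bounds(3)[of l] by (auto intro: order_less_le_trans)
  note hb = horner_bounds[OF xs]
  note IH = doesD[OF Cons.IH[OF xs]]
  note M1 = doesD[OF does_zmul[OF hb(2) x(3)]]
  have sd: "snd (horner xs) * cD = snd (horner (x # xs))" by (simp add: case_prod_beta)
  have dh: "\<bar>snd (horner xs) * cD\<bar> < 2 ^ ?h"
    unfolding sd by (rule horner_bounds[OF Cons.prems])
  note M2 = doesD[OF does_zmul[OF x(2) dh]]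
  have "\<bar>x * (snd (horner xs) * cD)\<bar> < 2 ^ ?h"
  proof -
    have "\<bar>snd (horner xs) * cD\<bar> \<le> 2 ^ (c * l)"
    proof -
      have "\<bar>snd (horner xs) * cD\<bar> \<le> 2 ^ (c * length (x # xs))"
        unfolding sd unfolding horner_snd by (rule abs_cD_power)
      also have "\<dots> \<le> 2 ^ (c * l)" using Cons.prems(2) by (intro power_increasing mult_left_mono) auto
      finally show ?thesis .
    qed
    then have "\<bar>x\<bar> * \<bar>snd (horner xs) * cD\<bar> \<le> 2 ^ bits_at l * 2 ^ (c * l)"
      using x(1) by (intro mult_mono) auto
    also have "\<dots> = 2 ^ (bits_at l + c * l)" by (simp add: power_add)
    also have "\<dots> < 2 ^ ?h" by (intro power_strict_increasing) (auto simp: horner_bits_def)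
    finally show ?thesis by (simp add: abs_mult)
  qed
  note A = doesD[OF does_zadd[OF this hb(1)]]
  define Z where "Z = (length xs + 1) * horner_time l"
  have tot: "(length (x # xs) + 1) * horner_time l = Z + horner_time l" by (simp add: Z_def)
  note IH = IH[folded Z_def]
  have eq: "fst (horner (x # xs)) = x * (snd (horner xs) * cD) + fst (horner xs)"
     "snd (horner (x # xs)) = snd (horner xs) * cD"
    by (simp_all add: case_prod_beta)
  show ?case
    unfolding does_def call_prog tot eq
    by (simp add: horner_body_def run_simps IH(1) M1(1) M2(1) A(1))
       (use IH(2) M1(2) M2(2) A(2) in \<open>unfold horner_time_def; linarith\<close>)
qed

definition outer_time :: "nat \<Rightarrow> nat \<Rightarrow> nat \<Rightarrow> nat \<Rightarrow> nat \<Rightarrow> nat" where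
  "outer_time l M w d m = 3 * overhead l M w * (d + 2) ^ l + (l + 1) * horner_time l
     + 2 * ((M + 1) * (120 * w + 250)) + 20 * M + 180 * horner_bits l + 2 * zmul_time m + 500"

text \<open>Fractions are never reduced. Each vertex lengthens numerator and denominator by at most
  \<open>horner_bits l + 1\<close> bits; \<open>j\<close> follows their current length and
  \<open>m\<close> bounds it at the end.\<close>

lemma does_outer:
  assumes "\<forall>v\<in>set vs. v < 2 ^ w" "vertices_below (2 ^ w) E P" "length E + length P \<le> M"
    "\<forall>u. length (nbrs u E) \<le> d" "\<bar>num\<bar> < 2 ^ j" "\<bar>den\<bar> < 2 ^ j" "j + (length vs + 1) * (horner_bits l + 1) \<le> m"
  shows "does fOUTER [unary_code l, edges_code E, pins_code P, list_code nat_code vs, int_code num, int_code den]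
     ((length vs + 1) * outer_time l M w d m)
     (Cell (int_code (fst (outer l E P vs num den))) (int_code (snd (outer l E P vs num den))))"
  using assms
proof (induction vs arbitrary: E P num den j)
  case Nil
  then show ?case by (simp add: does_def call_prog outer_body_def run_simps outer_time_def)
next
  case (Cons v vs)
  have v: "v < 2 ^ w" "\<forall>v\<in>set vs. v < 2 ^ w" using Cons.prems(1) by auto
  let ?r = "ratio l v E P" and ?h = "horner_bits l"
  have r: "wnorm c ?r \<le> 2 ^ 0" "length ?r = l" using ratio_props by auto
  have re: "\<forall>x\<in>set ?r. \<bar>x\<bar> < 2 ^ bits_at l" by (rule entries_less[OF r(1)]) (auto simp: r)
  note R = doesD[OF does_ratio[OF order_refl[of l] v(1) Cons.prems(2,3,4)]]
  note H = doesD[OF does_horner[OF re eq_refl[OF r(2)]], unfolded r(2)]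
  obtain n d' where nd: "horner ?r = (n, d')" by (cases "horner ?r")
  note H = H[unfolded nd fst_conv snd_conv]
  have hb: "\<bar>n\<bar> < 2 ^ ?h" "\<bar>d'\<bar> < 2 ^ ?h" using horner_bounds[OF re eq_refl[OF r(2)]] by (simp_all add: nd)
  note A = doesD[OF does_zadd[OF hb(2,1)]]
  have dn: "\<bar>d' + n\<bar> < 2 ^ (?h + 1)" using hb by simp
  have dn': "\<bar>d'\<bar> < 2 ^ (?h + 1)" using hb by simp
  have jm: "j \<le> m" "?h + 1 \<le> m" using Cons.prems(7) by auto
  have pw: "(2::int) ^ j \<le> 2 ^ m" "(2::int) ^ (?h + 1) \<le> 2 ^ m" by (intro power_increasing jm; simp)+
  have big: "\<bar>num\<bar> < 2 ^ m" "\<bar>den\<bar> < 2 ^ m" "\<bar>d' + n\<bar> < 2 ^ m" "\<bar>d'\<bar> < 2 ^ m"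
    by (rule order_less_le_trans[OF Cons.prems(5) pw(1)] order_less_le_trans[OF Cons.prems(6) pw(1)]
        order_less_le_trans[OF dn pw(2)] order_less_le_trans[OF dn' pw(2)])+
  note M1 = doesD[OF does_zmul[OF big(1,3)]]
  note M2 = doesD[OF does_zmul[OF big(2,4)]]
  have nj: "\<bar>num * (d' + n)\<bar> < 2 ^ (j + (?h + 1))"
    unfolding abs_mult power_add[of _ j] using Cons.prems(5) dn by (intro mult_strict_mono) auto
  have dj: "\<bar>den * d'\<bar> < 2 ^ (j + (?h + 1))"
    unfolding abs_mult power_add[of _ j] using Cons.prems(6) dn' by (intro mult_strict_mono) auto
  note RS = doesD[OF does_rest[OF v(1) vertices_belowD(1)[OF Cons.prems(2)]]]
  note N = doesD[OF does_nbrs[OF v(1) vertices_belowD(1)[OF Cons.prems(2)]]]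
  note PI = doesD[OF does_pins[of "nbrs v E" P]]
  have len: "length (rest v E) + length (pins (nbrs v E) P) \<le> M"
    using length_rest_nbrs[of v E] Cons.prems(3) by simp
  have deg: "\<forall>u. length (nbrs u (rest v E)) \<le> d"
    using length_nbrs_rest Cons.prems(4) order_trans by blast
  have vb: "vertices_below (2 ^ w) (rest v E) (pins (nbrs v E) P)"
    by (rule vertices_below_pins[OF vertices_below_rest[OF Cons.prems(2)] vertices_below_nbrs[OF Cons.prems(2)]])
  have mm: "j + (?h + 1) + (length vs + 1) * (?h + 1) \<le> m" using Cons.prems(7) by (simp add: algebra_simps)
  note IH = doesD[OF Cons.IH[OF v(2) vb len deg nj dj mm]]
  define Z where "Z = (length vs + 1) * outer_time l M w d m"
  have tot: "(length (v # vs) + 1) * outer_time l M w d m = Z + outer_time l M w d m" by (simp add: Z_def)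
  note IH = IH[folded Z_def]
  have eq: "outer l E P (v # vs) num den = outer l (rest v E) (pins (nbrs v E) P) vs (num * (d' + n)) (den * d')"
    by (simp add: nd)
  have t1: "(length E + 1) * (120 * w + 250) \<le> (M + 1) * (120 * w + 250)" 
    using Cons.prems(3) by (intro mult_right_mono) auto
  have t2: "20 * length (nbrs v E) + 20 \<le> 20 * M + 20"
    using length_rest_nbrs[of v E] Cons.prems(3) by simp
  have t3: "y - (z::nat) \<le> y" for y z by simp
  define T1 where "T1 = 3 * overhead l M w * (d + 2) ^ l"
  define T2 where "T2 = (l + 1) * horner_time l"
  define T3 where "T3 = (M + 1) * (120 * w + 250)"
  have ot: "outer_time l M w d m = T1 + T2 + 2 * T3 + 20 * M + 180 * horner_bits l + 2 * zmul_time m + 500"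
    by (simp add: outer_time_def T1_def T2_def T3_def)
  note R2 = order_trans[OF R(2) t3, folded T1_def]
  note H2 = H(2)[folded T2_def] and t1 = t1[folded T3_def]
  show ?case
    unfolding does_def call_prog tot eq
    by (simp add: outer_body_def run_simps IH(1) R(1) H(1) A(1) M1(1) M2(1) RS(1) N(1) PI(1))
       (use IH(2) R2 H2 A(2) M1(2) M2(2) RS(2) N(2) PI(2) t1 t2 ot in linarith)
qed

text \<open>Here \<open>n\<close> bounds the numbers of vertices and edges as well as all bit
  lengths of the input. The total of edges and pins is bounded by \<open>2 * n\<close>, because a
  loop becomes two pins.\<close>

definition main_time :: "nat \<Rightarrow> nat \<Rightarrow> nat \<Rightarrow> nat" where
  "main_time n l d =
     (n + 1) * outer_time l (2 * n) n d (c * (n + 1) + 1 + (n + 1) * (horner_bits l + 1))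
     + 2 * ((n + 1) * (60 * n + 200)) + 2 * ((n + 1) * (zmul_time (c * (n + 1) + 1) + 30))
     + (n + 1) * (60 * n + 100) + 2 * (n * (2 * K + 20)) + 20 * n
     + 20 * K + 10 * cells (int_code bn) + 10 * cells (int_code bd) + 500"

lemma does_main:
  assumes "length vs \<le> n" "length es \<le> n" "\<forall>v\<in>set vs. v < 2 ^ n" "vertices_below (2 ^ n) es []"
    "\<forall>u. length (nbrs u (noloop es)) \<le> d" "a > 0" "bit_length (nat a) \<le> n" "bit_length b \<le> n"
  defines "l \<equiv> K * bit_length (length vs) + (K * (bit_length b - bit_length (nat a)) + 3 * K)"
  defines "out \<equiv> outer l (noloop es) (looppins es) vs (bn ^ length es) (bd ^ length es)"
  shows "does 0 [Cell (Cell (list_code nat_code vs) (edges_code es)) (Cell (int_code a) (nat_code b))]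
     (main_time n l d) (Cell (int_code (fst out)) (nat_code (nat \<bar>snd out\<bar>)))"
proof -
  note C = doesD[OF does_count[of nat_code vs]]
  note D = doesD[OF does_drop[of b "nat a"]]
  note F1 = doesD[OF does_fuel[of "b div 2 ^ bit_length (nat a)" "3 * K"], unfolded bit_length_div_power]
  note F2 = doesD[OF does_fuel[of "length vs" "K * (bit_length b - bit_length (nat a)) + 3 * K"], folded l_def]
  note NL = doesD[OF does_noloop[OF assms(4)]]
  note LP = doesD[OF does_looppins[OF assms(4)]]
  let ?q = "c * (n + 1) + 1"
  have q: "c * (length es + 1) < ?q" 
    using assms(2) by (simp add: less_Suc_eq_le)
  note P1 = doesD[OF does_pow[OF bn_le q, where f = "\<lambda>(u, v). Cell (nat_code u) (nat_code v)"]]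
  note P2 = doesD[OF does_pow[OF bd_le q, where f = "\<lambda>(u, v). Cell (nat_code u) (nat_code v)"]]
  have pb: "\<bar>x ^ length es\<bar> < 2 ^ ?q" if "\<bar>x\<bar> \<le> 2 ^ c" for x :: int
  proof -
    have "\<bar>x ^ length es\<bar> \<le> (2 ^ c) ^ length es"
      unfolding power_abs using that by (intro power_mono) auto
    also have "\<dots> < 2 ^ ?q"
      unfolding power_mult[symmetric] using q by (intro power_strict_increasing) auto
    finally show ?thesis .
  qed
  let ?m = "?q + (n + 1) * (horner_bits l + 1)"
  have mm: "?q + (length vs + 1) * (horner_bits l + 1) \<le> ?m"
    using assms(1) by (intro add_left_mono mult_right_mono) auto
  have len: "length (noloop es) + length (looppins es) \<le> 2 * n"
    using length_noloop_looppins[of es] assms(2) by linarith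
  note O = doesD[OF does_outer[OF assms(3) vertices_below_noloop[OF assms(4)] len assms(5) pb[OF bn_le] pb[OF bd_le] mm],
     folded out_def]
  have t1: "(length vs + 1) * outer_time l (2 * n) n d ?m \<le> (n + 1) * outer_time l (2 * n) n d ?m"
    using assms(1) by (intro mult_right_mono) auto
  have t2: "(length es + 1) * (60 * n + 200) \<le> (n + 1) * (60 * n + 200)"
    "(length es + 1) * (zmul_time ?q + 30) \<le> (n + 1) * (zmul_time ?q + 30)"
    using assms(2) by (intro mult_right_mono; simp)+
  have t3: "(length vs + 1) * (60 * length vs + 100) \<le> (n + 1) * (60 * n + 100)"
    using assms(1) by (intro mult_mono) auto
  have "bit_length (length vs) \<le> length vs" by (intro bit_length_le less_exp)
  then have t4: "bit_length (length vs) * (2 * K + 20) \<le> n * (2 * K + 20)"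
    "(bit_length b - bit_length (nat a)) * (2 * K + 20) \<le> n * (2 * K + 20)"
    using assms(1,8) by (intro mult_right_mono; simp)+
  have aa: "nat \<bar>a\<bar> = nat a" using assms(6) by simp
  define T1 where "T1 = (n + 1) * outer_time l (2 * n) n d ?m"
  define T2 where "T2 = (n + 1) * (60 * n + 200)"
  define T3 where "T3 = (n + 1) * (zmul_time ?q + 30)"
  define T4 where "T4 = (n + 1) * (60 * n + 100)"
  define T5 where "T5 = n * (2 * K + 20)"
  have mt: "main_time n l d = T1 + 2 * T2 + 2 * T3 + T4 + 2 * T5 + 20 * n
     + 20 * K + 10 * cells (int_code bn) + 10 * cells (int_code bd) + 500"
    by (simp only: main_time_def T1_def T2_def T3_def T4_def T5_def)
  note t1 = t1[folded T1_def] and t2 = t2[folded T2_def T3_def] and t3 = t3[folded T4_def] and t4 = t4[folded T5_def]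
  show ?thesis
    unfolding does_def call_prog
    by (simp add: main_body_def run_simps aa C(1) D(1) F1(1) F2(1) NL(1) LP(1) P1(1) P2(1) O(1))
       (use C(2) D(2) F1(2) F2(2) NL(2) LP(2) P1(2) P2(2) O(2) t1 t2 t3 t4 assms(7) mt in linarith)
qed

end

section \<open>Power series of the spin ratios\<close>

text \<open>The half-edge weights divided by \<beta>, with A for x / \<beta> and G for \<gamma> x,
  so that the all-zero configuration has weight 1. A configuration is its set T of vertices of spin
  1. The ring is left open: the sums occur over naturals, complex numbers and formal power
  series.\<close>

fun edge_wt :: "'a::comm_semiring_1 \<Rightarrow> 'a \<Rightarrow> nat set \<Rightarrow> nat \<times> nat \<Rightarrow> 'a" where
  "edge_wt A G T (u, v) = (if u \<in> T then (if v \<in> T then A * G else A) else if v \<in> T then A else 1)"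

fun pin_wt :: "'a::comm_semiring_1 \<Rightarrow> 'a \<Rightarrow> nat set \<Rightarrow> nat \<times> bool \<Rightarrow> 'a" where
  "pin_wt A G T (u, f) = (if u \<in> T then (if f then G else A) else 1)"

definition wt :: "'a::comm_semiring_1 \<Rightarrow> 'a \<Rightarrow> (nat \<times> nat) list \<Rightarrow> (nat \<times> bool) list \<Rightarrow> nat set \<Rightarrow> 'a" where
  "wt A G E P T = prod_list (map (edge_wt A G T) E) * prod_list (map (pin_wt A G T) P)"

definition Zsum :: "'a::comm_semiring_1 \<Rightarrow> 'a \<Rightarrow> nat set \<Rightarrow> (nat \<times> nat) list \<Rightarrow> (nat \<times> bool) list \<Rightarrow> 'a" where
  "Zsum A G W E P = (\<Sum>T\<in>Pow W. wt A G E P T)"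

definition pins1 :: "nat list \<Rightarrow> (nat \<times> bool) list \<Rightarrow> (nat \<times> bool) list" where
  "pins1 us P = map (\<lambda>u. (u, True)) us @ P"

definition pin_factor :: "'a::comm_semiring_1 \<Rightarrow> 'a \<Rightarrow> nat \<Rightarrow> (nat \<times> bool) list \<Rightarrow> 'a" where
  "pin_factor A G v P = prod_list (map (\<lambda>(u, f). if u = v then (if f then G else A) else 1) P)"

lemma wt_simps:
  "wt A G [] [] T = 1"
  "wt A G (e # E) P T = edge_wt A G T e * wt A G E P T"
  "wt A G E (q # P) T = pin_wt A G T q * wt A G E P T"
  by (simp_all add: wt_def ac_simps)

lemma wt_empty [simp]: "wt A G E P {} = 1"
proof -
  have "prod_list (map (edge_wt A G {}) E) = 1"
    by (induction E) auto
  moreover have "prod_list (map (pin_wt A G {}) P) = 1"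
    by (induction P) auto
  ultimately show ?thesis by (simp add: wt_def)
qed

lemma wt_pins_append: "wt A G E (P @ Q) T = prod_list (map (pin_wt A G T) P) * wt A G E Q T"
  by (simp add: wt_def ac_simps)

lemma wt_pins1_Cons: "wt A G E (pins1 us ((u, True) # P)) T = wt A G E (pins1 (u # us) P) T"
  and wt_pins_True: "wt A G E (pins us ((u, True) # P)) T = wt A G E ((u, True) # pins us P) T"
  by (simp_all add: pins1_def pins_def wt_simps wt_pins_append ac_simps)

text \<open>An edge to a vertex of spin 0 acts on its other end exactly like a pin with
  \<open>False\<close>.\<close>

lemma wt_remove:
  assumes "v \<notin> T"
  shows "wt A G E P T = wt A G (rest v E) (pins (nbrs v E) P) T"
proof (induction E)
  case (Cons e E)
  then show ?case
    using assms by (cases e) (auto simp: wt_simps ac_simps)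
qed simp

text \<open>An edge at a vertex of spin 1 weighs A, times G if its other end has spin 1 too: one A
  per edge splits off and a pin with \<open>True\<close> remains. A loop would pin the vertex to
  itself, hence the assumption on \<open>E\<close>.\<close>

lemma wt_insert:
  assumes "v \<notin> T" "\<And>x y. (x, y) \<in> set E \<Longrightarrow> x \<noteq> y"
  shows "wt A G E P (insert v T)
     = pin_factor A G v P * A ^ length (nbrs v E) * wt A G (rest v E) (pins1 (nbrs v E) P) T"
  using assms(2)
proof (induction E)
  case Nil
  show ?case
  proof (induction P)
    case (Cons q P)
    then show ?case
      using assms(1) by (cases q) (auto simp: wt_simps pin_factor_def pins1_def ac_simps)
  qed (simp add: wt_simps pin_factor_def pins1_def)
next
  case (Cons e E)
  obtain x y where e: "e = (x, y)" by (cases e)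
  have xy: "x \<noteq> y" using Cons.prems[of x y] e by simp
  have IH: "wt A G E P (insert v T)
     = pin_factor A G v P * A ^ length (nbrs v E) * wt A G (rest v E) (pins1 (nbrs v E) P) T"
    using Cons by auto
  show ?case
    using assms(1) xy by (simp add: e wt_simps IH pins1_def ac_simps)
qed

lemma wt_hom:
  assumes "h 1 = 1" "\<And>x y. h (x * y) = h x * h y"
  shows "h (wt A G E P T) = wt (h A) (h G) E P T"
proof -
  have "h (prod_list xs) = prod_list (map h xs)" for xs
    by (induction xs) (auto simp: assms)
  moreover have "h (edge_wt A G T e) = edge_wt (h A) (h G) T e" for e
    by (cases e) (auto simp: assms)
  moreover have "h (pin_wt A G T q) = pin_wt (h A) (h G) T q" for q
    by (cases q) (auto simp: assms)
  ultimately show ?thesis by (simp add: wt_def assms(2) comp_def)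
qed

text \<open>Needed for \<open>of_nat\<close> and for the constant coefficient of a power
  series.\<close>

lemma Zsum_hom:
  assumes "h 1 = 1" "\<And>x y. h (x * y) = h x * h y" "h 0 = 0" "\<And>x y. h (x + y) = h x + h y"
  shows "h (Zsum A G W E P) = Zsum (h A) (h G) W E P"
proof -
  have "h (sum f S) = (\<Sum>x\<in>S. h (f x))" for f :: "nat set \<Rightarrow> _" and S
    by (induction S rule: infinite_finite_induct) (auto simp: assms)
  then show ?thesis by (simp add: Zsum_def wt_hom[of h, OF assms(1,2)])
qed

text \<open>At x = 0 only sets of vertices that meet no edge and no pin survive, so the sum counts
  them and need not be 1. Positivity is evident over the naturals, from where \<open>of_nat\<close>
  carries it over.\<close>

lemma Zsum_0_nonzero:
  assumes "finite W"
  shows "Zsum (0::'a::{comm_semiring_1, semiring_char_0}) 0 W E P \<noteq> 0"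
proof -
  have "(1::nat) = (\<Sum>T\<in>{{}}. wt 0 0 E P T)" by simp
  also have "\<dots> \<le> Zsum 0 0 W E P"
    unfolding Zsum_def using assms by (intro sum_mono2) auto
  finally have "Zsum (0::nat) 0 W E P \<noteq> 0" by simp
  moreover have "of_nat (Zsum 0 0 W E P) = (Zsum 0 0 W E P :: 'a)"
    using Zsum_hom[of "of_nat :: nat \<Rightarrow> 'a" 0 0 W E P] by simp
  ultimately show ?thesis by (metis of_nat_eq_0_iff)
qed

lemma sum_Pow_insert:
  assumes "finite W" "v \<notin> W"
  shows "(\<Sum>T\<in>Pow (insert v W). f T) = (\<Sum>T\<in>Pow W. f T) + (\<Sum>T\<in>Pow W. f (insert v T))"
proof -
  have "inj_on (insert v) (Pow W)"
    using assms(2) by (auto simp: inj_on_def)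
  moreover have "Pow W \<inter> insert v ` Pow W = {}"
    using assms(2) by auto
  ultimately show ?thesis
    using assms(1) by (simp add: Pow_insert sum.union_disjoint sum.reindex)
qed

section \<open>Lists as truncations of formal power series\<close>

definition truncates :: "complex fps \<Rightarrow> int list \<Rightarrow> bool" where
  "truncates F xs \<longleftrightarrow> (\<forall>i < length xs. of_int (xs ! i) = fps_nth F i)"

lemma truncates_Nil [simp]: "truncates F []"
  by (simp add: truncates_def)

lemma truncates_Cons: "truncates F (x # xs) \<longleftrightarrow> of_int x = fps_nth F 0 \<and> truncates (fps_shift 1 F) xs"
  by (auto simp: truncates_def less_Suc_eq_0_disj)

lemma truncates_scale: "truncates F xs \<Longrightarrow> truncates (fps_const (of_int k) * F) (map ((*) k) xs)"
  by (auto simp: truncates_def)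

lemma truncates_map2_plus: "truncates F xs \<Longrightarrow> truncates H ys \<Longrightarrow> truncates (F + H) (map2 (+) xs ys)"
  by (auto simp: truncates_def)

lemma fps_split_0: "F = fps_const (fps_nth F 0) + fps_X * fps_shift 1 (F :: complex fps)"
  by (simp add: fps_eq_iff)

lemma truncates_Cons_mult_X: "truncates F xs \<Longrightarrow> truncates (fps_const (of_int x) + fps_X * F) (x # xs)"
proof -
  have "fps_shift 1 (fps_const (of_int x) + fps_X * F) = F" by (simp add: fps_eq_iff)
  then show "truncates F xs \<Longrightarrow> ?thesis" by (simp add: truncates_Cons)
qed

lemma truncates_shift: "truncates F xs \<Longrightarrow> truncates (fps_const (of_int x) + fps_X * F) (shift x xs)"
proof (induction xs arbitrary: F x)
  case (Cons y xs)
  have eq: "fps_const (of_int y) + fps_X * fps_shift 1 F = F"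
    using Cons.prems fps_split_0[of F] by (simp add: truncates_Cons)
  have "truncates F (shift y xs)"
    using Cons.IH[of "fps_shift 1 F" y] Cons.prems unfolding eq by (simp add: truncates_Cons)
  then show ?case using truncates_Cons_mult_X by simp
qed simp

lemma truncates_pmul: "truncates F xs \<Longrightarrow> truncates H ys \<Longrightarrow> truncates (F * H) (pmul xs ys)"
proof (induction xs arbitrary: F)
  case (Cons x xs)
  have F: "F = fps_const (of_int x) + fps_X * fps_shift 1 F"
    using Cons.prems(1) fps_split_0[of F] by (simp add: truncates_Cons)
  have "truncates (fps_shift 1 F * H) (pmul xs ys)"
    using Cons by (simp add: truncates_Cons)
  from truncates_Cons_mult_X[OF this, of 0]
  have "truncates (fps_X * (fps_shift 1 F * H)) (0 # pmul xs ys)" by simp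
  then have "truncates (fps_const (of_int x) * H + fps_X * (fps_shift 1 F * H)) (pmul (x # xs) ys)"
    unfolding pmul.simps by (intro truncates_map2_plus truncates_scale Cons.prems(2))
  also have "fps_const (of_int x) * H + fps_X * (fps_shift 1 F * H) = F * H"
    by (subst (2) F) (simp add: algebra_simps)
  finally show ?case .
qed simp

text \<open>Long division: if F = x + X F1 then F / (1 + X U) = x + X (F1 - x U) / (1 + X
  U).\<close>

lemma truncates_pdiv:
  "truncates F xs \<Longrightarrow> truncates U ys \<Longrightarrow> truncates (F * inverse (1 + fps_X * U)) (pdiv xs ys)"
proof (induction xs ys arbitrary: F rule: pdiv.induct)
  case (2 x xs ys)
  let ?I = "inverse (1 + fps_X * U)"
  let ?F1 = "fps_shift 1 F" and ?x = "fps_const (of_int x) :: complex fps"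
  have F: "F = ?x + fps_X * ?F1"
    using "2.prems"(1) fps_split_0[of F] by (simp add: truncates_Cons)
  have inv: "(1 + fps_X * U) * ?I = 1"
    by (rule inverse_mult_eq_1') simp
  have "truncates (?F1 + fps_const (of_int (- x)) * U) (map2 (+) xs (map ((*) (- x)) ys))"
    using "2.prems" by (intro truncates_map2_plus truncates_scale) (auto simp: truncates_Cons)
  from truncates_Cons_mult_X[OF "2.IH"[OF this "2.prems"(2)], of x]
  have "truncates (?x + fps_X * ((?F1 + fps_const (of_int (- x)) * U) * ?I)) (pdiv (x # xs) ys)"
    by simp
  also have "?x + fps_X * ((?F1 + fps_const (of_int (- x)) * U) * ?I) = F * ?I"
  proof -
    have m: "fps_const (of_int (- x)) = - ?x" by (simp add: fps_eq_iff)
    have "?x + fps_X * ((?F1 - ?x * U) * ?I) = ?x * ((1 + fps_X * U) * ?I) + fps_X * ((?F1 - ?x * U) * ?I)"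
      by (simp only: inv mult_1_right)
    also have "\<dots> = (?x + fps_X * ?F1) * ?I" by (simp add: algebra_simps)
    finally have e: "?x + fps_X * ((?F1 - ?x * U) * ?I) = (?x + fps_X * ?F1) * ?I" .
    have "?F1 + - ?x * U = ?F1 - ?x * U" by (simp only: mult_minus_left add_uminus_conv_diff)
    then show ?thesis unfolding m using e F by metis
  qed
  finally show ?case .
qed simp

lemma truncates_unit: "truncates 1 (1 # replicate k 0)"
  by (auto simp: truncates_def nth_Cons' )

section \<open>The recursion computes the ratio series\<close>

context spin_program
begin

definition serA :: "complex fps" where "serA = fps_const (of_int cA) * fps_X"
definition serG :: "complex fps" where "serG = fps_const (of_int cG) * fps_X"

lemma serA_0 [simp]: "fps_nth serA 0 = 0" and serG_0 [simp]: "fps_nth serG 0 = 0"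
  by (simp_all add: serA_def serG_def)

lemma Zsum_nth_0: "finite W \<Longrightarrow> fps_nth (Zsum serA serG W E P) 0 \<noteq> 0"
  using Zsum_hom[of "\<lambda>F. fps_nth F 0" serA serG W E P] Zsum_0_nonzero[of W E P, where 'a = complex]
  by simp

text \<open>The series of \<open>Z[\<sigma>(v) = 1] / Z[\<sigma>(v) = 0]\<close>, where \<open>W\<close> is the set of the vertices other than \<open>v\<close>.\<close>

definition ratio_series :: "nat set \<Rightarrow> nat \<Rightarrow> (nat \<times> nat) list \<Rightarrow> (nat \<times> bool) list \<Rightarrow> complex fps" where
  "ratio_series W v E P =
     (\<Sum>T\<in>Pow W. wt serA serG E P (insert v T)) * inverse (Zsum serA serG W E P)"

lemma truncates_step:
  assumes "truncates R r" "truncates F acc"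
  shows "truncates (F * serA * (1 + serG * R) * inverse (1 + serA * R)) (step r acc)"
proof -
  have "truncates (fps_const (of_int cA) * (fps_const (of_int 0) + fps_X * F)) (map ((*) cA) (shift 0 acc))"
    by (intro truncates_scale truncates_shift assms)
  moreover have "truncates (fps_const (of_int 1) + fps_X * (fps_const (of_int cG) * R)) (1 # map ((*) cG) r)"
    by (intro truncates_scale truncates_Cons_mult_X assms)
  ultimately have "truncates (fps_const (of_int cA) * (fps_const (of_int 0) + fps_X * F)
       * (fps_const (of_int 1) + fps_X * (fps_const (of_int cG) * R))
       * inverse (1 + fps_X * (fps_const (of_int cA) * R))) (step r acc)"
    unfolding step_def by (rule truncates_pdiv[OF truncates_pmul truncates_scale[OF assms(1)]])
  then show ?thesis by (simp add: serA_def serG_def ac_simps)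
qed

lemma truncates_pinprod: "truncates F acc \<Longrightarrow> truncates (F * pin_factor serA serG v P) (pinprod v P acc)"
proof (induction v P acc arbitrary: F rule: pinprod.induct)
  case (2 v u f P acc)
  show ?case
  proof (cases "u = v")
    case True
    let ?k = "if f then cG else cA"
    have "truncates (fps_const (of_int ?k) * (fps_const (of_int 0) + fps_X * F)) (map ((*) ?k) (shift 0 acc))"
      by (intro truncates_scale truncates_shift "2.prems")
    also have "fps_const (of_int ?k) * (fps_const (of_int 0) + fps_X * F) = F * (if f then serG else serA)"
      by (simp add: serA_def serG_def)
    finally have "truncates (F * (if f then serG else serA)) (if u = v then map ((*) ?k) (shift 0 acc) else acc)"
      using True by simp
    from "2.IH"[OF this] True show ?thesis by (simp add: pin_factor_def ac_simps)
  next
    case False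
    then show ?thesis using 2 by (simp add: pin_factor_def)
  qed
qed (simp add: pin_factor_def)

text \<open>The invariant of \<open>loop\<close> contains what is still missing: the sum with all
  remaining copies at spin 1 over the sum with all of them at spin 0. It holds for arbitrary pins,
  as invertibility of a series only asks for a nonzero constant term.\<close>

lemma truncates_ratio:
  "finite W \<Longrightarrow> v \<notin> W \<Longrightarrow> set E \<subseteq> insert v W \<times> insert v W \<Longrightarrow> \<forall>(x, y) \<in> set E. x \<noteq> y \<Longrightarrow>
   truncates (ratio_series W v E P) (ratio k v E P)"
  and truncates_loop:
  "finite W \<Longrightarrow> set E \<subseteq> W \<times> W \<Longrightarrow> set us \<subseteq> W \<Longrightarrow> \<forall>(x, y) \<in> set E. x \<noteq> y \<Longrightarrow> truncates F acc \<Longrightarrow>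
   truncates (F * serA ^ length us * Zsum serA serG W E (pins1 us P) * inverse (Zsum serA serG W E (pins us P)))
     (loop k E P us acc)"
proof (induction k v E P and k E P us acc arbitrary: W and W F rule: ratio_loop.induct)
  case (2 k v E P)
  have "truncates (1 * pin_factor serA serG v P) (pinprod v P (1 # replicate k 0))"
    by (intro truncates_pinprod truncates_unit)
  moreover have "set (rest v E) \<subseteq> W \<times> W" "set (nbrs v E) \<subseteq> W"
    using "2.prems"(3,4) by (auto simp: set_rest set_nbrs)
  moreover have "\<forall>(x, y) \<in> set (rest v E). x \<noteq> y" using "2.prems"(4) by (auto simp: set_rest)
  ultimately have "truncates (1 * pin_factor serA serG v P * serA ^ length (nbrs v E)
      * Zsum serA serG W (rest v E) (pins1 (nbrs v E) P)
      * inverse (Zsum serA serG W (rest v E) (pins (nbrs v E) P))) (ratio (Suc k) v E P)"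
    using "2.IH" "2.prems"(1) by auto
  moreover have "Zsum serA serG W (rest v E) (pins (nbrs v E) P) = Zsum serA serG W E P"
    unfolding Zsum_def using "2.prems"(2) by (intro sum.cong refl wt_remove[symmetric]) auto
  moreover have "(\<Sum>T\<in>Pow W. wt serA serG E P (insert v T))
     = pin_factor serA serG v P * serA ^ length (nbrs v E) * Zsum serA serG W (rest v E) (pins1 (nbrs v E) P)"
    unfolding Zsum_def sum_distrib_left using "2.prems"(2,4) by (intro sum.cong refl wt_insert) auto
  ultimately show ?case by (simp add: ratio_series_def)
next
  case (3 k E P acc)
  have "Zsum serA serG W E P * inverse (Zsum serA serG W E P) = 1"
    by (rule inverse_mult_eq_1') (rule Zsum_nth_0[OF "3.prems"(1)])
  then show ?case using "3.prems" by (simp add: pins1_def mult.assoc)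
next
  case (4 k E P u us acc)
  define W0 where "W0 = W - {u}"
  have W: "W = insert u W0" "u \<notin> W0" "finite W0" using "4.prems" by (auto simp: W0_def)
  let ?Q = "pins us P"
  define Y0 where "Y0 = Zsum serA serG W0 E ?Q"
  define Y1 where "Y1 = (\<Sum>T\<in>Pow W0. wt serA serG E ?Q (insert u T))"
  define R where "R = ratio_series W0 u E ?Q"
  have R: "R = Y1 * inverse Y0" by (simp add: R_def ratio_series_def Y0_def Y1_def)
  have Y0: "fps_nth Y0 0 \<noteq> 0" unfolding Y0_def by (rule Zsum_nth_0[OF W(3)])
  have Z: "Zsum serA serG W E ((u, f) # ?Q) = Y0 + (if f then serG else serA) * Y1" for f
  proof -
    have "wt serA serG E ((u, f) # ?Q) T = wt serA serG E ?Q T" if "T \<in> Pow W0" for T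
      using that W(2) by (auto simp: wt_simps)
    moreover have "wt serA serG E ((u, f) # ?Q) (insert u T) = (if f then serG else serA) * wt serA serG E ?Q (insert u T)" for T
      by (simp add: wt_simps)
    ultimately show ?thesis
      unfolding Zsum_def Y0_def Y1_def W(1) sum_Pow_insert[OF W(3,2)] sum_distrib_left by simp
  qed
  have R1: "truncates R (ratio k u E ?Q)"
    unfolding R_def using "4.prems" W by (intro "4.IH"(1)) auto
  let ?F = "F * serA * (1 + serG * R) * inverse (1 + serA * R)"
  have "truncates ?F (step (ratio k u E ?Q) acc)"
    by (rule truncates_step[OF R1 "4.prems"(5)])
  then have "truncates (?F * serA ^ length us * Zsum serA serG W E (pins1 us ((u, True) # P))
      * inverse (Zsum serA serG W E (pins us ((u, True) # P)))) (loop k E P (u # us) acc)"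
    using "4.IH"(2) "4.prems" by auto
  moreover have "Zsum serA serG W E (pins1 us ((u, True) # P)) = Zsum serA serG W E (pins1 (u # us) P)"
    by (simp add: Zsum_def wt_pins1_Cons)
  moreover have "Zsum serA serG W E (pins us ((u, True) # P)) = Y0 + serG * Y1"
    using Z[of True] by (simp add: Zsum_def wt_pins_True)
  moreover have "Zsum serA serG W E (pins (u # us) P) = Y0 + serA * Y1"
    using Z[of False] by simp
  \<comment> \<open>The sums with the copy next to \<open>u\<close> at spin 0 and at spin 1 are Y0
    (1 + A R) and Y0 (1 + G R); this cancellation is one link of the telescoping product.\<close>
  moreover have c: "(1 + serG * R) * inverse (1 + serA * R) * inverse (Y0 + serG * Y1) = inverse (Y0 + serA * Y1)"
  proof -
    have i: "Y0 * inverse Y0 = 1" by (rule inverse_mult_eq_1'[OF Y0])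
    have e: "Y0 + H * Y1 = Y0 * (1 + H * R)" for H
    proof -
      have "Y0 * (1 + H * R) = Y0 + H * Y1 * (Y0 * inverse Y0)" by (simp add: R algebra_simps)
      then show ?thesis by (simp add: i)
    qed
    have j: "(1 + serG * R) * inverse (1 + serG * R) = 1" by (rule inverse_mult_eq_1') simp
    have "(1 + serG * R) * inverse (1 + serA * R) * inverse (Y0 + serG * Y1)
        = ((1 + serG * R) * inverse (1 + serG * R)) * (inverse Y0 * inverse (1 + serA * R))"
      unfolding e fps_inverse_mult by (simp add: ac_simps)
    then show ?thesis unfolding j by (simp add: e fps_inverse_mult)
  qed
  moreover have "?F * serA ^ length us * H * inverse (Y0 + serG * Y1)
      = F * serA ^ length (u # us) * H * inverse (Y0 + serA * Y1)" for H
    unfolding c[symmetric] by (simp add: ac_simps)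
  ultimately show ?case by simp
qed auto

end

section \<open>Absence of zeros\<close>

lemma cmod_less_of_nonzero:
  assumes "\<And>a. cmod a \<le> 1 \<Longrightarrow> p + q * a \<noteq> 0"
  shows "cmod q < cmod p"
proof (rule ccontr)
  assume "\<not> cmod q < cmod p"
  then have le: "cmod p \<le> cmod q" by simp
  have "p \<noteq> 0" using assms[of 0] by simp
  then have q: "q \<noteq> 0" using le by auto
  have "cmod (- p / q) \<le> 1" using le q by (simp add: norm_divide)
  from assms[OF this] q show False by simp
qed

lemma parallelogram: "(cmod (x + y))\<^sup>2 + (cmod (x - y))\<^sup>2 = 2 * (cmod x)\<^sup>2 + 2 * (cmod y)\<^sup>2"
  unfolding cmod_power2 by (simp add: power2_eq_square algebra_simps)

text \<open>As a polynomial in a, the expression gives |B + D b| < |A + C b|. Taking b = 1 and b =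
  -1, the parallelogram law yields |B|^2 + |D|^2 < |A|^2 + |C|^2. Adding the same inequality with B
  and C exchanged cancels both of them.\<close>

lemma asano_bound:
  assumes "\<And>a b. cmod a \<le> 1 \<Longrightarrow> cmod b \<le> 1 \<Longrightarrow> A + B * a + C * b + D * a * b \<noteq> 0"
  shows "cmod D < cmod A"
proof -
  have half: "2 * (cmod B)\<^sup>2 + 2 * (cmod D)\<^sup>2 < 2 * (cmod A)\<^sup>2 + 2 * (cmod C)\<^sup>2"
    if nz: "\<And>a b. cmod a \<le> 1 \<Longrightarrow> cmod b \<le> 1 \<Longrightarrow> A + B * a + C * b + D * a * b \<noteq> 0" for B C
  proof -
    have *: "cmod (B + D * b) < cmod (A + C * b)" if "cmod b \<le> 1" for b
    proof (rule cmod_less_of_nonzero)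
      fix a :: complex assume "cmod a \<le> 1"
      from nz[OF this that] show "A + C * b + (B + D * b) * a \<noteq> 0" by (simp add: algebra_simps)
    qed
    have "(cmod (B + D))\<^sup>2 < (cmod (A + C))\<^sup>2" using *[of 1] by (intro power_strict_mono) auto
    moreover have "(cmod (B - D))\<^sup>2 < (cmod (A - C))\<^sup>2" using *[of "- 1"] by (intro power_strict_mono) auto
    ultimately show ?thesis using parallelogram[of B D] parallelogram[of A C] by linarith
  qed
  have "A + C * a + B * b + D * a * b \<noteq> 0" if "cmod a \<le> 1" "cmod b \<le> 1" for a b
    using assms[OF that(2,1)] by (simp add: algebra_simps)
  then have "2 * (cmod C)\<^sup>2 + 2 * (cmod D)\<^sup>2 < 2 * (cmod A)\<^sup>2 + 2 * (cmod B)\<^sup>2" by (rule half)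
  moreover have "2 * (cmod B)\<^sup>2 + 2 * (cmod D)\<^sup>2 < 2 * (cmod A)\<^sup>2 + 2 * (cmod C)\<^sup>2" using assms by (rule half)
  ultimately have "(cmod D)\<^sup>2 < (cmod A)\<^sup>2" by argo
  then show ?thesis by (rule power_less_imp_less_base) simp
qed

text \<open>An edge is attached by two contractions, one per endpoint. At the first, the dominations
  |B + D a| < |A + C a| and |q + s b| < |p + q b| multiply, which leaves a polynomial in a and b
  without zeros; \<open>asano_bound\<close> performs the second.\<close>

lemma asano_edge:
  assumes "\<And>a b. cmod a \<le> 1 \<Longrightarrow> cmod b \<le> 1 \<Longrightarrow> A + B * a + C * b + D * a * b \<noteq> 0"
    and "\<And>a b. cmod a \<le> 1 \<Longrightarrow> cmod b \<le> 1 \<Longrightarrow> p + q * a + q * b + s * a * b \<noteq> 0"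
  shows "p * A + q * B + q * C + s * D \<noteq> 0"
proof -
  have 1: "cmod (B + D * b) < cmod (A + C * b)" if "cmod b \<le> 1" for b
  proof (rule cmod_less_of_nonzero)
    fix a :: complex assume "cmod a \<le> 1"
    from assms(1)[OF this that] show "A + C * b + (B + D * b) * a \<noteq> 0" by (simp add: algebra_simps)
  qed
  have 2: "cmod (q + s * b) < cmod (p + q * b)" if "cmod b \<le> 1" for b
  proof (rule cmod_less_of_nonzero)
    fix a :: complex assume "cmod a \<le> 1"
    from assms(2)[OF this that] show "p + q * b + (q + s * b) * a \<noteq> 0" by (simp add: algebra_simps)
  qed
  have "cmod (C * q + D * s) < cmod (A * p + B * q)"
  proof (rule asano_bound)
    fix a b :: complex assume ab: "cmod a \<le> 1" "cmod b \<le> 1"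
    have "cmod ((B + D * a) * (q + s * b)) < cmod ((A + C * a) * (p + q * b))"
      unfolding norm_mult using 1[OF ab(1)] 2[OF ab(2)] by (intro mult_strict_mono') auto
    then have "(A + C * a) * (p + q * b) + (B + D * a) * (q + s * b) \<noteq> 0"
      by (metis add_eq_0_iff norm_minus_cancel order_less_irrefl)
    then show "A * p + B * q + (C * p + D * q) * a + (A * q + B * s) * b + (C * q + D * s) * a * b \<noteq> 0"
      by (simp add: algebra_simps)
  qed
  then have "A * p + B * q + (C * q + D * s) \<noteq> 0"
    by (metis add_eq_0_iff norm_minus_cancel order_less_irrefl)
  then show ?thesis by (simp add: algebra_simps)
qed

section \<open>Absence of zeros for vertex fields\<close>

fun spin_wt :: "complex \<Rightarrow> complex \<Rightarrow> nat set \<Rightarrow> nat \<times> nat \<Rightarrow> complex" where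
  "spin_wt \<beta> \<gamma> T (u, v) = (if u \<in> T then (if v \<in> T then \<gamma> else 1) else if v \<in> T then 1 else \<beta>)"

fun deg :: "(nat \<times> nat) list \<Rightarrow> nat \<Rightarrow> nat" where
  "deg [] w = 0"
| "deg ((u, v) # E) w = of_bool (u = w) + of_bool (v = w) + deg E w"

definition field_sum ::
  "complex \<Rightarrow> complex \<Rightarrow> (nat \<times> nat) list \<Rightarrow> (nat \<Rightarrow> complex) \<Rightarrow> nat set \<Rightarrow> complex" where
  "field_sum \<beta> \<gamma> E z W = (\<Sum>T\<in>Pow W. prod_list (map (spin_wt \<beta> \<gamma> T) E) * prod z T)"

lemma sum_Pow_prod: "finite W \<Longrightarrow> (\<Sum>T\<in>Pow W. prod z T) = (\<Prod>v\<in>W. 1 + (z v :: complex))"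
proof (induction W rule: finite_induct)
  case (insert v W)
  have "prod z (insert v T) = z v * prod z T" if "T \<in> Pow W" for T
    using that insert.hyps by (subst prod.insert) (auto intro: finite_subset)
  then have "(\<Sum>T\<in>Pow W. prod z (insert v T)) = z v * (\<Sum>T\<in>Pow W. prod z T)"
    by (simp add: sum_distrib_left)
  then show ?case
    using insert by (simp add: sum_Pow_insert algebra_simps)
qed simp

lemma field_sum_split:
  assumes "finite W" "u \<notin> W"
  shows "(\<Sum>T\<in>Pow (insert u W). f T * prod z T)
     = (\<Sum>T\<in>Pow W. f T * prod z T) + (\<Sum>T\<in>Pow W. f (insert u T) * prod z T) * (z u :: complex)"
proof -
  have "f (insert u T) * prod z (insert u T) = f (insert u T) * prod z T * z u" if "T \<in> Pow W" for T
    using that assms by (subst prod.insert) (auto intro: finite_subset)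
  then have "(\<Sum>T\<in>Pow W. f (insert u T) * prod z (insert u T)) = (\<Sum>T\<in>Pow W. f (insert u T) * prod z T * z u)"
    by (rule sum.cong[OF refl])
  then show ?thesis
    unfolding sum_Pow_insert[OF assms] by (simp only: sum_distrib_right)
qed

lemma sum_prod_cong:
  assumes "\<And>w. w \<in> W \<Longrightarrow> z w = z' w"
  shows "(\<Sum>T\<in>Pow W. f T * prod z T) = (\<Sum>T\<in>Pow W. f T * (prod z' T :: complex))"
proof (rule sum.cong)
  fix T assume "T \<in> Pow W"
  then have "prod z T = prod z' T" using assms by (intro prod.cong) auto
  then show "f T * prod z T = f T * prod z' T" by simp
qed simp

text \<open>Induction on the edges. Without edges the sum is the product of the 1 +
  \<open>z v\<close> with |\<open>z v\<close>| < 1; every half-edge then enlarges the admissible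
  radius at its vertex by the factor \<rho>.\<close>

theorem field_sum_nonzero:
  assumes "finite W" "\<rho> \<ge> 1"
    and edge: "\<And>a b. cmod a \<le> \<rho> \<Longrightarrow> cmod b \<le> \<rho> \<Longrightarrow> \<beta> + a + b + \<gamma> * a * b \<noteq> 0"
    and "set E \<subseteq> W \<times> W" "\<And>w. w \<in> W \<Longrightarrow> cmod (z w) < \<rho> ^ deg E w"
  shows "field_sum \<beta> \<gamma> E z W \<noteq> 0"
  using assms(4,5)
proof (induction E arbitrary: z)
  case Nil
  have "1 + z v \<noteq> 0" if "v \<in> W" for v
    using Nil.prems(2)[OF that] by (metis add_eq_0_iff norm_minus_cancel norm_one deg.simps(1) power_0 order_less_irrefl)
  then show ?case
    using assms(1) by (simp add: field_sum_def sum_Pow_prod)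
next
  case (Cons e E)
  obtain u v where e: "e = (u, v)" by (cases e)
  have uv: "u \<in> W" "v \<in> W" and E: "set E \<subseteq> W \<times> W" using Cons.prems(1) by (auto simp: e)
  define f where "f T = prod_list (map (spin_wt \<beta> \<gamma> T) E)" for T
  have \<rho>0: "\<rho> > 0" using assms(2) by simp
  let ?r = "complex_of_real \<rho>"
  have edge': "\<beta> + ?r * a + ?r * b + \<gamma> * ?r\<^sup>2 * a * b \<noteq> 0" if "cmod a \<le> 1" "cmod b \<le> 1" for a b
  proof -
    have "cmod (?r * a) \<le> \<rho>" "cmod (?r * b) \<le> \<rho>"
      using that \<rho>0 by (auto simp: norm_mult mult_left_le)
    from edge[OF this] show ?thesis by (simp add: algebra_simps power2_eq_square)
  qed
  have IH: "(\<Sum>T\<in>Pow W. f T * prod z' T) \<noteq> 0" if "\<And>w. w \<in> W \<Longrightarrow> cmod (z' w) < \<rho> ^ deg E w" for z'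
    using Cons.IH[OF E that] by (simp add: field_sum_def f_def)
  have dz: "cmod (z w) < \<rho> ^ deg E w" if "w \<in> W" "w \<noteq> u" "w \<noteq> v" for w
    using Cons.prems(2)[OF that(1)] that by (simp add: e)
  show ?case
  proof (cases "u = v")
    case True
    define W0 where "W0 = W - {u}"
    have W: "W = insert u W0" "u \<notin> W0" "finite W0" using assms(1) uv by (auto simp: W0_def)
    define P0 where "P0 = (\<Sum>T\<in>Pow W0. f T * prod z T)"
    define P1 where "P1 = (\<Sum>T\<in>Pow W0. f (insert u T) * prod z T)"
    define s where "s = z u / ?r\<^sup>2"
    have zu: "z u = s * ?r\<^sup>2" using \<rho>0 by (simp add: s_def)
    have "cmod (z u) < \<rho> ^ deg E u * \<rho>\<^sup>2"
      using Cons.prems(2)[OF uv(1)] True by (simp add: e power2_eq_square ac_simps)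
    then have s: "cmod s < \<rho> ^ deg E u"
      using \<rho>0 by (simp add: s_def norm_divide norm_power divide_less_eq)
    have "cmod (P1 * s) < cmod P0"
    proof (rule cmod_less_of_nonzero)
      fix a :: complex assume a: "cmod a \<le> 1"
      let ?z = "z(u := s * a)"
      have "cmod (s * a) \<le> cmod s" using a by (simp add: norm_mult mult_left_le)
      then have "(\<Sum>T\<in>Pow W. f T * prod ?z T) \<noteq> 0"
        using s dz True by (intro IH) (auto intro: order_le_less_trans)
      moreover have "(\<Sum>T\<in>Pow W. f T * prod ?z T) = P0 + P1 * ?z u"
      proof -
        have "(\<Sum>T\<in>Pow W0. h T * prod ?z T) = (\<Sum>T\<in>Pow W0. h T * prod z T)" for h
          using W(2) by (intro sum_prod_cong) auto
        then show ?thesis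
          unfolding W(1) field_sum_split[OF W(3,2)] P0_def P1_def by simp
      qed
      ultimately show "P0 + P1 * s * a \<noteq> 0" by (simp add: mult.assoc)
    qed
    \<comment> \<open>For a loop, the two ends of the edge polynomial are first contracted with each
      other.\<close>
    moreover have "cmod (\<gamma> * ?r\<^sup>2) < cmod \<beta>"
      by (rule asano_bound[of \<beta> ?r ?r "\<gamma> * ?r\<^sup>2"]) (rule edge')
    ultimately have "cmod ((\<gamma> * ?r\<^sup>2) * (P1 * s)) < cmod (\<beta> * P0)"
      unfolding norm_mult[of _ "P1 * s"] norm_mult[of _ P0] by (intro mult_strict_mono') auto
    then have "\<beta> * P0 + (\<gamma> * ?r\<^sup>2) * (P1 * s) \<noteq> 0"
      by (metis add_eq_0_iff norm_minus_cancel order_less_irrefl)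
    moreover have "field_sum \<beta> \<gamma> (e # E) z W = \<beta> * P0 + \<gamma> * P1 * z u"
    proof -
      have "field_sum \<beta> \<gamma> (e # E) z W = (\<Sum>T\<in>Pow W. (if u \<in> T then \<gamma> else \<beta>) * f T * prod z T)"
        unfolding field_sum_def by (rule sum.cong) (auto simp: e True f_def)
      also have "\<dots> = \<beta> * P0 + \<gamma> * P1 * z u"
      proof -
        have "(\<Sum>T\<in>Pow W0. (if u \<in> T then \<gamma> else \<beta>) * f T * prod z T) = \<beta> * P0"
          unfolding P0_def sum_distrib_left using W(2) by (intro sum.cong) auto
        moreover have "(\<Sum>T\<in>Pow W0. (if u \<in> insert u T then \<gamma> else \<beta>) * f (insert u T) * prod z T) = \<gamma> * P1"
          unfolding P1_def sum_distrib_left by (intro sum.cong) auto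
        ultimately show ?thesis unfolding W(1) field_sum_split[OF W(3,2)] by simp
      qed
      finally show ?thesis .
    qed
    ultimately show ?thesis by (simp add: zu ac_simps)
  next
    case False
    define W0 where "W0 = W - {u, v}"
    have W: "W = insert u (insert v W0)" "u \<notin> insert v W0" "v \<notin> W0" "finite W0" "finite (insert v W0)"
      using assms(1) uv False by (auto simp: W0_def)
    define Z where "Z A = (\<Sum>T\<in>Pow W0. f (A \<union> T) * prod z T)" for A
    define s where "s = z u / ?r"
    define t where "t = z v / ?r"
    have zs: "z u = ?r * s" "z v = ?r * t" using \<rho>0 by (simp_all add: s_def t_def)
    have "cmod (z u) < \<rho> ^ deg E u * \<rho>" "cmod (z v) < \<rho> ^ deg E v * \<rho>"
      using Cons.prems(2)[OF uv(1)] Cons.prems(2)[OF uv(2)] False by (simp_all add: e ac_simps)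
    then have st: "cmod s < \<rho> ^ deg E u" "cmod t < \<rho> ^ deg E v"
      using \<rho>0 by (simp_all add: s_def t_def norm_divide divide_less_eq)
    have split: "(\<Sum>T\<in>Pow W. h T * prod z' T)
       = (\<Sum>T\<in>Pow W0. h T * prod z' T) + (\<Sum>T\<in>Pow W0. h (insert v T) * prod z' T) * z' v
         + (\<Sum>T\<in>Pow W0. h (insert u T) * prod z' T) * z' u
         + (\<Sum>T\<in>Pow W0. h (insert u (insert v T)) * prod z' T) * z' u * z' v" for h and z' :: "nat \<Rightarrow> complex"
      unfolding W(1) field_sum_split[OF W(5,2)] field_sum_split[OF W(4,3)]
      by (simp add: algebra_simps)
    have "\<beta> * Z {} + ?r * (Z {u} * s) + ?r * (Z {v} * t) + (\<gamma> * ?r\<^sup>2) * (Z {u, v} * s * t) \<noteq> 0"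
    proof (rule asano_edge[OF _ edge'])
      fix a b :: complex assume ab: "cmod a \<le> 1" "cmod b \<le> 1"
      let ?z = "z(u := s * a, v := t * b)"
      have "cmod (s * a) \<le> cmod s" "cmod (t * b) \<le> cmod t" using ab by (simp_all add: norm_mult mult_left_le)
      then have "(\<Sum>T\<in>Pow W. f T * prod ?z T) \<noteq> 0"
        using st dz by (intro IH) (auto intro: order_le_less_trans)
      moreover have "(\<Sum>T\<in>Pow W0. h T * prod ?z T) = (\<Sum>T\<in>Pow W0. h T * prod z T)" for h
        using W(2,3) by (intro sum_prod_cong) auto
      ultimately show "Z {} + Z {u} * s * a + Z {v} * t * b + Z {u, v} * s * t * a * b \<noteq> 0"
        unfolding split Z_def using False by (simp add: algebra_simps)
    qed
    moreover have "field_sum \<beta> \<gamma> (e # E) z W = \<beta> * Z {} + Z {u} * z u + Z {v} * z v + \<gamma> * Z {u, v} * z u * z v"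
    proof -
      have "field_sum \<beta> \<gamma> (e # E) z W = (\<Sum>T\<in>Pow W. (spin_wt \<beta> \<gamma> T (u, v) * f T) * prod z T)"
        unfolding field_sum_def by (simp add: e f_def)
      also have "\<dots> = \<beta> * Z {} + Z {u} * z u + Z {v} * z v + \<gamma> * Z {u, v} * z u * z v"
      proof -
        have "(\<Sum>T\<in>Pow W0. (spin_wt \<beta> \<gamma> T (u, v) * f T) * prod z T) = \<beta> * Z {}"
          unfolding Z_def sum_distrib_left using W(2,3) by (intro sum.cong) auto
        moreover have "(\<Sum>T\<in>Pow W0. (spin_wt \<beta> \<gamma> (insert v T) (u, v) * f (insert v T)) * prod z T) = Z {v}"
          unfolding Z_def using W(2,3) by (intro sum.cong) auto
        moreover have "(\<Sum>T\<in>Pow W0. (spin_wt \<beta> \<gamma> (insert u T) (u, v) * f (insert u T)) * prod z T) = Z {u}"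
          unfolding Z_def using W(2,3) by (intro sum.cong) auto
        moreover have "(\<Sum>T\<in>Pow W0. (spin_wt \<beta> \<gamma> (insert u (insert v T)) (u, v) * f (insert u (insert v T))) * prod z T)
            = \<gamma> * Z {u, v}"
          unfolding Z_def sum_distrib_left by (intro sum.cong) auto
        ultimately show ?thesis unfolding split by simp
      qed
      finally show ?thesis .
    qed
    ultimately show ?thesis by (simp add: zs algebra_simps power2_eq_square)
  qed
qed

section \<open>The edge polynomial\<close>

lemma affine_pos:
  fixes p q x m :: real
  assumes "p + q * m > 0" "p - q * m > 0" "\<bar>x\<bar> \<le> m"
  shows "p + q * x > 0"
proof -
  have "\<bar>q * x\<bar> \<le> \<bar>q * m\<bar>" using assms(3) unfolding abs_mult by (intro mult_left_mono) auto
  then show ?thesis using assms(1,2) by linarith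
qed

text \<open>
  For fixed \<open>\<bar>a\<bar>\<close> the difference \<open>\<bar>\<beta> + a\<bar>\<^sup>2 - \<rho>\<^sup>2 \<bar>1 + \<gamma> a\<bar>\<^sup>2\<close> is affine in \<open>Re a\<close>, so it is enough to treat
  real \<open>a\<close>, where it splits into two affine factors.
\<close>

lemma edge_polynomial_nonzero_pos:
  fixes \<beta> \<gamma> \<rho> :: real
  assumes "\<rho> > 0" "\<beta> - \<gamma> * \<rho>\<^sup>2 > 0" "\<beta> + \<gamma> * \<rho>\<^sup>2 - 2 * \<rho> > 0" "cmod a \<le> \<rho>" "cmod b \<le> \<rho>"
  shows "complex_of_real \<beta> + a + b + complex_of_real \<gamma> * a * b \<noteq> 0"
proof
  assume 0: "complex_of_real \<beta> + a + b + complex_of_real \<gamma> * a * b = 0"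
  have "(\<beta> + t)\<^sup>2 > \<rho>\<^sup>2 * (1 + \<gamma> * t)\<^sup>2" if t: "\<bar>t\<bar> \<le> \<rho>" for t
  proof -
    \<comment> \<open>At t = \<rho> and t = -\<rho> this affine function takes exactly the values
      assumed to be positive.\<close>
    have "(\<beta> - \<rho>) + (1 - \<rho> * \<gamma>) * t > 0"
      using assms(1-3) by (intro affine_pos[OF _ _ t]) (auto simp: algebra_simps power2_eq_square)
    moreover have "(\<beta> + \<rho>) + (1 + \<rho> * \<gamma>) * t > 0"
      using assms(1-3) by (intro affine_pos[OF _ _ t]) (auto simp: algebra_simps power2_eq_square)
    ultimately have "((\<beta> - \<rho>) + (1 - \<rho> * \<gamma>) * t) * ((\<beta> + \<rho>) + (1 + \<rho> * \<gamma>) * t) > 0" by simp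
    also have "((\<beta> - \<rho>) + (1 - \<rho> * \<gamma>) * t) * ((\<beta> + \<rho>) + (1 + \<rho> * \<gamma>) * t) = (\<beta> + t)\<^sup>2 - \<rho>\<^sup>2 * (1 + \<gamma> * t)\<^sup>2"
      by (simp add: power2_eq_square algebra_simps)
    finally show ?thesis by simp
  qed
  from this[of "cmod a"] this[of "- cmod a"]
  have pm: "(\<beta> + cmod a)\<^sup>2 > \<rho>\<^sup>2 * (1 + \<gamma> * cmod a)\<^sup>2" "(\<beta> - cmod a)\<^sup>2 > \<rho>\<^sup>2 * (1 - \<gamma> * cmod a)\<^sup>2"
    using assms(4) by auto
  define m where "m = cmod a"
  have re: "\<bar>Re a\<bar> \<le> m" unfolding m_def by (rule abs_Re_le_cmod)
  have sq: "(cmod (complex_of_real p + complex_of_real q * a))\<^sup>2 = p\<^sup>2 + q\<^sup>2 * m\<^sup>2 + 2 * p * q * Re a" for p q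
    unfolding m_def cmod_power2 by (simp add: power2_eq_square algebra_simps)
  have "(cmod (complex_of_real \<beta> + a))\<^sup>2 > \<rho>\<^sup>2 * (cmod (1 + complex_of_real \<gamma> * a))\<^sup>2"
  proof -
    let ?l = "\<beta>\<^sup>2 + m\<^sup>2 - \<rho>\<^sup>2 * (1 + \<gamma>\<^sup>2 * m\<^sup>2)" and ?k = "2 * \<beta> - \<rho>\<^sup>2 * (2 * \<gamma>)"
    have "?l + ?k * m > 0" "?l - ?k * m > 0"
      using pm unfolding m_def[symmetric] by (simp_all add: power2_eq_square algebra_simps)
    then have "?l + ?k * Re a > 0" using re by (rule affine_pos)
    moreover have "(cmod (complex_of_real \<beta> + a))\<^sup>2 = \<beta>\<^sup>2 + m\<^sup>2 + 2 * \<beta> * Re a"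
      using sq[of \<beta> 1] by simp
    moreover have "(cmod (1 + complex_of_real \<gamma> * a))\<^sup>2 = 1 + \<gamma>\<^sup>2 * m\<^sup>2 + 2 * \<gamma> * Re a"
      using sq[of 1 \<gamma>] by simp
    ultimately show ?thesis by (simp add: algebra_simps)
  qed
  moreover have "complex_of_real \<beta> + a = - (b * (1 + complex_of_real \<gamma> * a))"
    using 0 by (simp add: algebra_simps eq_neg_iff_add_eq_0)
  then have "(cmod (complex_of_real \<beta> + a))\<^sup>2 = (cmod b)\<^sup>2 * (cmod (1 + complex_of_real \<gamma> * a))\<^sup>2"
    by (simp add: norm_mult power_mult_distrib)
  moreover have "(cmod b)\<^sup>2 * (cmod (1 + complex_of_real \<gamma> * a))\<^sup>2 \<le> \<rho>\<^sup>2 * (cmod (1 + complex_of_real \<gamma> * a))\<^sup>2"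
    using assms(5) by (intro mult_right_mono power_mono) auto
  ultimately show False by linarith
qed

text \<open>For positive \<beta> the two inequalities needed become \<beta> > \<gamma> and \<beta> +
  \<gamma> > 2 at \<rho> = 1; being strict, they persist slightly to the right of 1. Negative
  \<beta> is reduced to this by changing the signs of \<beta>, \<gamma>, a and b.\<close>

lemma edge_polynomial_nonzero:
  fixes \<beta> \<gamma> :: real
  assumes "\<bar>\<beta>\<bar> > \<bar>\<gamma>\<bar>" "\<bar>\<beta> + \<gamma>\<bar> > 2"
  obtains \<rho> :: real where "\<rho> > 1"
    "\<And>a b. cmod a \<le> \<rho> \<Longrightarrow> cmod b \<le> \<rho> \<Longrightarrow> complex_of_real \<beta> + a + b + complex_of_real \<gamma> * a * b \<noteq> 0"
proof -
  have pos: "\<exists>\<rho>>1. \<beta> - \<gamma> * \<rho>\<^sup>2 > 0 \<and> \<beta> + \<gamma> * \<rho>\<^sup>2 - 2 * \<rho> > 0" if "\<beta> > \<bar>\<gamma>\<bar>" "\<beta> + \<gamma> > 2" for \<beta> \<gamma> :: real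
  proof -
    have "((\<lambda>\<rho>. \<beta> - \<gamma> * \<rho>\<^sup>2) \<longlongrightarrow> \<beta> - \<gamma> * 1\<^sup>2) (at_right 1)" by (intro tendsto_intros)
    then have "eventually (\<lambda>\<rho>. \<beta> - \<gamma> * \<rho>\<^sup>2 > 0) (at_right 1)"
      by (rule order_tendstoD) (use that in auto)
    moreover have "((\<lambda>\<rho>. \<beta> + \<gamma> * \<rho>\<^sup>2 - 2 * \<rho>) \<longlongrightarrow> \<beta> + \<gamma> * 1\<^sup>2 - 2 * 1) (at_right 1)" by (intro tendsto_intros)
    then have "eventually (\<lambda>\<rho>. \<beta> + \<gamma> * \<rho>\<^sup>2 - 2 * \<rho> > 0) (at_right 1)"
      by (rule order_tendstoD) (use that in auto)
    moreover have "eventually (\<lambda>\<rho>. \<rho> > (1::real)) (at_right 1)" by (rule eventually_at_right_less)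
    ultimately have "eventually (\<lambda>\<rho>. \<rho> > 1 \<and> \<beta> - \<gamma> * \<rho>\<^sup>2 > 0 \<and> \<beta> + \<gamma> * \<rho>\<^sup>2 - 2 * \<rho> > 0) (at_right (1::real))"
      by eventually_elim auto
    from eventually_happens[OF this] show ?thesis by auto
  qed
  show thesis
  proof (cases "\<beta> > 0")
    case True
    then have "\<beta> > \<bar>\<gamma>\<bar>" "\<beta> + \<gamma> > 2" using assms by auto
    from pos[OF this] obtain \<rho> where "\<rho> > 1" "\<beta> - \<gamma> * \<rho>\<^sup>2 > 0" "\<beta> + \<gamma> * \<rho>\<^sup>2 - 2 * \<rho> > 0" by auto
    then show ?thesis using edge_polynomial_nonzero_pos[of \<rho> \<beta> \<gamma>] by (intro that[of \<rho>]) auto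
  next
    case False
    then have "- \<beta> > \<bar>- \<gamma>\<bar>" "- \<beta> + - \<gamma> > 2" using assms by auto
    from pos[OF this] obtain \<rho> where \<rho>: "\<rho> > 1" "- \<beta> - - \<gamma> * \<rho>\<^sup>2 > 0" "- \<beta> + - \<gamma> * \<rho>\<^sup>2 - 2 * \<rho> > 0" by auto
    show ?thesis
    proof (rule that[OF \<rho>(1)])
      fix a b :: complex assume "cmod a \<le> \<rho>" "cmod b \<le> \<rho>"
      then have "complex_of_real (- \<beta>) + (- a) + (- b) + complex_of_real (- \<gamma>) * (- a) * (- b) \<noteq> 0"
        using \<rho> by (intro edge_polynomial_nonzero_pos[of \<rho>]) auto
      moreover have "complex_of_real (- \<beta>) + (- a) + (- b) + complex_of_real (- \<gamma>) * (- a) * (- b)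
          = - (complex_of_real \<beta> + a + b + complex_of_real \<gamma> * a * b)"
        by (simp add: algebra_simps)
      ultimately show "complex_of_real \<beta> + a + b + complex_of_real \<gamma> * a * b \<noteq> 0"
        by (simp only: neg_equal_0_iff_equal not_False_eq_True)
    qed
  qed
qed

section \<open>Truncation error\<close>

lemma wt_eq_spin_wt:
  fixes \<beta> \<gamma> x :: complex
  assumes "\<beta> \<noteq> 0" "finite T"
  shows "\<beta> ^ length E * wt (x / \<beta>) (\<gamma> * x) E [] T
     = prod_list (map (spin_wt \<beta> \<gamma> T) E) * (\<Prod>v\<in>T. x ^ deg E v)"
proof (induction E)
  case Nil
  then show ?case by (simp add: wt_simps)
next
  case (Cons e E)
  obtain u v where e: "e = (u, v)" by (cases e)
  have d: "(\<Prod>w\<in>T. x ^ of_bool (u = w)) = x ^ of_bool (u \<in> T)" for u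
  proof -
    have "(\<Prod>w\<in>T. x ^ of_bool (u = w)) = (\<Prod>w\<in>T. if w = u then x else 1)"
      by (intro prod.cong) auto
    then show ?thesis using assms(2) by simp
  qed
  have "(\<Prod>w\<in>T. x ^ deg (e # E) w) = x ^ of_bool (u \<in> T) * x ^ of_bool (v \<in> T) * (\<Prod>w\<in>T. x ^ deg E w)"
    by (simp add: e power_add prod.distrib d)
  moreover have "\<beta> * edge_wt (x / \<beta>) (\<gamma> * x) T e = spin_wt \<beta> \<gamma> T e * x ^ of_bool (u \<in> T) * x ^ of_bool (v \<in> T)"
    using assms(1) by (auto simp: e)
  moreover have "\<beta> ^ length (e # E) * wt (x / \<beta>) (\<gamma> * x) (e # E) [] T
     = (\<beta> * edge_wt (x / \<beta>) (\<gamma> * x) T e) * (\<beta> ^ length E * wt (x / \<beta>) (\<gamma> * x) E [] T)"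
    by (simp add: wt_simps ac_simps)
  ultimately show ?case unfolding Cons.IH by (simp add: ac_simps)
qed

lemma wt_cong:
  assumes "\<And>x y. (x, y) \<in> set E \<Longrightarrow> (x \<in> T \<longleftrightarrow> x \<in> T') \<and> (y \<in> T \<longleftrightarrow> y \<in> T')"
  shows "wt A G E [] T = wt A G E [] T'"
proof -
  have e: "map (edge_wt A G T) E = map (edge_wt A G T') E"
  proof (rule map_cong[OF refl])
    fix e assume e: "e \<in> set E"
    obtain x y where xy: "e = (x, y)" by (cases e)
    show "edge_wt A G T e = edge_wt A G T' e"
      using assms[OF e[unfolded xy]] unfolding xy by simp
  qed
  show ?thesis unfolding wt_def e list.map(1) ..
qed

lemma deg_pos: "(x, y) \<in> set E \<Longrightarrow> deg E x > 0 \<and> deg E y > 0"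
  by (induction E) auto

text \<open>Meant for isolated vertices: their field \<open>x ^ 0\<close> is 1 and so misses the
  strict bound \<open>\<rho> ^ 0\<close> required for absence of zeros. Being free, they only
  contribute powers of 2.\<close>

lemma sum_Pow_restrict:
  fixes f :: "nat set \<Rightarrow> complex"
  assumes "finite I" "finite W" "I \<inter> W = {}" "\<And>T. T \<subseteq> I \<union> W \<Longrightarrow> f T = f (T \<inter> W)"
  shows "(\<Sum>T\<in>Pow (I \<union> W). f T) = 2 ^ card I * (\<Sum>T\<in>Pow W. f T)"
  using assms(1,3,4)
proof (induction I rule: finite_induct)
  case (insert i I)
  have IH: "(\<Sum>T\<in>Pow (I \<union> W). f T) = 2 ^ card I * (\<Sum>T\<in>Pow W. f T)"
    using insert.prems by (intro insert.IH) auto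
  have "f (insert i T) = f T" if "T \<in> Pow (I \<union> W)" for T
  proof -
    have "f (insert i T) = f (insert i T \<inter> W)" using that by (intro insert.prems(2)) auto
    also have "insert i T \<inter> W = T \<inter> W" using insert.prems(1) by auto
    also have "f (T \<inter> W) = f T" using that by (intro insert.prems(2)[symmetric]) auto
    finally show ?thesis .
  qed
  then have "(\<Sum>T\<in>Pow (I \<union> W). f (insert i T)) = (\<Sum>T\<in>Pow (I \<union> W). f T)" by (intro sum.cong) auto
  moreover have "(\<Sum>T\<in>Pow (insert i (I \<union> W)). f T)
      = (\<Sum>T\<in>Pow (I \<union> W). f T) + (\<Sum>T\<in>Pow (I \<union> W). f (insert i T))"
    using insert.hyps insert.prems(1) assms(2) by (intro sum_Pow_insert) auto
  ultimately show ?case using insert.hyps IH by simp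
next
  case empty
  show ?case by simp
qed

text \<open>The extra factor \<open>c\<close> in the field at \<open>v\<close> probes the ratio of
  the two sums: wherever a disc of values \<open>c\<close> is allowed, the ratio is bounded by the
  inverse radius.\<close>

lemma partition_ratio_nonzero:
  fixes \<beta> \<gamma> x c :: complex
  assumes "\<beta> \<noteq> 0" "\<rho> \<ge> 1"
    and edge: "\<And>a b. cmod a \<le> \<rho> \<Longrightarrow> cmod b \<le> \<rho> \<Longrightarrow> \<beta> + a + b + \<gamma> * a * b \<noteq> 0"
    and V: "finite V" "set E \<subseteq> V \<times> V" "W \<subseteq> V" "v \<in> V" "v \<notin> W"
    and x: "cmod x < \<rho>" and c: "cmod c * cmod x ^ deg E v < \<rho> ^ deg E v"
  shows "Zsum (x / \<beta>) (\<gamma> * x) W E [] + c * (\<Sum>T\<in>Pow W. wt (x / \<beta>) (\<gamma> * x) E [] (insert v T)) \<noteq> 0"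
proof -
  define W' where "W' = {w \<in> W. deg E w > 0}"
  define I where "I = {w \<in> W. deg E w = 0}"
  have W: "W = I \<union> W'" "I \<inter> W' = {}" by (auto simp: I_def W'_def)
  have "finite W" by (rule finite_subset[OF V(3,1)])
  then have fin: "finite I" "finite W'" "finite W" by (simp_all add: I_def W'_def)
  have vW': "v \<notin> W'" using V(5) W by auto
  let ?w = "wt (x / \<beta>) (\<gamma> * x) E []"
  \<comment> \<open>Field 0 forces spin 0 outside \<open>W\<close>. The isolated vertices of
    \<open>W\<close> receive it as well, since the factor \<open>2 ^ card I\<close> accounts for
    them.\<close>
  define z where "z w = (if w = v then c * x ^ deg E v else if w \<in> W' then x ^ deg E w else 0)" for w
  have w: "?w (S \<union> T) = ?w (S \<union> (T \<inter> W'))" if "T \<subseteq> I \<union> W'" for S T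
  proof (rule wt_cong)
    fix p q assume "(p, q) \<in> set E"
    then have "p \<notin> I" "q \<notin> I" using deg_pos[of p q E] by (auto simp: I_def)
    then show "(p \<in> S \<union> T \<longleftrightarrow> p \<in> S \<union> (T \<inter> W')) \<and> (q \<in> S \<union> T \<longleftrightarrow> q \<in> S \<union> (T \<inter> W'))"
      using that by blast
  qed
  have Z0: "Zsum (x / \<beta>) (\<gamma> * x) W E [] = 2 ^ card I * (\<Sum>T\<in>Pow W'. ?w T)"
    unfolding Zsum_def W(1) using w[of _ "{}", unfolded Un_empty_left] by (rule sum_Pow_restrict[OF fin(1,2) W(2)])
  have Z1: "(\<Sum>T\<in>Pow W. ?w (insert v T)) = 2 ^ card I * (\<Sum>T\<in>Pow W'. ?w (insert v T))"
    unfolding W(1) using w[of _ "{v}", folded insert_is_Un] by (rule sum_Pow_restrict[OF fin(1,2) W(2)])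
  have "cmod (z w) < \<rho> ^ deg E w" for w
  proof (cases "w = v")
    case True
    then show ?thesis using c by (simp add: z_def norm_mult norm_power)
  next
    case False
    then show ?thesis
      using x assms(2) by (auto simp: z_def W'_def norm_power intro!: power_strict_mono)
  qed
  then have "field_sum \<beta> \<gamma> E z V \<noteq> 0"
    by (intro field_sum_nonzero[OF V(1) assms(2) edge V(2)]) auto
  moreover have "field_sum \<beta> \<gamma> E z V = \<beta> ^ length E * ((\<Sum>T\<in>Pow W'. ?w T) + c * (\<Sum>T\<in>Pow W'. ?w (insert v T)))"
  proof -
    let ?f = "\<lambda>T. prod_list (map (spin_wt \<beta> \<gamma> T) E)"
    have e1: "field_sum \<beta> \<gamma> E z V = (\<Sum>T\<in>Pow (insert v W'). ?f T * prod z T)"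
      unfolding field_sum_def
    proof (rule sum.mono_neutral_right)
      show "Pow (insert v W') \<subseteq> Pow V" using V W by auto
      show "\<forall>T\<in>Pow V - Pow (insert v W'). ?f T * prod z T = 0"
      proof
        fix T assume T: "T \<in> Pow V - Pow (insert v W')"
        then obtain w where "w \<in> T" "w \<noteq> v" "w \<notin> W'" by auto
        moreover have "finite T" using T finite_subset[OF _ V(1)] by auto
        ultimately have "prod z T = 0" by (intro prod_zero) (auto simp: z_def)
        then show "?f T * prod z T = 0" by simp
      qed
    qed (simp add: V(1))
    have e2: "(\<Sum>T\<in>Pow (insert v W'). ?f T * prod z T)
        = (\<Sum>T\<in>Pow W'. ?f T * prod z T) + (\<Sum>T\<in>Pow W'. ?f (insert v T) * prod z T) * z v"
      by (rule field_sum_split[OF fin(2) vW'])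
    have e3: "(\<Sum>T\<in>Pow W'. ?f T * prod z T) = \<beta> ^ length E * (\<Sum>T\<in>Pow W'. ?w T)"
      unfolding sum_distrib_left
    proof (rule sum.cong)
      fix T assume T: "T \<in> Pow W'"
      have "prod z T = (\<Prod>w\<in>T. x ^ deg E w)"
      proof (rule prod.cong)
        fix w assume "w \<in> T"
        then have "w \<in> W'" "w \<noteq> v" using T vW' by auto
        then show "z w = x ^ deg E w" by (simp add: z_def)
      qed simp
      then show "?f T * prod z T = \<beta> ^ length E * ?w T"
        using wt_eq_spin_wt[OF assms(1) finite_subset[OF _ fin(2)], of T E x \<gamma>] T by simp
    qed simp
    have e4: "(\<Sum>T\<in>Pow W'. ?f (insert v T) * prod z T) * z v = \<beta> ^ length E * (c * (\<Sum>T\<in>Pow W'. ?w (insert v T)))"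
      unfolding sum_distrib_left sum_distrib_right
    proof (rule sum.cong)
      fix T assume T: "T \<in> Pow W'"
      then have finT: "finite T" "v \<notin> T" using finite_subset[OF _ fin(2)] vW' by auto
      have pz: "prod z T = (\<Prod>w\<in>T. x ^ deg E w)"
      proof (rule prod.cong)
        fix w assume "w \<in> T"
        then have "w \<in> W'" "w \<noteq> v" using T vW' by auto
        then show "z w = x ^ deg E w" by (simp add: z_def)
      qed simp
      have zv: "z v = c * x ^ deg E v" by (simp add: z_def)
      have e: "prod z T * z v = c * (\<Prod>w\<in>insert v T. x ^ deg E w)"
        unfolding pz zv prod.insert[OF finT] by (simp only: ac_simps)
      have "?f (insert v T) * prod z T * z v = c * (?f (insert v T) * (\<Prod>w\<in>insert v T. x ^ deg E w))"
        unfolding mult.assoc e by (rule mult.left_commute)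
      also have "\<dots> = c * (\<beta> ^ length E * ?w (insert v T))"
        by (subst wt_eq_spin_wt[OF assms(1)]) (use finT in simp_all)
      also have "\<dots> = \<beta> ^ length E * (c * ?w (insert v T))" by (rule mult.left_commute)
      finally show "?f (insert v T) * prod z T * z v = \<beta> ^ length E * (c * ?w (insert v T))" .
    qed simp
    show ?thesis unfolding e1 e2 e3 e4 by (simp only: distrib_left)
  qed
  ultimately have nz: "(\<Sum>T\<in>Pow W'. ?w T) + c * (\<Sum>T\<in>Pow W'. ?w (insert v T)) \<noteq> 0" by auto
  have "Zsum (x / \<beta>) (\<gamma> * x) W E [] + c * (\<Sum>T\<in>Pow W. ?w (insert v T))
      = 2 ^ card I * ((\<Sum>T\<in>Pow W'. ?w T) + c * (\<Sum>T\<in>Pow W'. ?w (insert v T)))"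
    unfolding Z0 Z1 by (simp add: algebra_simps)
  then show ?thesis using nz by simp
qed

text \<open>Cauchy's estimate on the circle of radius \<open>t\<close>, which lies strictly inside
  the disc because nothing is known on its boundary; the tail is then dominated by a geometric
  series.\<close>

lemma fps_tail_bound:
  fixes f :: "complex \<Rightarrow> complex" and s t R :: real
  assumes F: "f has_fps_expansion F" and hol: "f holomorphic_on ball 0 R"
    and le: "\<And>z. z \<in> ball 0 R \<Longrightarrow> cmod (f z) \<le> 1" and st: "0 < s" "s < t" "t < R"
  shows "cmod (f (of_real s) - (\<Sum>j<k. fps_nth F j * of_real s ^ j)) \<le> (s / t) ^ k / (1 - s / t)"
proof -
  have t: "t > 0" using st by simp
  have coeff: "cmod (fps_nth F n) \<le> 1 / t ^ n" for n
  proof -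
    have "cmod ((deriv ^^ n) f 0) \<le> fact n * 1 / t ^ n"
    proof (rule Cauchy_inequality)
      show "f holomorphic_on ball 0 t" using st by (intro holomorphic_on_subset[OF hol]) auto
      show "continuous_on (cball 0 t) f"
        using st by (intro holomorphic_on_imp_continuous_on holomorphic_on_subset[OF hol]) auto
      show "0 < t" by fact
      show "cmod (f z) \<le> 1" if "cmod (0 - z) = t" for z
        using that st(3) by (intro le) simp
    qed
    then show ?thesis
      by (simp add: fps_nth_fps_expansion[OF F] norm_divide field_simps)
  qed
  have "(\<lambda>n. fps_nth F n * of_real s ^ n) sums f (of_real s)"
    using st by (intro has_fps_expansion_imp_sums_complex[OF F, of "ereal R"]) (auto simp: hol)
  then have "(\<lambda>n. fps_nth F (n + k) * of_real s ^ (n + k)) sums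
      (f (of_real s) - (\<Sum>j<k. fps_nth F j * of_real s ^ j))"
    by (rule sums_split_initial_segment)
  moreover have "(\<lambda>n. (s / t) ^ k * (s / t) ^ n) sums ((s / t) ^ k * (1 / (1 - s / t)))"
    using st by (intro sums_mult geometric_sums) auto
  moreover have "cmod (fps_nth F (n + k) * of_real s ^ (n + k)) \<le> (s / t) ^ k * (s / t) ^ n" for n
  proof -
    have "cmod (fps_nth F (n + k) * of_real s ^ (n + k)) = cmod (fps_nth F (n + k)) * s ^ (n + k)"
      using st(1) by (simp add: norm_mult norm_power)
    also have "\<dots> \<le> 1 / t ^ (n + k) * s ^ (n + k)"
      by (rule mult_right_mono[OF coeff]) (use st(1) in simp)
    also have "\<dots> = (s / t) ^ (n + k)" by (simp only: power_divide times_divide_eq_left mult_1_left)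
    also have "\<dots> = (s / t) ^ k * (s / t) ^ n" unfolding power_add by (rule mult.commute)
    finally show ?thesis .
  qed
  ultimately have "cmod (f (of_real s) - (\<Sum>j<k. fps_nth F j * of_real s ^ j)) \<le> (s / t) ^ k * (1 / (1 - s / t))"
    by - (rule norm_sums_le, assumption+)
  then show ?thesis by (simp only: times_divide_eq_right mult_1_right)
qed

lemma has_fps_expansion_wt:
  fixes fA fG :: "complex \<Rightarrow> complex"
  assumes "fA has_fps_expansion A" "fG has_fps_expansion G"
  shows "(\<lambda>y. wt (fA y) (fG y) E [] T) has_fps_expansion wt A G E [] T"
proof (induction E)
  case (Cons e E)
  have "(\<lambda>y. edge_wt (fA y) (fG y) T e) has_fps_expansion edge_wt A G T e"
    using assms by (cases e) (auto intro!: fps_expansion_intros)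
  then show ?case unfolding wt_simps using Cons by (intro fps_expansion_intros)
qed (simp add: wt_simps)

lemma holomorphic_wt:
  fixes fA fG :: "complex \<Rightarrow> complex"
  assumes "fA holomorphic_on S" "fG holomorphic_on S"
  shows "(\<lambda>y. wt (fA y) (fG y) E [] T) holomorphic_on S"
proof (induction E)
  case (Cons e E)
  have "(\<lambda>y. edge_wt (fA y) (fG y) T e) holomorphic_on S"
  proof (cases e)
    case (Pair a b)
    show ?thesis
      using assms unfolding Pair by (cases "a \<in> T"; cases "b \<in> T") (auto intro!: holomorphic_intros)
  qed
  then show ?case unfolding wt_simps using Cons by (intro holomorphic_intros)
qed (simp add: wt_simps)

lemma relative_error_prod:
  fixes X Y X' Y' :: complex
  assumes "cmod (Y - X) \<le> \<eta> * cmod X" "cmod (Y' - X') \<le> ((1 + \<eta>) ^ n - 1) * cmod X'" "\<eta> \<ge> 0"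
  shows "cmod (Y * Y' - X * X') \<le> ((1 + \<eta>) ^ Suc n - 1) * cmod (X * X')"
proof -
  have "cmod Y \<le> cmod X + cmod (Y - X)" by (rule norm_triangle_sub)
  then have Y: "cmod Y \<le> (1 + \<eta>) * cmod X" using assms(1) by (simp add: algebra_simps)
  have e: "Y * Y' - X * X' = Y * (Y' - X') + (Y - X) * X'" by (simp add: algebra_simps)
  have "cmod (Y * Y' - X * X') \<le> cmod Y * cmod (Y' - X') + cmod (Y - X) * cmod X'"
    unfolding e norm_mult[symmetric] by (rule norm_triangle_ineq)
  also have "\<dots> \<le> ((1 + \<eta>) * cmod X) * (((1 + \<eta>) ^ n - 1) * cmod X') + (\<eta> * cmod X) * cmod X'"
    using Y assms by (intro add_mono mult_mono) auto
  also have "\<dots> = ((1 + \<eta>) ^ Suc n - 1) * cmod (X * X')"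
    by (simp add: norm_mult algebra_simps)
  finally show ?thesis .
qed

section \<open>Analytic bounds for the ratios\<close>

locale spin_zero_free = spin_program +
  fixes \<beta> \<gamma> \<rho> :: real
  assumes \<beta>_nz: "\<beta> \<noteq> 0" and cD_pos: "cD > 0" and cA_eq: "of_int cA * \<beta> = of_int cD"
    and cG_eq: "of_int cG = \<gamma> * of_int cD" and \<rho>_gt_1: "\<rho> > 1"
    and edge_nz: "cmod a \<le> \<rho> \<Longrightarrow> cmod b \<le> \<rho> \<Longrightarrow> of_real \<beta> + a + b + of_real \<gamma> * a * b \<noteq> 0"
begin

text \<open>The radius, in terms of x, of the circle for Cauchy's estimate. Of the two factors in
  \<open>tail_const\<close>, one sums the geometric tail; the other comes from the lower bound for
  |1 + R_v| that makes the error relative.\<close>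

definition tail_base :: real where "tail_base = (1 + \<rho>) / 2"
definition tail_const :: real where "tail_const = 1 / ((1 - 1 / tail_base) * (1 - 1 / \<rho>))"

lemma tail_base: "1 < tail_base" "tail_base < \<rho>"
  using \<rho>_gt_1 by (auto simp: tail_base_def)

lemma tail_const_pos: "tail_const > 0"
  using tail_base \<rho>_gt_1 by (auto simp: tail_const_def)

lemma scaled_weights:
  "of_int cA * y = of_int cD * y / complex_of_real \<beta>" "of_int cG * y = complex_of_real \<gamma> * (of_int cD * y)"
proof -
  have "complex_of_int cA * complex_of_real \<beta> = of_int cD"
    using arg_cong[OF cA_eq, of complex_of_real] by simp
  then show "of_int cA * y = of_int cD * y / complex_of_real \<beta>" using \<beta>_nz by (simp add: field_simps)
  have "complex_of_int cG = complex_of_real \<gamma> * of_int cD"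
    using arg_cong[OF cG_eq, of complex_of_real] by simp
  then show "of_int cG * y = complex_of_real \<gamma> * (of_int cD * y)" by simp
qed

text \<open>Summing over subsets of \<open>W\<close> pins every other vertex to 0, so
  \<open>E\<close> can remain the edge list of the whole graph.\<close>

definition Z0 :: "nat set \<Rightarrow> (nat \<times> nat) list \<Rightarrow> complex \<Rightarrow> complex" where
  "Z0 W E y = Zsum (of_int cA * y) (of_int cG * y) W E []"

definition Z1 :: "nat set \<Rightarrow> nat \<Rightarrow> (nat \<times> nat) list \<Rightarrow> complex \<Rightarrow> complex" where
  "Z1 W v E y = (\<Sum>T\<in>Pow W. wt (of_int cA * y) (of_int cG * y) E [] (insert v T))"

lemma Z_nonzero:
  assumes "finite V" "set E \<subseteq> V \<times> V" "W \<subseteq> V" "v \<in> V" "v \<notin> W"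
    and "cmod (of_int cD * y) < \<rho>" "cmod c * cmod (of_int cD * y) ^ deg E v < \<rho> ^ deg E v"
  shows "Z0 W E y + c * Z1 W v E y \<noteq> 0"
  unfolding Z0_def Z1_def scaled_weights
  by (rule partition_ratio_nonzero[OF _ _ edge_nz assms]) (use \<beta>_nz \<rho>_gt_1 in auto)

text \<open>The value \<open>c\<close> = - Z0 / Z1 would make the sum vanish, so it cannot lie in
  the open unit disc.\<close>

lemma Z1_le_Z0:
  assumes "finite V" "set E \<subseteq> V \<times> V" "W \<subseteq> V" "v \<in> V" "v \<notin> W" "cmod (of_int cD * y) < \<rho>"
  shows "cmod (Z1 W v E y) \<le> cmod (Z0 W E y)"
proof (rule ccontr)
  assume n: "\<not> ?thesis"
  define c where "c = - Z0 W E y / Z1 W v E y"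
  have nz: "Z1 W v E y \<noteq> 0" using n by auto
  have c: "cmod c < 1" using n nz by (simp add: c_def norm_divide)
  have "cmod c * cmod (of_int cD * y) ^ deg E v \<le> cmod c * \<rho> ^ deg E v"
    using assms(6) by (intro mult_left_mono power_mono) auto
  also have "\<dots> < 1 * \<rho> ^ deg E v" using c \<rho>_gt_1 by (intro mult_strict_right_mono) auto
  finally have "Z0 W E y + c * Z1 W v E y \<noteq> 0" using assms by (intro Z_nonzero) auto
  then show False using nz by (simp add: c_def)
qed

text \<open>At x = 1 the factor \<open>c\<close> may range up to \<open>\<rho> ^ deg E v\<close>,
  hence the ratio is at most 1 / \<rho> if \<open>v\<close> has an edge. An isolated vertex has
  ratio 1, which is far from -1.\<close>

lemma norm_one_plus_ratio:
  assumes "finite V" "set E \<subseteq> V \<times> V" "W \<subseteq> V" "v \<in> V" "v \<notin> W" and y: "y = 1 / of_int cD"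
  shows "cmod (1 + Z1 W v E y / Z0 W E y) \<ge> 1 - 1 / \<rho>"
proof -
  have Dy: "of_int cD * y = 1" using cD_pos y by simp
  have nz0: "Z0 W E y \<noteq> 0"
    using Z_nonzero[OF assms(1-5), of y 0] Dy \<rho>_gt_1 by simp
  show ?thesis
  proof (cases "deg E v = 0")
    case True
    have "wt (of_int cA * y) (of_int cG * y) E [] (insert v T) = wt (of_int cA * y) (of_int cG * y) E [] T" for T
      using True deg_pos by (intro wt_cong) fastforce
    then have "Z1 W v E y = Z0 W E y" by (simp add: Z1_def Z0_def Zsum_def)
    then show ?thesis using nz0 \<rho>_gt_1 by (simp add: field_simps)
  next
    case False
    have "\<rho> * cmod (Z1 W v E y) \<le> cmod (Z0 W E y)"
    proof (rule ccontr)
      assume n: "\<not> ?thesis"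
      define c where "c = - Z0 W E y / Z1 W v E y"
      have nz: "Z1 W v E y \<noteq> 0" using n by auto
      have "cmod c < \<rho>" using n nz by (simp add: c_def norm_divide field_simps)
      also have "\<rho> \<le> \<rho> ^ deg E v" using False \<rho>_gt_1 by (intro self_le_power) auto
      finally have "Z0 W E y + c * Z1 W v E y \<noteq> 0"
        using assms Dy \<rho>_gt_1 by (intro Z_nonzero) auto
      then show False using nz by (simp add: c_def)
    qed
    then have "cmod (Z1 W v E y / Z0 W E y) \<le> 1 / \<rho>"
      using nz0 \<rho>_gt_1 by (simp add: norm_divide field_simps)
    moreover have "cmod 1 - cmod (Z1 W v E y / Z0 W E y) \<le> cmod (1 + Z1 W v E y / Z0 W E y)"
      by (rule norm_diff_ineq)
    ultimately show ?thesis by simp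
  qed
qed

text \<open>In the variable y = x / \<open>cD\<close> all radii shrink by \<open>cD\<close>; their
  quotient, which governs the tail, does not change.\<close>

lemma ratio_tail:
  assumes "finite V" "set E \<subseteq> V \<times> V" "W \<subseteq> V" "v \<in> V" "v \<notin> W"
  defines "y \<equiv> 1 / of_int cD"
  shows "cmod (Z1 W v E y / Z0 W E y - (\<Sum>j<k. fps_nth (ratio_series W v E []) j / of_int cD ^ j))
     \<le> (1 / tail_base) ^ k / (1 - 1 / tail_base)"
proof -
  let ?f = "\<lambda>y. Z1 W v E y * inverse (Z0 W E y)"
  let ?D = "real_of_int cD"
  have D: "?D > 0" using cD_pos by simp
  have fin: "finite W" using assms finite_subset by blast
  have small: "cmod (of_int cD * y) < \<rho>" if "y \<in> ball 0 (\<rho> / ?D)" for y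
    using that D by (simp add: norm_mult field_simps)
  have nz: "Z0 W E y \<noteq> 0" if "y \<in> ball 0 (\<rho> / ?D)" for y
    using Z_nonzero[OF assms(1-5) small[OF that], of 0] \<rho>_gt_1 by simp
  have A: "(\<lambda>y. of_int cA * y) has_fps_expansion serA" "(\<lambda>y. of_int cG * y) has_fps_expansion serG"
    unfolding serA_def serG_def by (intro fps_expansion_intros)+
  have "(\<lambda>y. Z0 W E y) has_fps_expansion Zsum serA serG W E []"
    unfolding Z0_def Zsum_def by (intro fps_expansion_intros has_fps_expansion_wt A)
  moreover have "(\<lambda>y. Z1 W v E y) has_fps_expansion (\<Sum>T\<in>Pow W. wt serA serG E [] (insert v T))"
    unfolding Z1_def by (intro fps_expansion_intros has_fps_expansion_wt A)
  ultimately have "?f has_fps_expansion ratio_series W v E []"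
    unfolding ratio_series_def using Zsum_nth_0[OF fin] by (intro fps_expansion_intros) auto
  moreover have "?f holomorphic_on ball 0 (\<rho> / ?D)"
    unfolding Z0_def Z1_def Zsum_def
    by (intro holomorphic_intros holomorphic_wt) (use nz in \<open>auto simp: Z0_def Zsum_def\<close>)
  moreover have "cmod (?f z) \<le> 1" if "z \<in> ball 0 (\<rho> / ?D)" for z
  proof -
    have "cmod (Z1 W v E z) \<le> cmod (Z0 W E z)" by (rule Z1_le_Z0[OF assms(1-5) small[OF that]])
    then show ?thesis using nz[OF that] by (simp add: norm_divide flip: divide_inverse)
  qed
  ultimately have main: "cmod (?f (of_real (1 / ?D)) - (\<Sum>j<k. fps_nth (ratio_series W v E []) j * of_real (1 / ?D) ^ j))
      \<le> ((1 / ?D) / (tail_base / ?D)) ^ k / (1 - (1 / ?D) / (tail_base / ?D))"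
    using D tail_base by (intro fps_tail_bound[where R = "\<rho> / ?D"]) (auto simp: divide_strict_right_mono)
  have e1: "(1 / ?D) / (tail_base / ?D) = 1 / tail_base" using D by simp
  have e2: "complex_of_real (1 / ?D) = y" by (simp add: y_def)
  have e3: "c * y ^ j = c / of_int cD ^ j" for c j by (simp add: y_def power_one_over)
  have e4: "Z1 W v E y * inverse (Z0 W E y) = Z1 W v E y / Z0 W E y" by (rule divide_inverse[symmetric])
  show ?thesis using main unfolding e1 e2 e3 e4 .
qed

fun approx :: "nat \<Rightarrow> (nat \<times> nat) list \<Rightarrow> nat list \<Rightarrow> complex" where
  "approx k E [] = 1"
| "approx k E (v # vs) =
     (1 + (\<Sum>j<k. fps_nth (ratio_series (set vs) v E []) j / of_int cD ^ j)) * approx k E vs"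

theorem approx_error:
  assumes "finite V" "set E \<subseteq> V \<times> V" "set vs \<subseteq> V" "distinct vs"
  shows "cmod (approx k E vs - Z0 (set vs) E (1 / of_int cD))
     \<le> ((1 + tail_const * (1 / tail_base) ^ k) ^ length vs - 1) * cmod (Z0 (set vs) E (1 / of_int cD))"
  using assms(3,4)
proof (induction vs)
  case Nil
  then show ?case by (simp add: Z0_def Zsum_def)
next
  case (Cons v vs)
  let ?y = "1 / of_int cD :: complex" and ?W = "set vs"
  let ?R = "Z1 ?W v E ?y / Z0 ?W E ?y"
  have V: "?W \<subseteq> V" "v \<in> V" "v \<notin> ?W" using Cons.prems by auto
  have nz0: "Z0 ?W E ?y \<noteq> 0"
    using Z_nonzero[OF assms(1,2) V, of ?y 0] cD_pos \<rho>_gt_1 by simp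
  have "Z0 (set (v # vs)) E ?y = Z0 ?W E ?y + Z1 ?W v E ?y"
    unfolding Z0_def Z1_def Zsum_def using V(3) by (simp add: sum_Pow_insert)
  then have Z: "Z0 (set (v # vs)) E ?y = (1 + ?R) * Z0 ?W E ?y" using nz0 by (simp add: field_simps)
  let ?S = "\<Sum>j<k. fps_nth (ratio_series ?W v E []) j / of_int cD ^ j"
  have "cmod ((1 + ?S) - (1 + ?R)) = cmod (?R - ?S)" by (simp add: norm_minus_commute)
  also have "\<dots> \<le> (1 / tail_base) ^ k / (1 - 1 / tail_base)" by (rule ratio_tail[OF assms(1,2) V])
  also have "\<dots> = tail_const * (1 / tail_base) ^ k * (1 - 1 / \<rho>)"
    using \<rho>_gt_1 by (simp add: tail_const_def)
  also have "\<dots> \<le> tail_const * (1 / tail_base) ^ k * cmod (1 + ?R)"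
    using norm_one_plus_ratio[OF assms(1,2) V refl] tail_const_pos tail_base by (intro mult_left_mono) auto
  finally have 1: "cmod ((1 + ?S) - (1 + ?R)) \<le> tail_const * (1 / tail_base) ^ k * cmod (1 + ?R)" .
  have "cmod (approx k E vs - Z0 ?W E ?y)
      \<le> ((1 + tail_const * (1 / tail_base) ^ k) ^ length vs - 1) * cmod (Z0 ?W E ?y)"
    using Cons by auto
  from relative_error_prod[OF 1 this] show ?case
    using tail_const_pos tail_base unfolding Z by simp
qed

end

section \<open>Accuracy of the output\<close>

lemma wt_noloop_looppins: "wt A G (noloop E) (looppins E) T = wt A G E [] T"
proof (induction E)
  case (Cons e E)
  then show ?case
    by (cases e) (auto simp: noloop_def wt_simps ac_simps)
qed (simp add: noloop_def)

context spin_program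
begin

lemma horner_value:
  assumes "cD > 0"
  shows "complex_of_int (fst (horner xs)) / of_int (snd (horner xs))
     = (\<Sum>j<length xs. of_int (xs ! j) / of_int cD ^ j)" "snd (horner xs) > 0"
proof -
  have "snd (horner xs) > 0 \<and> complex_of_int (fst (horner xs)) / of_int (snd (horner xs))
     = (\<Sum>j<length xs. of_int (xs ! j) / of_int cD ^ j)"
  proof (induction xs)
    case (Cons x xs)
    obtain n d where nd: "horner xs = (n, d)" by (cases "horner xs")
    have d: "d > 0" and IH: "complex_of_int n / of_int d = (\<Sum>j<length xs. of_int (xs ! j) / of_int cD ^ j)"
      using Cons by (simp_all add: nd)
    have "(\<Sum>j<length (x # xs). complex_of_int ((x # xs) ! j) / of_int cD ^ j)
        = of_int x + (\<Sum>j<length xs. of_int (xs ! j) / of_int cD ^ j) / of_int cD"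
      by (simp add: sum.lessThan_Suc_shift sum_divide_distrib field_simps del: sum.lessThan_Suc)
    also have "\<dots> = of_int (x * (d * cD) + n) / of_int (d * cD)"
      unfolding IH[symmetric] using d assms by (simp add: field_simps)
    finally show ?case using d assms by (simp add: nd)
  qed simp
  then show "complex_of_int (fst (horner xs)) / of_int (snd (horner xs))
     = (\<Sum>j<length xs. of_int (xs ! j) / of_int cD ^ j)" "snd (horner xs) > 0" by auto
qed

end

lemma (in spin_algo) length_ratio: "length (ratio k v E P) = k"
  using ratio_props by auto

locale spin_full = spin_algo + spin_zero_free
begin

text \<open>The program has reached \<open>E'\<close> and \<open>P\<close> while
  \<open>approx\<close> still refers to the original \<open>E\<close>. The invariant is that both
  give equal weight to all spin-1 sets among the remaining vertices; \<open>wt_remove\<close>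
  preserves it.\<close>

lemma outer_value:
  assumes "distinct vs" "set E' \<subseteq> set vs \<times> set vs" "\<forall>(x, y) \<in> set E'. x \<noteq> y"
    "\<And>T. T \<subseteq> set vs \<Longrightarrow> wt serA serG E' P T = wt serA serG E [] T" "den > 0"
  shows "snd (outer l E' P vs num den) > 0 \<and>
    complex_of_int (fst (outer l E' P vs num den)) / of_int (snd (outer l E' P vs num den))
      = of_int num / of_int den * approx l E vs"
  using assms
proof (induction vs arbitrary: E' P num den)
  case (Cons v vs)
  let ?r = "ratio l v E' P"
  obtain n d where nd: "horner ?r = (n, d)" by (cases "horner ?r")
  have v: "v \<notin> set vs" "distinct vs" using Cons.prems(1) by auto
  have "truncates (ratio_series (set vs) v E' P) ?r"
    using Cons.prems v by (intro truncates_ratio) auto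
  moreover have "ratio_series (set vs) v E' P = ratio_series (set vs) v E []"
  proof -
    have "(\<Sum>T\<in>Pow (set vs). wt serA serG E' P (insert v T)) = (\<Sum>T\<in>Pow (set vs). wt serA serG E [] (insert v T))"
      by (intro sum.cong refl Cons.prems(4)) auto
    moreover have "Zsum serA serG (set vs) E' P = Zsum serA serG (set vs) E []"
      unfolding Zsum_def by (intro sum.cong refl Cons.prems(4)) auto
    ultimately show ?thesis by (simp only: ratio_series_def)
  qed
  ultimately have nth: "complex_of_int (?r ! j) = fps_nth (ratio_series (set vs) v E []) j" if "j < l" for j
    using that by (simp add: truncates_def length_ratio)
  have d: "d > 0" using horner_value(2)[OF cD_pos, of ?r] by (simp add: nd)
  have "complex_of_int n / of_int d = (\<Sum>j<l. of_int (?r ! j) / of_int cD ^ j)"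
    using horner_value(1)[OF cD_pos, of ?r] by (simp add: nd length_ratio)
  also have "\<dots> = (\<Sum>j<l. fps_nth (ratio_series (set vs) v E []) j / of_int cD ^ j)"
    by (intro sum.cong) (auto simp: nth)
  finally have val: "complex_of_int (d + n) / of_int d = 1 + (\<Sum>j<l. fps_nth (ratio_series (set vs) v E []) j / of_int cD ^ j)"
    using d by (simp add: add_divide_distrib)
  have eq: "outer l E' P (v # vs) num den = outer l (rest v E') (pins (nbrs v E') P) vs (num * (d + n)) (den * d)"
    by (simp add: nd)
  have wts: "wt serA serG (rest v E') (pins (nbrs v E') P) T = wt serA serG E [] T" if "T \<subseteq> set vs" for T
  proof -
    have "v \<notin> T" using that v by auto
    from wt_remove[OF this, of serA serG E' P] show ?thesis using Cons.prems(4)[of T] that by auto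
  qed
  have "snd (outer l (rest v E') (pins (nbrs v E') P) vs (num * (d + n)) (den * d)) > 0 \<and>
    complex_of_int (fst (outer l (rest v E') (pins (nbrs v E') P) vs (num * (d + n)) (den * d)))
       / of_int (snd (outer l (rest v E') (pins (nbrs v E') P) vs (num * (d + n)) (den * d)))
      = of_int (num * (d + n)) / of_int (den * d) * approx l E vs"
    using Cons.prems d v wts by (intro Cons.IH) (auto simp: set_rest)
  moreover have "complex_of_int (num * (d + n)) / of_int (den * d) * approx l E vs
      = of_int num / of_int den * (complex_of_int (d + n) / of_int d * approx l E vs)"
    by simp
  ultimately show ?case unfolding eq approx.simps val by simp
qed simp

end

section \<open>How many coefficients suffice\<close>

lemma power_error_bound:
  fixes \<eta> :: real
  assumes "\<eta> \<ge> 0" "real n * \<eta> \<le> 1"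
  shows "(1 + \<eta>) ^ n - 1 \<le> 2 * (real n * \<eta>)"
proof -
  let ?x = "real n * \<eta>"
  have "(1 + \<eta>) ^ n \<le> exp \<eta> ^ n" using assms(1) exp_ge_add_one_self[of \<eta>] by (intro power_mono) auto
  also have "\<dots> = exp ?x" by (simp add: exp_of_nat_mult)
  also have "\<dots> \<le> 1 + ?x + ?x\<^sup>2" using assms by (intro exp_bound) auto
  also have "?x\<^sup>2 \<le> ?x" using assms by (simp add: power2_eq_square mult_left_le)
  finally show ?thesis by (simp add: algebra_simps)
qed

text \<open>Each block of \<open>K\<close> coefficients gains a factor 2 (1 + C): the 2 halves the
  error, and one of the factors 1 + C absorbs \<open>C\<close>. The blocks for
  \<open>bit_length n\<close> compensate the number of vertices, those for the length difference
  reach the accuracy a / b. The three spare blocks cover the factor 2 of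
  \<open>power_error_bound\<close> and the rounding of a and b to powers of 2.\<close>

lemma accuracy:
  fixes r C :: real and n a b K :: nat
  assumes r: "r > 1" and C: "C > 0" and K: "r ^ K \<ge> 2 * (1 + C)" and ab: "a > 0" "b > 0"
  defines "l \<equiv> K * bit_length n + (K * (bit_length b - bit_length a) + 3 * K)"
  shows "(1 + C * (1 / r) ^ l) ^ n - 1 \<le> real a / real b"
proof -
  define \<delta> where "\<delta> = bit_length b - bit_length a"
  define Q where "Q = bit_length n + \<delta> + 3"
  have l: "l = K * Q" by (simp add: l_def Q_def \<delta>_def algebra_simps)
  have "(1 + C) * 2 ^ Q \<le> (1 + C) ^ Q * 2 ^ Q"
    using C by (intro mult_right_mono self_le_power) (auto simp: Q_def)
  also have "\<dots> = (2 * (1 + C)) ^ Q" unfolding power_mult_distrib by (rule mult.commute)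
  also have "\<dots> \<le> (r ^ K) ^ Q" using C K by (intro power_mono) auto
  finally have rl: "(1 + C) * 2 ^ Q \<le> r ^ l" by (simp add: l power_mult)
  have "C * (1 / r) ^ l = C / r ^ l" by (simp add: power_one_over)
  also have "\<dots> \<le> (1 + C) / ((1 + C) * 2 ^ Q)" using C rl by (intro frac_le) auto
  also have "\<dots> = 1 / 2 ^ Q" using C by simp
  finally have \<eta>: "C * (1 / r) ^ l \<le> 1 / 2 ^ Q" .
  have n: "real n \<le> 2 ^ bit_length n"
    using less_two_power_bit_length[of n] by (metis less_imp_le of_nat_le_iff of_nat_numeral of_nat_power)
  have "real n * (C * (1 / r) ^ l) \<le> 2 ^ bit_length n * (1 / 2 ^ Q)"
    using n \<eta> C r by (intro mult_mono) auto
  also have "\<dots> = 1 / 2 ^ (\<delta> + 3)" by (simp add: Q_def power_add)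
  finally have small: "real n * (C * (1 / r) ^ l) \<le> 1 / 2 ^ (\<delta> + 3)" .
  have "b < 2 ^ bit_length b" by (rule less_two_power_bit_length)
  also have "\<dots> \<le> 2 ^ (\<delta> + bit_length a)" by (intro power_increasing) (auto simp: \<delta>_def)
  also have "\<dots> = 2 ^ \<delta> * 2 ^ bit_length a" by (rule power_add)
  also have "\<dots> \<le> 2 ^ \<delta> * (2 * a)" using ab by (intro mult_left_mono two_power_bit_length_le) auto
  finally have "real b \<le> real (2 ^ \<delta> * (2 * a))" by (simp only: of_nat_le_iff less_imp_le)
  then have e: "1 / (2 * 2 ^ \<delta>) \<le> real a / real b" using ab by (simp add: field_simps)
  have le1: "1 / 2 ^ (\<delta> + 3) \<le> (1::real)" by simp
  have "(1 + C * (1 / r) ^ l) ^ n - 1 \<le> 2 * (real n * (C * (1 / r) ^ l))"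
    using C r small le1 by (intro power_error_bound) (auto intro: order_trans)
  also have "\<dots> \<le> 2 * (1 / 2 ^ (\<delta> + 3))" using small by (rule mult_left_mono) simp
  also have "\<dots> \<le> 1 / (2 * 2 ^ \<delta>)" by (simp add: power_add divide_simps)
  finally show ?thesis using e by simp
qed

section \<open>The partition function as a sum over spin-1 sets\<close>

lemma sum_PiE_01:
  assumes "finite V"
  shows "(\<Sum>\<sigma>\<in>V \<rightarrow>\<^sub>E {0, 1::nat}. f \<sigma>) = (\<Sum>T\<in>Pow V. f (\<lambda>v\<in>V. if v \<in> T then 1 else 0))"
proof (rule sum.reindex_bij_witness[where i = "\<lambda>T. \<lambda>v\<in>V. if v \<in> T then 1 else 0" and j = "\<lambda>\<sigma>. {v \<in> V. \<sigma> v = 1}"])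
  fix \<sigma> assume s: "\<sigma> \<in> V \<rightarrow>\<^sub>E {0, 1::nat}"
  then show eq: "(\<lambda>v\<in>V. if v \<in> {v \<in> V. \<sigma> v = 1} then 1 else 0) = \<sigma>"
    by (intro ext) (auto simp: PiE_iff extensional_def)
  show "f (\<lambda>v\<in>V. if v \<in> {v \<in> V. \<sigma> v = 1} then 1 else 0) = f \<sigma>" by (simp only: eq)
qed (auto split: if_splits)

lemma partition_function_eq_sum:
  assumes "wf_multigraph G" "mset (map (\<lambda>(u, v). Upair u v) es) = edges G"
  shows "complex_of_real (of_rat (partition_function \<beta> \<gamma> G))
    = (\<Sum>T\<in>Pow (verts G). prod_list (map (spin_wt (of_real (of_rat \<beta>)) (of_real (of_rat \<gamma>)) T) es))"
proof -
  let ?V = "verts G" and ?h = "\<lambda>q. complex_of_real (of_rat q)"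
  have fin: "finite ?V" using assms(1) by (simp add: wf_multigraph_def)
  have ends: "u \<in> ?V \<and> v \<in> ?V" if "(u, v) \<in> set es" for u v
  proof -
    have "Upair u v \<in># edges G" unfolding assms(2)[symmetric] using that by force
    then show ?thesis using assms(1) by (auto simp: wf_multigraph_def)
  qed
  have hp: "?h (prod_list xs) = prod_list (map ?h xs)" for xs
    by (induction xs) (auto simp: of_rat_mult)
  have hs: "?h (sum f A) = (\<Sum>x\<in>A. ?h (f x))" for f :: "nat set \<Rightarrow> rat" and A
    by (induction A rule: infinite_finite_induct) (auto simp: of_rat_add)
  have "?h (\<Prod>e\<in>#edges G. edge_weight \<beta> \<gamma> (\<lambda>v\<in>?V. if v \<in> T then 1 else 0) e)
     = prod_list (map (spin_wt (?h \<beta>) (?h \<gamma>) T) es)" for T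
  proof -
    let ?s = "\<lambda>v\<in>?V. if v \<in> T then 1 else 0 :: nat"
    have "(\<Prod>e\<in>#edges G. edge_weight \<beta> \<gamma> ?s e)
        = prod_list (map (edge_weight \<beta> \<gamma> ?s) (map (\<lambda>(u, v). Upair u v) es))"
      unfolding assms(2)[symmetric] by (simp only: mset_map[symmetric] prod_mset_prod_list)
    also have "map (edge_weight \<beta> \<gamma> ?s) (map (\<lambda>(u, v). Upair u v) es) = map (\<lambda>(u, v). interaction \<beta> \<gamma> (?s u) (?s v)) es"
      by auto
    finally have "?h (\<Prod>e\<in>#edges G. edge_weight \<beta> \<gamma> ?s e)
        = prod_list (map (\<lambda>e. ?h (case e of (u, v) \<Rightarrow> interaction \<beta> \<gamma> (?s u) (?s v))) es)"
      by (simp only: hp map_map comp_def)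
    also have "map (\<lambda>e. ?h (case e of (u, v) \<Rightarrow> interaction \<beta> \<gamma> (?s u) (?s v))) es = map (spin_wt (?h \<beta>) (?h \<gamma>) T) es"
    proof (rule map_cong[OF refl])
      fix e assume e: "e \<in> set es"
      obtain u v where uv: "e = (u, v)" by (cases e)
      have "u \<in> ?V" "v \<in> ?V" using ends e uv by auto
      then show "?h (case e of (u, v) \<Rightarrow> interaction \<beta> \<gamma> (?s u) (?s v)) = spin_wt (?h \<beta>) (?h \<gamma>) T e"
        by (simp add: uv interaction_def)
    qed
    finally show ?thesis .
  qed
  then show ?thesis
    unfolding partition_function_def sum_PiE_01[OF fin] by (simp add: hs)
qed

lemma partition_function_swap:
  assumes "wf_multigraph G"
  shows "partition_function \<beta> \<gamma> G = partition_function \<gamma> \<beta> G"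
  unfolding partition_function_def
proof (rule sum.reindex_bij_witness[where i = "\<lambda>\<sigma>. \<lambda>v\<in>verts G. 1 - \<sigma> v" and j = "\<lambda>\<sigma>. \<lambda>v\<in>verts G. 1 - \<sigma> v"])
  fix \<sigma> :: "'a \<Rightarrow> nat" assume s: "\<sigma> \<in> verts G \<rightarrow>\<^sub>E {0, 1}"
  have s01: "\<sigma> v = 0 \<or> \<sigma> v = 1" if "v \<in> verts G" for v using s that by (auto simp: PiE_iff)
  have "edge_weight \<gamma> \<beta> (\<lambda>v\<in>verts G. 1 - \<sigma> v) e = edge_weight \<beta> \<gamma> \<sigma> e" if "e \<in># edges G" for e
  proof (cases e)
    case (Upair u v)
    then have "u \<in> verts G" "v \<in> verts G" using that assms by (auto simp: wf_multigraph_def)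
    then show ?thesis using s01[of u] s01[of v] by (auto simp: Upair interaction_def)
  qed
  then show "(\<Prod>e\<in>#edges G. edge_weight \<gamma> \<beta> (\<lambda>v\<in>verts G. 1 - \<sigma> v) e) = (\<Prod>e\<in>#edges G. edge_weight \<beta> \<gamma> \<sigma> e)"
    by (intro arg_cong[where f = prod_mset] image_mset_cong)
next
  fix \<sigma> :: "'a \<Rightarrow> nat" assume s: "\<sigma> \<in> verts G \<rightarrow>\<^sub>E {0, 1}"
  then show "(\<lambda>v\<in>verts G. 1 - (\<lambda>v\<in>verts G. 1 - \<sigma> v) v) = \<sigma>"
    by (intro ext) (auto simp: PiE_iff extensional_def)
  from s show "(\<lambda>v\<in>verts G. 1 - (\<lambda>v\<in>verts G. 1 - \<sigma> v) v) = \<sigma>"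
    by (intro ext) (auto simp: PiE_iff extensional_def)
qed auto

section \<open>Input size and degree\<close>

lemma length_le_cells: "length xs \<le> cells (list_code f xs)"
  by (induction xs) auto

lemma cells_le_list_code: "x \<in> set xs \<Longrightarrow> cells (f x) \<le> cells (list_code f xs)"
  by (induction xs) auto

lemma bit_length_le_cells: "bit_length n \<le> cells (nat_code n)"
  unfolding bit_length_def nat_code_def by (rule length_le_cells)

lemma nbrs_le_degree: "length (nbrs u (noloop es)) \<le> length (filter (\<lambda>e. u \<in> set_uprod e) (map (\<lambda>(u, v). Upair u v) es))"
proof (induction es)
  case (Cons e es)
  then show ?case by (cases e) (auto simp: noloop_def)
qed (simp add: noloop_def)

lemma nbrs_le_max_degree:
  assumes "wf_multigraph G" "max_degree_le G \<Delta>" "mset (map (\<lambda>(u, v). Upair u v) es) = edges G"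
  shows "length (nbrs u (noloop es)) \<le> \<Delta>"
proof (cases "u \<in> verts G")
  case True
  have "length (filter (\<lambda>e. u \<in> set_uprod e) (map (\<lambda>(u, v). Upair u v) es)) = size {#e \<in># edges G. u \<in> set_uprod e#}"
    unfolding assms(3)[symmetric] by (metis mset_filter size_mset)
  also have "\<dots> \<le> vertex_degree G u" by (simp add: vertex_degree_def)
  also have "\<dots> \<le> \<Delta>" using assms(2) True by (simp add: max_degree_le_def)
  finally show ?thesis using nbrs_le_degree[of u es] by simp
next
  case False
  have "u \<notin> set_uprod e" if "e \<in> set (map (\<lambda>(u, v). Upair u v) es)" for e
  proof -
    have "e \<in># edges G" unfolding assms(3)[symmetric] using that by simp
    then show ?thesis using assms(1) False by (auto simp: wf_multigraph_def)
  qed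
  then have "\<forall>e\<in>set (map (\<lambda>(u, v). Upair u v) es). u \<notin> set_uprod e" by blast
  then have "filter (\<lambda>e. u \<in> set_uprod e) (map (\<lambda>(u, v). Upair u v) es) = []" by (rule filter_False)
  then show ?thesis using nbrs_le_degree[of u es] by simp
qed

section \<open>Approximation schemes\<close>

text \<open>A class closed under sums and products, so that the explicit running time never has to
  be expanded.\<close>

definition polyb :: "(nat \<Rightarrow> nat \<Rightarrow> nat) \<Rightarrow> bool" where
  "polyb f \<longleftrightarrow> (\<exists>c k. \<forall>n l. f n l \<le> c * (n + l + 1) ^ k)"

lemma polyb_const: "polyb (\<lambda>n l. m)"
  unfolding polyb_def by (rule exI[of _ m], rule exI[of _ 0]) simp

lemma polyb_fst: "polyb (\<lambda>n l. n)" and polyb_snd: "polyb (\<lambda>n l. l)"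
  unfolding polyb_def by (rule exI[of _ 1], rule exI[of _ 1], simp)+

lemma polyb_add:
  assumes "polyb f" "polyb g"
  shows "polyb (\<lambda>n l. f n l + g n l)"
proof -
  obtain c k c' k' where f: "\<And>n l. f n l \<le> c * (n + l + 1) ^ k" and g: "\<And>n l. g n l \<le> c' * (n + l + 1) ^ k'"
    using assms unfolding polyb_def by blast
  have "f n l + g n l \<le> (c + c') * (n + l + 1) ^ (k + k')" for n l
  proof -
    have "c * (n + l + 1) ^ k \<le> c * (n + l + 1) ^ (k + k')"
      "c' * (n + l + 1) ^ k' \<le> c' * (n + l + 1) ^ (k + k')"
      by (intro mult_left_mono power_increasing; simp)+
    then show ?thesis using f[of n l] g[of n l] unfolding distrib_right by linarith
  qed
  then show ?thesis unfolding polyb_def by blast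
qed

lemma polyb_mult:
  assumes "polyb f" "polyb g"
  shows "polyb (\<lambda>n l. f n l * g n l)"
proof -
  obtain c k c' k' where f: "\<And>n l. f n l \<le> c * (n + l + 1) ^ k" and g: "\<And>n l. g n l \<le> c' * (n + l + 1) ^ k'"
    using assms unfolding polyb_def by blast
  have "f n l * g n l \<le> (c * c') * (n + l + 1) ^ (k + k')" for n l
  proof -
    have "f n l * g n l \<le> (c * (n + l + 1) ^ k) * (c' * (n + l + 1) ^ k')"
      by (intro mult_mono f g) auto
    then show ?thesis by (simp only: power_add ac_simps)
  qed
  then show ?thesis unfolding polyb_def by blast
qed

lemmas polyb_intros = polyb_const polyb_fst polyb_snd polyb_add polyb_mult

text \<open>The power \<open>(d + 2) ^ l\<close> occurs in a single summand. Since it is at least 1,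
  all others may be multiplied by it, and what is left is polynomial in \<open>n\<close> and
  \<open>l\<close>.\<close>

lemma (in spin_algo) main_time_le:
  obtains C k where "\<And>n l d. main_time n l d \<le> C * (n + l + 1) ^ k * (d + 2) ^ l"
proof -
  define f where "f n l = (n + 1) * (3 * overhead l (2 * n) n + (l + 1) * horner_time l
     + 2 * ((2 * n + 1) * (120 * n + 250)) + 20 * (2 * n) + 180 * horner_bits l
     + 2 * zmul_time (c * (n + 1) + 1 + (n + 1) * (horner_bits l + 1)) + 500)
     + 2 * ((n + 1) * (60 * n + 200)) + 2 * ((n + 1) * (zmul_time (c * (n + 1) + 1) + 30))
     + (n + 1) * (60 * n + 100) + 2 * (n * (2 * K + 20)) + 20 * n
     + 20 * K + 10 * cells (int_code bn) + 10 * cells (int_code bd) + 500" for n l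
  have "polyb f"
    unfolding f_def overhead_def horner_time_def horner_bits_def zmul_time_def pin_time_def step_time_def
      scale_time_def pmul_time_def pdiv_time_def bits_at_def
    by (intro polyb_intros)
  then obtain C k where Ck: "\<And>n l. f n l \<le> C * (n + l + 1) ^ k"
    unfolding polyb_def by blast
  have le: "main_time n l d \<le> f n l * (d + 2) ^ l" for n l d
  proof -
    define X where "X = (d + 2) ^ l"
    have X: "X \<ge> 1" unfolding X_def by (rule one_le_power) simp
    have up: "u \<le> u * X" for u using X by simp
    define A where "A = 3 * overhead l (2 * n) n"
    define B where "B = (l + 1) * horner_time l
     + 2 * ((2 * n + 1) * (120 * n + 250)) + 20 * (2 * n) + 180 * horner_bits l
     + 2 * zmul_time (c * (n + 1) + 1 + (n + 1) * (horner_bits l + 1)) + 500"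
    define R where "R = 2 * ((n + 1) * (60 * n + 200)) + 2 * ((n + 1) * (zmul_time (c * (n + 1) + 1) + 30))
     + (n + 1) * (60 * n + 100) + 2 * (n * (2 * K + 20)) + 20 * n
     + 20 * K + 10 * cells (int_code bn) + 10 * cells (int_code bd) + 500"
    have m: "main_time n l d = (n + 1) * (A * X + B) + R"
      by (simp only: main_time_def outer_time_def A_def B_def R_def X_def add.assoc)
    have ff: "f n l = (n + 1) * (A + B) + R"
      by (simp only: f_def A_def B_def R_def add.assoc)
    have "A * X + B \<le> (A + B) * X" using up[of B] by (simp add: distrib_right)
    then have "(n + 1) * (A * X + B) \<le> (n + 1) * ((A + B) * X)" by (rule mult_left_mono) simp
    then have "main_time n l d \<le> (n + 1) * ((A + B) * X) + R * X" using up[of R] unfolding m by linarith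
    also have "\<dots> = f n l * X" unfolding ff by (simp add: algebra_simps)
    finally show ?thesis by (simp only: X_def)
  qed
  show ?thesis
  proof (rule that)
    fix n l d
    have "f n l * (d + 2) ^ l \<le> C * (n + l + 1) ^ k * (d + 2) ^ l"
      by (intro mult_right_mono Ck) simp
    then show "main_time n l d \<le> C * (n + l + 1) ^ k * (d + 2) ^ l"
      by (rule order_trans[OF le])
  qed
qed

section \<open>Truncation order against input size and accuracy\<close>

lemma fuel_le_log:
  fixes n a b K N :: nat
  assumes "n \<le> N" "4 \<le> N" "a > 0" "b > 0"
  shows "real (K * bit_length n + (K * (bit_length b - bit_length a) + 3 * K))
    \<le> 5 * real K * log 2 (real N + real b / real a)"
proof -
  define L where "L = log 2 (real N + real b / real a)"
  have s: "real b / real a > 0" using assms by simp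
  have "log 2 4 \<le> L" unfolding L_def using assms(2) s by (subst log_le_cancel_iff) auto
  moreover have "log 2 4 = (2::real)" using log_pow_cancel[of 2 2] by simp
  ultimately have L: "2 \<le> L" by simp
  have 1: "real (bit_length n) \<le> 1 + L"
  proof (cases "n = 0")
    case False
    then have "2 ^ bit_length n \<le> 2 * n" by (intro two_power_bit_length_le) auto
    then have "real (2 ^ bit_length n) \<le> real (2 * n)" by (simp only: of_nat_le_iff)
    then have "log 2 (2 ^ bit_length n) \<le> log 2 (2 * real n)" using False by (subst log_le_cancel_iff) auto
    also have "\<dots> = 1 + log 2 (real n)" using False by (simp add: log_mult)
    also have "log 2 (real n) \<le> L" unfolding L_def using False assms(1) s by (subst log_le_cancel_iff) auto
    finally show ?thesis by simp
  qed (use L in simp)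
  have 2: "real (bit_length b - bit_length a) \<le> 1 + L"
  proof (cases "bit_length b \<le> bit_length a")
    case False
    define \<delta> where "\<delta> = bit_length b - bit_length a"
    have "2 ^ \<delta> * a \<le> 2 ^ \<delta> * 2 ^ bit_length a"
      using less_two_power_bit_length[of a] by (intro mult_left_mono) auto
    also have "\<dots> = 2 ^ bit_length b" using False by (simp add: \<delta>_def flip: power_add)
    also have "\<dots> \<le> 2 * b" using assms by (intro two_power_bit_length_le) auto
    finally have "real (2 ^ \<delta> * a) \<le> real (2 * b)" by (simp only: of_nat_le_iff)
    then have "2 ^ \<delta> \<le> 2 * (real b / real a)" using assms by (simp add: field_simps)
    then have "log 2 (2 ^ \<delta>) \<le> log 2 (2 * (real b / real a))" using s by (subst log_le_cancel_iff) auto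
    also have "\<dots> = 1 + log 2 (real b / real a)" using s by (subst log_mult) auto
    also have "log 2 (real b / real a) \<le> L" unfolding L_def using s by (subst log_le_cancel_iff) auto
    finally show ?thesis by (simp add: \<delta>_def)
  qed (use L in simp)
  have "real (K * bit_length n + (K * (bit_length b - bit_length a) + 3 * K))
      = real K * (real (bit_length n) + real (bit_length b - bit_length a) + 3)"
    by (simp only: of_nat_add of_nat_mult of_nat_numeral) (simp add: algebra_simps)
  \<comment> \<open>The bracket is at most 2 L + 5, which L \<ge> 2 bounds by 5 L.\<close>
  also have "\<dots> \<le> real K * (5 * L)" using 1 2 L by (intro mult_left_mono) auto
  finally show ?thesis by (simp add: L_def)
qed

context spin_full
begin

text \<open>Degree bound \<open>d\<close> and time bound \<open>\<T>\<close> are left open, so that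
  both schemes share one correctness proof; \<open>time\<close> is asked only for orders
  \<open>l\<close> that the fuel can reach.\<close>

lemma approximates:
  fixes \<beta>' \<gamma>' :: rat
  assumes K: "tail_base ^ K \<ge> 2 * (1 + tail_const)" and bg: "\<beta> = of_rat \<beta>'" "\<gamma> = of_rat \<gamma>'"
    and bnd: "bd > 0" "\<beta>' = of_int bn / of_int bd"
    and wf: "\<And>G. G \<in> \<G> \<Longrightarrow> wf_multigraph G"
    and deg: "\<And>G es u. G \<in> \<G> \<Longrightarrow> mset (map (\<lambda>(u, v). Upair u v) es) = edges G \<Longrightarrow>
      length (nbrs u (noloop es)) \<le> d G"
    and time: "\<And>G N l s. G \<in> \<G> \<Longrightarrow> size (edges G) \<le> N \<Longrightarrow> 4 \<le> N \<Longrightarrow> 0 < s \<Longrightarrow>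
      real l \<le> 5 * real K * log 2 (real N + s) \<Longrightarrow> real (main_time N l (d G)) \<le> \<T> N s"
  shows "approximates_within prog (partition_function \<beta>' \<gamma>') \<G> \<T>"
  unfolding approximates_within_def
proof (intro ballI allI impI)
  fix G \<epsilon> g r
  assume G\<G>: "G \<in> \<G>" and \<epsilon>: "0 < \<epsilon>" "encodes_rat \<epsilon> r" and enc: "encodes_graph G g"
  note G = wf[OF G\<G>] enc
  let ?F = "partition_function \<beta>' \<gamma>' G"
  obtain vs es where vs: "distinct vs" "set vs = verts G" and es: "mset (map (\<lambda>(u, v). Upair u v) es) = edges G"
    and g: "g = Cell (list_code nat_code vs) (edges_code es)"
    using G(2) unfolding encodes_graph_def by blast
  obtain a b where b: "b > 0" and eps: "\<epsilon> = of_int a / of_nat b" and r: "r = Cell (int_code a) (nat_code b)"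
    using \<epsilon>(2) unfolding encodes_rat_def by blast
  have a: "a > 0" using \<epsilon>(1) b unfolding eps by (simp add: zero_less_divide_iff)
  define N where "N = cells (Cell g r)"
  have bl: "bit_length (nat a) \<le> cells (nat_code (nat a))" "bit_length b \<le> cells (nat_code b)"
    by (rule bit_length_le_cells)+
  have Nc: "N = 4 + cells (list_code nat_code vs) + cells (edges_code es) + cells (nat_code (nat a)) + cells (nat_code b)"
    using a by (simp add: N_def g r int_code_def bool_code_def)
  have blb: "bit_length b \<ge> 1" "bit_length (nat a) \<ge> 1" using b a by (simp_all add: bit_length_unfold)
  have N4: "4 \<le> N" using bl blb unfolding Nc by linarith
  have lv: "length vs \<le> N" "length es \<le> N"
    using length_le_cells[of vs nat_code] length_le_cells[of es "\<lambda>(u, v). Cell (nat_code u) (nat_code v)"] 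
    unfolding Nc by linarith+
  have below: "v < 2 ^ N" if "cells (nat_code v) \<le> N" for v
  proof -
    have "v < 2 ^ bit_length v" by (rule less_two_power_bit_length)
    also have "\<dots> \<le> 2 ^ N" using that bit_length_le_cells[of v] by (intro power_increasing) auto
    finally show ?thesis .
  qed
  have vsN: "\<forall>v\<in>set vs. v < 2 ^ N"
  proof
    fix v assume "v \<in> set vs"
    from cells_le_list_code[OF this, of nat_code] show "v < 2 ^ N" unfolding Nc by (intro below[unfolded Nc]) linarith
  qed
  have esN: "vertices_below (2 ^ N) es []"
    unfolding vertices_below_def
  proof (intro conjI ballI)
    fix e assume e: "e \<in> set es"
    obtain u v where uv: "e = (u, v)" by (cases e)
    have "cells (nat_code u) + cells (nat_code v) \<le> cells (edges_code es)"
      using cells_le_list_code[OF e, of "\<lambda>(u, v). Cell (nat_code u) (nat_code v)"] by (simp add: uv)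
    then have "cells (nat_code u) \<le> N" "cells (nat_code v) \<le> N" unfolding Nc by linarith+
    then show "case e of (x, y) \<Rightarrow> x < 2 ^ N \<and> y < 2 ^ N" using below by (simp add: uv)
  qed simp
  have blN: "bit_length (nat a) \<le> N" "bit_length b \<le> N" using bl unfolding Nc by linarith+
  define l where "l = K * bit_length (length vs) + (K * (bit_length b - bit_length (nat a)) + 3 * K)"
  define out where "out = outer l (noloop es) (looppins es) vs (bn ^ length es) (bd ^ length es)"
  have "does 0 [Cell g r] (main_time N l (d G)) (Cell (int_code (fst out)) (nat_code (nat \<bar>snd out\<bar>)))"
    unfolding g r l_def out_def
    by (rule does_main[OF lv vsN esN _ a blN]) (use deg[OF G\<G> es] in blast)
  then obtain t where t: "call prog 0 [Cell g r] = Some (t, Cell (int_code (fst out)) (nat_code (nat \<bar>snd out\<bar>)))"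
    "t \<le> main_time N l (d G)"
    unfolding does_def by blast
  have runs: "runs prog (Cell g r) t (Cell (int_code (fst out)) (nat_code (nat \<bar>snd out\<bar>)))"
    using t(1) unfolding call_def runs_def by (auto simp: ev_eq_Some_iff split: if_splits)
  have l_le: "real l \<le> 5 * real K * log 2 (real N + 1 / of_rat \<epsilon>)"
  proof -
    have "real l \<le> 5 * real K * log 2 (real N + real b / real (nat a))"
      unfolding l_def using lv(1) N4 a b by (intro fuel_le_log) auto
    moreover have "real b / real (nat a) = 1 / of_rat \<epsilon>"
      unfolding eps using a by (simp add: of_rat_divide)
    ultimately show ?thesis by simp
  qed
  have sz: "size (edges G) \<le> N" using lv(2) unfolding es[symmetric] by simp
  define z where "z = (of_int (fst out) / of_int (snd out) :: rat)"
  have fin: "finite (verts G)" using G(1) by (simp add: wf_multigraph_def)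
  have ends: "set es \<subseteq> set vs \<times> set vs"
  proof
    fix e assume e: "e \<in> set es"
    obtain u v where uv: "e = (u, v)" by (cases e)
    have "Upair u v \<in># edges G" unfolding es[symmetric] using e uv by force
    then show "e \<in> set vs \<times> set vs" using G(1) vs(2) by (auto simp: wf_multigraph_def uv)
  qed
  have out: "snd out > 0 \<and> complex_of_int (fst out) / of_int (snd out)
      = of_int (bn ^ length es) / of_int (bd ^ length es) * approx l es vs"
    unfolding out_def
    by (rule outer_value) (use vs ends bnd in \<open>auto simp: noloop_def wt_noloop_looppins[unfolded noloop_def]\<close>)
  moreover have "encodes_rat z (Cell (int_code (fst out)) (nat_code (nat \<bar>snd out\<bar>)))"
    unfolding encodes_rat_def z_def using out
    by (intro exI[of _ "fst out"] exI[of _ "nat \<bar>snd out\<bar>"]) auto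
  moreover have "\<bar>z - ?F\<bar> \<le> \<epsilon> * \<bar>?F\<bar>"
  proof -
    let ?h = "\<lambda>q. complex_of_real (of_rat q)"
    define Z where "Z = Z0 (set vs) es (1 / of_int cD)"
    have bc: "complex_of_real \<beta> = of_int bn / of_int bd" unfolding bg bnd(2) by (simp add: of_rat_divide)
    have bnz: "complex_of_real \<beta> \<noteq> 0" using \<beta>_nz by simp
    have w1: "of_int cA * (1 / of_int cD) = 1 / complex_of_real \<beta>"
      "of_int cG * (1 / of_int cD) = complex_of_real \<gamma> * 1"
      unfolding scaled_weights using cD_pos by simp_all
    have hz: "?h z = complex_of_real \<beta> ^ length es * approx l es vs"
      unfolding z_def using out by (simp add: of_rat_divide bc power_divide)
    have "?h ?F = (\<Sum>T\<in>Pow (set vs). prod_list (map (spin_wt (complex_of_real \<beta>) (complex_of_real \<gamma>) T) es))"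
      unfolding partition_function_eq_sum[OF G(1) es] bg vs(2) ..
    also have "\<dots> = (\<Sum>T\<in>Pow (set vs). complex_of_real \<beta> ^ length es * wt (1 / complex_of_real \<beta>) (complex_of_real \<gamma> * 1) es [] T)"
    proof (rule sum.cong[OF refl])
      fix T assume "T \<in> Pow (set vs)"
      then have "finite T" using finite_subset[of T "set vs"] by simp
      then show "prod_list (map (spin_wt (complex_of_real \<beta>) (complex_of_real \<gamma>) T) es)
          = complex_of_real \<beta> ^ length es * wt (1 / complex_of_real \<beta>) (complex_of_real \<gamma> * 1) es [] T"
        by (subst wt_eq_spin_wt[OF bnz]) simp_all
    qed
    also have "\<dots> = complex_of_real \<beta> ^ length es * Z"
      unfolding Z_def Z0_def Zsum_def w1 sum_distrib_left ..
    finally have hF: "?h ?F = complex_of_real \<beta> ^ length es * Z" .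
    have "cmod (approx l es vs - Z) \<le> ((1 + tail_const * (1 / tail_base) ^ l) ^ length vs - 1) * cmod Z"
      unfolding Z_def by (rule approx_error[OF _ ends order_refl vs(1)]) simp
    also have "\<dots> \<le> (real (nat a) / real b) * cmod Z"
      unfolding l_def using tail_base(1) tail_const_pos K a b by (intro mult_right_mono accuracy) auto
    also have "real (nat a) / real b = of_rat \<epsilon>" unfolding eps using a by (simp add: of_rat_divide)
    finally have e: "cmod (approx l es vs - Z) \<le> of_rat \<epsilon> * cmod Z" .
    have "?h z - ?h ?F = complex_of_real \<beta> ^ length es * (approx l es vs - Z)"
      unfolding hz hF by (simp add: algebra_simps)
    then have "cmod (?h z - ?h ?F) = cmod (complex_of_real \<beta> ^ length es) * cmod (approx l es vs - Z)"
      by (simp only: norm_mult)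
    also have "\<dots> \<le> cmod (complex_of_real \<beta> ^ length es) * (of_rat \<epsilon> * cmod Z)"
      by (rule mult_left_mono[OF e]) simp
    also have "\<dots> = of_rat \<epsilon> * cmod (?h ?F)"
      unfolding hF norm_mult by (simp only: ac_simps)
    finally have "cmod (?h (z - ?F)) \<le> of_rat \<epsilon> * cmod (?h ?F)"
      by (simp only: of_rat_diff of_real_diff)
    then have "real_of_rat \<bar>z - ?F\<bar> \<le> of_rat (\<epsilon> * \<bar>?F\<bar>)"
      by (simp only: norm_of_real abs_of_rat of_rat_mult)
    then show ?thesis by (simp only: of_rat_less_eq)
  qed
  moreover have "real t \<le> \<T> N (1 / of_rat \<epsilon>)"
  proof (rule order_trans)
    show "real t \<le> real (main_time N l (d G))" using t(2) by (simp only: of_nat_le_iff)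
    show "real (main_time N l (d G)) \<le> \<T> N (1 / of_rat \<epsilon>)"
      using \<epsilon>(1) by (intro time[OF G\<G> sz N4 _ l_le]) simp
  qed
  ultimately show "\<exists>t y z. runs prog (Cell g r) t y \<and> real t \<le> \<T> (cells (Cell g r)) (1 / real_of_rat \<epsilon>) \<and>
      encodes_rat z y \<and> \<bar>z - ?F\<bar> \<le> \<epsilon> * \<bar>?F\<bar>"
    using runs unfolding N_def by blast
qed

end

section \<open>Choice of the parameters and final time bounds\<close>

lemma spin_full_exists:
  fixes \<beta>' \<gamma>' :: rat
  assumes "\<bar>\<beta>'\<bar> > \<bar>\<gamma>'\<bar>" "\<bar>\<beta>' + \<gamma>'\<bar> > 2"
  obtains cA cG cD bn bd K c \<rho> where "spin_full cA cG cD bn bd c (of_rat \<beta>') (of_rat \<gamma>') \<rho>"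
    "spin_zero_free.tail_base \<rho> ^ K \<ge> 2 * (1 + spin_zero_free.tail_const \<rho>)"
    "bd > 0" "\<beta>' = of_int bn / of_int bd"
proof -
  obtain p q where pq: "quotient_of \<beta>' = (p, q)" by (cases "quotient_of \<beta>'")
  obtain s t where st: "quotient_of \<gamma>' = (s, t)" by (cases "quotient_of \<gamma>'")
  have q: "q > 0" "\<beta>' = of_int p / of_int q" using quotient_of_denom_pos[OF pq] quotient_of_div[OF pq] by auto
  have t: "t > 0" "\<gamma>' = of_int s / of_int t" using quotient_of_denom_pos[OF st] quotient_of_div[OF st] by auto
  have p: "p \<noteq> 0" using assms q by auto
  \<comment> \<open>The common denominator |p| t of 1 / \<beta> = q / p and \<gamma> = s / t, with
    the sign of p moved into the numerator to keep \<open>cD\<close> positive.\<close>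
  define cA where "cA = sgn p * q * t"
  define cG where "cG = s * \<bar>p\<bar>"
  define cD where "cD = \<bar>p\<bar> * t"
  define c where "c = nat (4 * \<bar>cA\<bar> + 4 * \<bar>cG\<bar> + \<bar>cD\<bar> + \<bar>p\<bar> + \<bar>q\<bar>)"
  have "int c < 2 ^ c" by (metis less_exp of_nat_less_iff of_nat_numeral of_nat_power)
  then have c: "4 * \<bar>cA\<bar> + 4 * \<bar>cG\<bar> + \<bar>cD\<bar> + \<bar>p\<bar> + \<bar>q\<bar> < 2 ^ c"
    unfolding c_def by simp
  have "\<bar>real_of_rat \<gamma>'\<bar> < \<bar>real_of_rat \<beta>'\<bar>"
    unfolding abs_of_rat of_rat_less by (rule assms(1))
  moreover have "\<bar>real_of_rat \<beta>' + real_of_rat \<gamma>'\<bar> > 2"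
  proof -
    have "real_of_rat 2 < real_of_rat \<bar>\<beta>' + \<gamma>'\<bar>" unfolding of_rat_less by (rule assms(2))
    then show ?thesis by (simp add: of_rat_add flip: abs_of_rat)
  qed
  ultimately obtain \<rho> :: real where \<rho>: "\<rho> > 1"
    "\<And>a b. cmod a \<le> \<rho> \<Longrightarrow> cmod b \<le> \<rho> \<Longrightarrow>
       complex_of_real (of_rat \<beta>') + a + b + complex_of_real (of_rat \<gamma>') * a * b \<noteq> 0"
    by (rule edge_polynomial_nonzero) (rule that; blast)
  have "spin_algo cA cG cD p q c"
    using c by unfold_locales linarith+
  moreover have "spin_zero_free cA cG cD (of_rat \<beta>') (of_rat \<gamma>') \<rho>"
  proof
    show "real_of_rat \<beta>' \<noteq> 0" using p q by simp
    show "cD > 0" using p t by (simp add: cD_def)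
    have "real_of_rat \<beta>' = real_of_int p / real_of_int q"
      unfolding q(2) by (simp add: of_rat_divide)
    then have "real_of_int cA * of_rat \<beta>' = real_of_int (p * sgn p) * real_of_int t"
      unfolding cA_def using q(1) by simp
    also have "\<dots> = real_of_int cD" unfolding cD_def by (simp only: abs_sgn of_int_mult)
    finally show "real_of_int cA * of_rat \<beta>' = real_of_int cD" .
    show "real_of_int cG = of_rat \<gamma>' * real_of_int cD"
      using t by (simp add: cG_def cD_def of_rat_divide)
  qed (use \<rho> in auto)
  ultimately have full: "spin_full cA cG cD p q c (of_rat \<beta>') (of_rat \<gamma>') \<rho>"
    unfolding spin_full_def by blast
  \<comment> \<open>\<open>K\<close> is yet to be chosen. The constants \<open>tail_base\<close> and
    \<open>tail_const\<close> do not depend on it, so 0 serves as a placeholder.\<close>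
  interpret spin_zero_free cA cG cD p q 0 "of_rat \<beta>'" "of_rat \<gamma>'" \<rho> by fact
  obtain K where "2 * (1 + tail_const) < tail_base ^ K"
    using real_arch_pow[OF tail_base(1)] by blast
  then show thesis using that[OF full] q by (auto intro: less_imp_le)
qed

lemma poly_base_le:
  assumes "4 \<le> N" "0 < s" "real l \<le> 5 * real K * log 2 (real N + s)"
  shows "real (N + l + 1) \<le> (5 * real K + 2) * (real N + s)"
proof -
  let ?X = "real N + s"
  have X: "?X \<ge> 4" using assms(1,2) by simp
  have "log 2 ?X \<le> ?X"
  proof -
    define m where "m = nat \<lfloor>?X\<rfloor>"
    have m: "real m \<le> ?X" "?X < real m + 1" "m \<ge> 1" using X unfolding m_def by linarith+
    have "Suc m \<le> 2 ^ m" using less_exp[of m] by linarith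
    then have "real (Suc m) \<le> real (2 ^ m)" by (simp only: of_nat_le_iff)
    then have "?X \<le> 2 ^ m" using m by simp
    then have "log 2 ?X \<le> log 2 (2 ^ m)" using X by (subst log_le_cancel_iff) auto
    then show ?thesis using m(1) by simp
  qed
  then have "5 * real K * log 2 ?X \<le> 5 * real K * ?X" by (intro mult_left_mono) auto
  then have "real l \<le> 5 * real K * ?X" using assms(3) by linarith
  then show ?thesis using X assms(2) by (simp add: algebra_simps)
qed

text \<open>For fixed d and l at most 5 K log X, the power (d + 2)^l is at most X^(5 K log (d + 2)),
  a polynomial in X = N + s.\<close>

lemma time_bound_bounded_degree:
  fixes C k d K :: nat
  shows "\<exists>c' k'. \<forall>N l s. 4 \<le> N \<longrightarrow> 0 < s \<longrightarrow> real l \<le> 5 * real K * log 2 (real N + s) \<longrightarrow>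
    real (C * (N + l + 1) ^ k * (d + 2) ^ l) \<le> c' * (real N + s) ^ k'"
proof -
  define M where "M = nat \<lceil>5 * real K * log 2 (real (d + 2))\<rceil>"
  have "real (C * (N + l + 1) ^ k * (d + 2) ^ l) \<le> (real C * (5 * real K + 2) ^ k) * (real N + s) ^ (k + M)"
    if N: "4 \<le> N" and s: "0 < s" and l: "real l \<le> 5 * real K * log 2 (real N + s)" for N l :: nat and s
  proof -
    let ?X = "real N + s"
    have X: "?X \<ge> 4" using N s by simp
    have base: "real (N + l + 1) \<le> (5 * real K + 2) * ?X"
      using poly_base_le[OF N s l] .
    have "real ((d + 2) ^ l) = 2 powr (log 2 (real (d + 2)) * real l)"
      by (simp add: powr_realpow[symmetric] powr_powr[symmetric])
    also have "\<dots> \<le> 2 powr (log 2 (real (d + 2)) * (5 * real K * log 2 ?X))"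
      using l by (intro powr_mono mult_left_mono) auto
    also have "\<dots> = 2 powr (log 2 ?X * (5 * real K * log 2 (real (d + 2))))"
      by (simp only: ac_simps)
    also have "\<dots> = ?X powr (5 * real K * log 2 (real (d + 2)))"
      unfolding powr_powr[symmetric] using X by simp
    also have "\<dots> \<le> ?X powr real M"
      using X unfolding M_def by (intro powr_mono) linarith+
    also have "\<dots> = ?X ^ M" using X by (simp add: powr_realpow)
    finally have pw: "real ((d + 2) ^ l) \<le> ?X ^ M" .
    have "real (C * (N + l + 1) ^ k * (d + 2) ^ l) = real C * real (N + l + 1) ^ k * real ((d + 2) ^ l)"
      by (simp only: of_nat_mult of_nat_power)
    also have "\<dots> \<le> real C * ((5 * real K + 2) * ?X) ^ k * ?X ^ M"
      using base pw X by (intro mult_mono power_mono) auto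
    also have "\<dots> = (real C * (5 * real K + 2) ^ k) * ?X ^ (k + M)"
      by (simp only: power_mult_distrib power_add ac_simps)
    finally show ?thesis .
  qed
  then show ?thesis by blast
qed

text \<open>Now d is only bounded by N, so (d + 2)^l is at most X^(2 l) and its logarithm is
  quadratic in log X. The exponent \<open>k'\<close> is therefore 2.\<close>

lemma time_bound_unbounded_degree:
  fixes C k K :: nat
  shows "\<exists>c' k'. \<forall>N l d s. 4 \<le> N \<longrightarrow> 0 < s \<longrightarrow> d \<le> N \<longrightarrow> real l \<le> 5 * real K * log 2 (real N + s) \<longrightarrow>
    real (C * (N + l + 1) ^ k * (d + 2) ^ l) \<le> 2 powr (c' * log 2 (real N + s) ^ k')"
proof -
  \<comment> \<open>\<open>C + 1\<close> in place of \<open>C\<close> ensures B \<ge> 1, so that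
    \<open>log 2 B\<close> is nonnegative and can be absorbed into the coefficient of the squared
    logarithm.\<close>
  define B where "B = (real C + 1) * (5 * real K + 2) ^ k"
  have B: "B \<ge> 1" unfolding B_def by (intro mult_ge1_I one_le_power) auto
  have "real (C * (N + l + 1) ^ k * (d + 2) ^ l) \<le> 2 powr ((log 2 B + real k + 10 * real K) * log 2 (real N + s) ^ 2)"
    if N: "4 \<le> N" and s: "0 < s" and d: "d \<le> N" and l: "real l \<le> 5 * real K * log 2 (real N + s)" for N l d :: nat and s
  proof -
    let ?X = "real N + s"
    define L where "L = log 2 ?X"
    have X: "?X \<ge> 4" using N s by simp
    have X2: "?X = 2 powr L" using X by (simp add: L_def)
    have "log 2 4 \<le> L" unfolding L_def using X by (subst log_le_cancel_iff) auto
    moreover have "log 2 4 = (2::real)" using log_pow_cancel[of 2 2] by simp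
    ultimately have L: "L \<ge> 1" by simp
    have base: "real (N + l + 1) \<le> (5 * real K + 2) * ?X"
      using poly_base_le[OF N s l] .
    have "real (d + 2) \<le> 2 * ?X" using d N s by simp
    also have "\<dots> \<le> ?X * ?X" using X by (intro mult_right_mono) auto
    also have "\<dots> = 2 powr (2 * L)" unfolding X2 by (simp add: powr_add[symmetric])
    finally have "real (d + 2) ^ l \<le> (2 powr (2 * L)) ^ l" by (intro power_mono) auto
    also have "\<dots> = 2 powr (2 * L * real l)" by (simp add: powr_realpow[symmetric] powr_powr)
    also have "\<dots> \<le> 2 powr (2 * L * (5 * real K * L))"
      using l L unfolding L_def[symmetric] by (intro powr_mono mult_left_mono) auto
    also have "2 * L * (5 * real K * L) = 10 * real K * L ^ 2" by (simp add: power2_eq_square)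
    finally have pw: "real ((d + 2) ^ l) \<le> 2 powr (10 * real K * L ^ 2)" by (simp only: of_nat_power)
    have "real (C * (N + l + 1) ^ k * (d + 2) ^ l) = real C * real (N + l + 1) ^ k * real ((d + 2) ^ l)"
      by (simp only: of_nat_mult of_nat_power)
    also have "\<dots> \<le> (real C + 1) * ((5 * real K + 2) * ?X) ^ k * 2 powr (10 * real K * L ^ 2)"
      using base pw X by (intro mult_mono power_mono) auto
    also have "\<dots> = B * ?X ^ k * 2 powr (10 * real K * L ^ 2)"
      by (simp only: power_mult_distrib B_def ac_simps)
    also have "\<dots> = 2 powr (log 2 B + L * real k + 10 * real K * L ^ 2)"
      using B unfolding X2 by (simp add: powr_add powr_realpow[symmetric] powr_powr)
    also have "\<dots> \<le> 2 powr ((log 2 B + real k + 10 * real K) * L ^ 2)"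
    proof (rule powr_mono)
      have LL: "L \<le> L ^ 2" "1 \<le> L ^ 2" using L by (simp_all add: power2_eq_square mult_ge1_I)
      have "0 \<le> log 2 B" using B by simp
      then have "log 2 B * 1 \<le> log 2 B * L ^ 2" using LL by (intro mult_left_mono) auto
      moreover have "L * real k \<le> real k * L ^ 2" using LL by (subst mult.commute) (intro mult_left_mono, auto)
      ultimately show "log 2 B + L * real k + 10 * real K * L ^ 2 \<le> (log 2 B + real k + 10 * real K) * L ^ 2"
        unfolding distrib_right by linarith
    qed simp
    finally show ?thesis by (simp only: L_def)
  qed
  then show ?thesis by blast
qed

theorem schemes_of_dominant:
  fixes \<beta>' \<gamma>' :: rat
  assumes "\<bar>\<beta>'\<bar> > \<bar>\<gamma>'\<bar>" "\<bar>\<beta>' + \<gamma>'\<bar> > 2"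
  shows "has_FPTAS (partition_function \<beta>' \<gamma>') {G. wf_multigraph G \<and> max_degree_le G \<Delta>}"
    "has_QPTAS (partition_function \<beta>' \<gamma>') {G. wf_multigraph G}"
proof -
  obtain cA cG cD bn bd K c \<rho> where full: "spin_full cA cG cD bn bd c (of_rat \<beta>') (of_rat \<gamma>') \<rho>"
    and K: "spin_zero_free.tail_base \<rho> ^ K \<ge> 2 * (1 + spin_zero_free.tail_const \<rho>)"
    and bnd: "bd > 0" "\<beta>' = of_int bn / of_int bd"
    using spin_full_exists[OF assms] .
  interpret spin_full cA cG cD bn bd K c "of_rat \<beta>'" "of_rat \<gamma>'" \<rho> by fact
  obtain C k where Ck: "\<And>n l d. main_time n l d \<le> C * (n + l + 1) ^ k * (d + 2) ^ l"
    by (rule main_time_le) (rule that; blast)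
  have le: "real (main_time N l d) \<le> real (C * (N + l + 1) ^ k * (d + 2) ^ l)" for N l d
    using Ck by (simp only: of_nat_le_iff)
  note approx = approximates[OF K refl refl bnd]
  obtain c' k' where T: "\<And>N l s. 4 \<le> N \<Longrightarrow> 0 < s \<Longrightarrow> real l \<le> 5 * real K * log 2 (real N + s) \<Longrightarrow>
      real (C * (N + l + 1) ^ k * (\<Delta> + 2) ^ l) \<le> c' * (real N + s) ^ k'"
    using time_bound_bounded_degree[of K C k \<Delta>] by blast
  have "approximates_within prog (partition_function \<beta>' \<gamma>') {G. wf_multigraph G \<and> max_degree_le G \<Delta>}
      (\<lambda>n s. c' * (real n + s) ^ k')"
  proof (rule approx[where d = "\<lambda>_. \<Delta>"])
    show "real (main_time N l \<Delta>) \<le> c' * (real N + s) ^ k'"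
      if "4 \<le> N" "0 < s" "real l \<le> 5 * real K * log 2 (real N + s)" for N l s
      by (rule order_trans[OF le T[OF that]])
    show "length (nbrs u (noloop es)) \<le> \<Delta>"
      if "G \<in> {G. wf_multigraph G \<and> max_degree_le G \<Delta>}" "mset (map (\<lambda>(u, v). Upair u v) es) = edges G" for G es u
      using that by (intro nbrs_le_max_degree) auto
  qed auto
  then show "has_FPTAS (partition_function \<beta>' \<gamma>') {G. wf_multigraph G \<and> max_degree_le G \<Delta>}"
    unfolding has_FPTAS_def by blast
  obtain c' k' where T: "\<And>N l d s. 4 \<le> N \<Longrightarrow> 0 < s \<Longrightarrow> d \<le> N \<Longrightarrow> real l \<le> 5 * real K * log 2 (real N + s) \<Longrightarrow>
      real (C * (N + l + 1) ^ k * (d + 2) ^ l) \<le> 2 powr (c' * log 2 (real N + s) ^ k')"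
    using time_bound_unbounded_degree[of K C k] by blast
  have "approximates_within prog (partition_function \<beta>' \<gamma>') {G. wf_multigraph G}
      (\<lambda>n s. 2 powr (c' * log 2 (real n + s) ^ k'))"
  proof (rule approx[where d = "\<lambda>G. size (edges G)"])
    show "real (main_time N l (size (edges G))) \<le> 2 powr (c' * log 2 (real N + s) ^ k')"
      if "size (edges G) \<le> N" "4 \<le> N" "0 < s" "real l \<le> 5 * real K * log 2 (real N + s)" for G :: "nat multigraph" and N l s
      by (rule order_trans[OF le T[OF that(2,3,1,4)]])
    show "length (nbrs u (noloop es)) \<le> size (edges G)"
      if "mset (map (\<lambda>(u, v). Upair u v) es) = edges G" for G :: "nat multigraph" and es u
    proof -
      have "length (nbrs u (noloop es)) \<le> length (noloop es)"
        using length_rest_nbrs[of u "noloop es"] by linarith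
      also have "\<dots> \<le> length es" by (simp add: noloop_def)
      also have "\<dots> = size (edges G)" unfolding that[symmetric] by simp
      finally show ?thesis .
    qed
  qed auto
  then show "has_QPTAS (partition_function \<beta>' \<gamma>') {G. wf_multigraph G}"
    unfolding has_QPTAS_def by blast
qed

lemma approximates_within_cong:
  "(\<And>G. G \<in> \<G> \<Longrightarrow> F G = F' G) \<Longrightarrow> approximates_within p F \<G> T = approximates_within p F' \<G> T"
  unfolding approximates_within_def by simp

theorem theorem2:
  fixes \<beta> \<gamma> :: rat
  assumes "\<beta> \<noteq> \<gamma>" and "\<bar>\<beta> + \<gamma>\<bar> > 2"
  shows "(\<forall>\<Delta>::nat. \<Delta> > 0 \<longrightarrow>
            has_FPTAS (partition_function \<beta> \<gamma>) {G. wf_multigraph G \<and> max_degree_le G \<Delta>})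
         \<and> has_QPTAS (partition_function \<beta> \<gamma>) {G. wf_multigraph G}"
proof (cases "\<bar>\<beta>\<bar> > \<bar>\<gamma>\<bar>")
  case True
  then show ?thesis using schemes_of_dominant[OF True assms(2)] by blast
next
  case False
  \<comment> \<open>Equal absolute values are impossible: \<beta> = \<gamma> is excluded directly,
    and \<beta> = -\<gamma> would make the sum 0.\<close>
  then have gt: "\<bar>\<gamma>\<bar> > \<bar>\<beta>\<bar>" "\<bar>\<gamma> + \<beta>\<bar> > 2" using assms by (auto simp: abs_if split: if_splits)
  have swap: "approximates_within p (partition_function \<gamma> \<beta>) \<G> T = approximates_within p (partition_function \<beta> \<gamma>) \<G> T"
    if "\<G> \<subseteq> {G. wf_multigraph G}" for p \<G> T
    using that partition_function_swap by (intro approximates_within_cong) auto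
  have "has_FPTAS (partition_function \<beta> \<gamma>) {G. wf_multigraph G \<and> max_degree_le G \<Delta>}" for \<Delta>
    using schemes_of_dominant(1)[OF gt, of \<Delta>] unfolding has_FPTAS_def
    by (subst (asm) swap) auto
  moreover have "has_QPTAS (partition_function \<beta> \<gamma>) {G. wf_multigraph G}"
    using schemes_of_dominant(2)[OF gt] unfolding has_QPTAS_def
    by (subst (asm) swap) auto
  ultimately show ?thesis by blast
qed

end
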